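(* Assume the tree matrix is transient, and let $r_1\in S_r$ be a successor of the root with $\mu(\bar\partial_\infty)>0$, where $\bar\partial_\infty=\partial_\infty(r_1)$. Fix $\xi\in\bar\partial_\infty^{reg}=\partial_\infty^{reg}\cap\bar\partial_\infty$ and consider two independent random elements $\bar\Xi^\xi$ and $\Xi^\mu$ ($\Xi^\mu$ is a copy of the process $\Xi$ with initial distribution $\mu$, and $\bar\Xi^\xi$ a copy of the process $\bar\Xi$ started at $\xi$, with lifetime $\bar\Upsilon$). Let $B$ be a Bernoulli variable with $\mathbb P\{B=1\}=1-G_1(\xi)/G_0$, independent of $\Xi^\mu$ and $\bar\Xi^\xi$. Then the process $$\widetilde\Xi^\xi_t=\begin{cases}\bar\Xi^\xi_t&\text{if }t<\bar\Upsilon,\\ \dag&\text{if }t\ge\bar\Upsilon\text{ and }B=0,\\ \Xi^\mu_{t-\bar\Upsilon}&\text{otherwise}\end{cases}$$ is a Markov process which is a copy of $\Xi^\xi$ (that is, $\widetilde\Xi^\xi$ and $\Xi^\xi$, the process $\Xi$ started at $\xi$, are identically distributed).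
   Context: Tree and matrix. $(I,\mathcal T)$ is a connected, locally finite, non-oriented tree with countably infinite set of sites $I$ and root $r$, every branch being infinite (each site has at least one successor). $|i|$ is the distance from $i$ to $r$; $i^-$ ($i\ne r$) is the neighbour of $i$ closer to $r$; $S_i=\{j:j^-=i\}$. $w:\mathbb N=\{0,1,\dots\}\to(0,\infty)$ is strictly increasing, $w_{-1}=0$, $\Delta_n(w)=w_n-w_{n-1}$ for $n\ge0$. The tree matrix is $U_{ij}=w_{|i\wedge j|}$, $i\wedge j$ being the common vertex, farthest from $r$, of the geodesics from $r$ to $i$ and $j$. The matrix $Q$ is: $Q_{ii^-}=Q_{i^-i}=(w_{|i|}-w_{|i|-1})^{-1}$ for $i\neq r$, $Q_{ii}=-\big((w_{|i|}-w_{|i|-1})^{-1}+|S_i|(w_{|i|+1}-w_{|i|})^{-1}\big)$, and $0$ otherwise. Boundary. $\partial_\infty$ is the set of infinite geodesic rays $\xi=(\xi(n))_{n\ge0}$ with $\xi(0)=r$, $\xi(n+1)\in S_{\xi(n)}$, with the compact topology generated by the sets $\partial_\infty(i)=\{\xi:\xi(|i|)=i\}$; $C^n(\xi)=\partial_\infty(\xi(n))$. $|\xi\wedge\eta|=\max\{n:\xi(n)=\eta(n)\}$ for $\xi\neq\eta$ and $|\xi\wedge\xi|=\infty$. Process in the tree. $X$ is the minimal continuous-time Markov chain on $I$ with $q$-matrix $Q$, absorbed from $r$ at rate $1/w_0$ in an extra state $\partial_r$ (absorption time $T_{\partial_r}$); $\zeta$ is its lifetime; $X_\zeta=\partial_r$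 if absorption occurs, and otherwise $X_\zeta\in\partial_\infty$ is the a.s. existing limit of $X_t$ as $t\uparrow\zeta$. Transient means $\mathbb P_r\{X_\zeta\in\partial_\infty\}>0$; $\mu(\cdot)=\mathbb P_r\{X_\zeta\in\cdot\mid X_\zeta\in\partial_\infty\}$. A point $\eta\in\partial_\infty$ is regular if $\lim_{j\to\eta}\mathbb P_j\{T_{\partial_r}<\infty\}=0$; $\partial_\infty^{reg}$ is the set of regular points (of full $\mu$-measure). $G_n(\xi)=\sum_{k\ge n}\Delta_k(w)\mu(C^k(\xi))$; on $\partial^{reg}_\infty$ it is positive, $G_0$ is constant and $G_n(\xi)$ depends only on $\xi(n-1)$ for $n\ge1$. Process $\Xi$ in the boundary. $(\Xi_t:0\le t\le\Upsilon)$ is the right-continuous with left limits Markov process on $\partial_\infty^{reg}$, with lifetime $\Upsilon$ and coffin state $\dag$ (the process equals $\dag$ from time $\Upsilon$ on), with sub-Markov transition density with respect to $\mu$ $$p(t,\xi,\eta)=\sum_{n=0}^{|\xi\wedge\eta|}\frac{e^{-t/G_n(\xi)}-e^{-t/G_{n+1}(\xi)}}{\mu(C^n(\xi))}.$$ Process $\bar\Xi$. This is the analogous process for the subtree $\bar I=\{i\in I: r_1\text{ lies on the geodesic from }r\text{ to }i\}$ rooted at $r_1$, with boundary $\bar\partial_\infty$, probability measure $\bar\mu=\mu(\bullet|\bar\partial_\infty)$, $\bar C^n(\xi)=C^{n+1}(\xi)$, and weights $\bar w$ defined by $\bar w_{-1}=0$, $\bar w_k-\bar w_{k-1}=\mu(\bar\partial_\infty)\Delta_{k+1}(w)$,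 $k\ge0$; then $\bar G_n=\sum_{k\ge n}(\bar w_k-\bar w_{k-1})\bar\mu(\bar C^k)=G_{n+1}$. Explicitly, $(\bar\Xi_t:0\le t\le\bar\Upsilon)$ is the right-continuous with left limits Markov process on $\bar\partial^{reg}_\infty$, with lifetime $\bar\Upsilon$, with transition density with respect to $\bar\mu$ $$\bar p(t,\xi,\eta)=\sum_{n=0}^{|\xi\wedge\eta|-1}\frac{e^{-t/\bar G_n(\xi)}-e^{-t/\bar G_{n+1}(\xi)}}{\bar\mu(\bar C^n(\xi))}.$$ *)

theory Defs
  imports "HOL-Probability.Probability"
begin

section \<open>Weighted rooted trees\<close>

record 'i tree_data =
  sites :: "'i set"
  adj :: "'i \<Rightarrow> 'i \<Rightarrow> bool"
  origin :: 'i
  weight :: "nat \<Rightarrow> real"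

definition path_between :: "('i, 'm) tree_data_scheme \<Rightarrow> 'i \<Rightarrow> 'i \<Rightarrow> 'i list \<Rightarrow> bool" where
  "path_between T i j xs \<longleftrightarrow> xs \<noteq> [] \<and> hd xs = i \<and> last xs = j \<and> set xs \<subseteq> sites T \<and>
     distinct xs \<and> successively (adj T) xs"

definition geodesic :: "('i, 'm) tree_data_scheme \<Rightarrow> 'i \<Rightarrow> 'i \<Rightarrow> 'i list" where
  "geodesic T i j = (THE xs. path_between T i j xs)"

definition depth :: "('i, 'm) tree_data_scheme \<Rightarrow> 'i \<Rightarrow> nat" where
  "depth T i = length (geodesic T (origin T) i) - 1"

definition parent :: "('i, 'm) tree_data_scheme \<Rightarrow> 'i \<Rightarrow> 'i" where
  "parent T i = (THE j. adj T i j \<and> depth T j < depth T i)"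

definition successors :: "('i, 'm) tree_data_scheme \<Rightarrow> 'i \<Rightarrow> 'i set" where
  "successors T i = {j \<in> sites T. j \<noteq> origin T \<and> parent T j = i}"

text \<open>
  A tree is a simple graph in which any two vertices are joined by exactly one path, that is,
  a connected graph without cycles.
\<close>

definition weighted_tree :: "('i, 'm) tree_data_scheme \<Rightarrow> bool" where
  "weighted_tree T \<longleftrightarrow>
     countable (sites T) \<and> infinite (sites T) \<and> origin T \<in> sites T \<and>
     (\<forall>i j. adj T i j \<longrightarrow> i \<in> sites T \<and> j \<in> sites T \<and> i \<noteq> j \<and> adj T j i) \<and>
     (\<forall>i\<in>sites T. \<forall>j\<in>sites T. \<exists>!xs. path_between T i j xs) \<and>
     (\<forall>i\<in>sites T. finite {j. adj T i j}) \<and>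
     (\<forall>i\<in>sites T. successors T i \<noteq> {}) \<and>
     strict_mono (weight T) \<and> (\<forall>n. 0 < weight T n)"

text \<open>The increments of a weight sequence, with the convention that its value at \<open>-1\<close> is \<open>0\<close>.\<close>

definition increment :: "(nat \<Rightarrow> real) \<Rightarrow> nat \<Rightarrow> real" where
  "increment w n = (if n = 0 then w 0 else w n - w (n - 1))"

definition qmatrix :: "('i, 'm) tree_data_scheme \<Rightarrow> 'i \<Rightarrow> 'i \<Rightarrow> real" where
  "qmatrix T i j =
     (if i \<noteq> origin T \<and> j = parent T i then inverse (increment (weight T) (depth T i))
      else if j \<noteq> origin T \<and> i = parent T j then inverse (increment (weight T) (depth T j))
      else if i = j then
        - (inverse (increment (weight T) (depth T i)) +
           real (card (successors T i)) * inverse (increment (weight T) (depth T i + 1)))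
      else 0)"


section \<open>The boundary\<close>

definition boundary :: "('i, 'm) tree_data_scheme \<Rightarrow> (nat \<Rightarrow> 'i) set" where
  "boundary T = {\<xi>. \<xi> 0 = origin T \<and> (\<forall>n. \<xi> (Suc n) \<in> successors T (\<xi> n))}"

definition boundary_at :: "('i, 'm) tree_data_scheme \<Rightarrow> 'i \<Rightarrow> (nat \<Rightarrow> 'i) set" where
  "boundary_at T i = {\<xi> \<in> boundary T. \<xi> (depth T i) = i}"

definition cell :: "('i, 'm) tree_data_scheme \<Rightarrow> nat \<Rightarrow> (nat \<Rightarrow> 'i) \<Rightarrow> (nat \<Rightarrow> 'i) set" where
  "cell T n \<xi> = boundary_at T (\<xi> n)"

definition meet :: "(nat \<Rightarrow> 'i) \<Rightarrow> (nat \<Rightarrow> 'i) \<Rightarrow> enat" where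
  "meet \<xi> \<eta> = (if \<xi> = \<eta> then \<infinity> else enat (Max {n. \<xi> n = \<eta> n}))"

definition boundary_top :: "('i, 'm) tree_data_scheme \<Rightarrow> (nat \<Rightarrow> 'i) topology" where
  "boundary_top T = topology_generated_by (boundary_at T ` sites T)"

definition borel_of_top :: "'a topology \<Rightarrow> 'a measure" where
  "borel_of_top X = sigma (topspace X) {U. openin X U}"

definition boundary_borel :: "('i, 'm) tree_data_scheme \<Rightarrow> (nat \<Rightarrow> 'i) measure" where
  "boundary_borel T = borel_of_top (boundary_top T)"

text \<open>
  The filter of the neighbourhoods of \<open>\<eta>\<close> in the compactified tree, traced on the sites: these
  are generated by the sets of all sites \<open>j\<close> whose geodesic from the root passes through \<open>\<eta> n\<close>.
\<close>

definition toward :: "('i, 'm) tree_data_scheme \<Rightarrow> (nat \<Rightarrow> 'i) \<Rightarrow> 'i filter" where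
  "toward T \<eta> = (INF n. principal {j \<in> sites T. \<eta> n \<in> set (geodesic T (origin T) j)})"


section \<open>The minimal chain in the tree\<close>

text \<open>
  The chain is realised on its canonical space by its jump chain and holding times.  States are
  \<open>Some i\<close> for a site \<open>i\<close>, and \<open>None\<close> for the absorbing state adjacent to the root.  A sample
  point \<open>(y, e)\<close> consists of the trajectory \<open>y\<close> of the jump chain and of an independent sequence
  \<open>e\<close> of independent exponential variables of parameter 1; the \<open>n\<close>-th holding time
  is \<open>e n\<close> divided by the total jump rate of \<open>y n\<close>.
\<close>

type_synonym 'i sample = "(nat \<Rightarrow> 'i option) \<times> (nat \<Rightarrow> real)"

definition states :: "('i, 'm) tree_data_scheme \<Rightarrow> 'i option set" where
  "states T = insert None (Some ` sites T)"

fun rate :: "('i, 'm) tree_data_scheme \<Rightarrow> 'i option \<Rightarrow> real" where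
  "rate T None = 0"
| "rate T (Some i) = - qmatrix T i i"

fun jump_prob :: "('i, 'm) tree_data_scheme \<Rightarrow> 'i option \<Rightarrow> 'i option \<Rightarrow> real" where
  "jump_prob T None s = (if s = None then 1 else 0)"
| "jump_prob T (Some i) None = (if i = origin T then inverse (weight T 0) / rate T (Some i) else 0)"
| "jump_prob T (Some i) (Some j) = (if i = j then 0 else qmatrix T i j / rate T (Some i))"

definition jump_measure :: "('i, 'm) tree_data_scheme \<Rightarrow> 'i option \<Rightarrow> 'i option measure" where
  "jump_measure T s = density (count_space (states T)) (\<lambda>s'. ennreal (jump_prob T s s'))"

definition jump_kernel ::
  "('i, 'm) tree_data_scheme \<Rightarrow> 'i \<Rightarrow> nat \<Rightarrow> (nat \<Rightarrow> 'i option) \<Rightarrow> 'i option measure" where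
  "jump_kernel T i n y =
     (case n of 0 \<Rightarrow> return (count_space (states T)) (Some i) | Suc m \<Rightarrow> jump_measure T (y m))"

text \<open>The law of the jump chain started at \<open>i\<close>, given by the Ionescu-Tulcea theorem.\<close>

definition jump_chain_law :: "('i, 'm) tree_data_scheme \<Rightarrow> 'i \<Rightarrow> (nat \<Rightarrow> 'i option) measure" where
  "jump_chain_law T i =
     projective_family.lim UNIV
       (Ionescu_Tulcea.CI (jump_kernel T i) (\<lambda>_. count_space (states T)))
       (\<lambda>_. count_space (states T))"

definition chain_law :: "('i, 'm) tree_data_scheme \<Rightarrow> 'i \<Rightarrow> 'i sample measure" where
  "chain_law T i =
     jump_chain_law T i \<Otimes>\<^sub>M PiM UNIV (\<lambda>_. density lborel (exponential_density 1))"

definition holding_time :: "('i, 'm) tree_data_scheme \<Rightarrow> 'i sample \<Rightarrow> nat \<Rightarrow> ennreal" where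
  "holding_time T \<omega> n = ennreal (snd \<omega> n) / ennreal (rate T (fst \<omega> n))"

definition jump_time :: "('i, 'm) tree_data_scheme \<Rightarrow> 'i sample \<Rightarrow> nat \<Rightarrow> ennreal" where
  "jump_time T \<omega> n = (\<Sum>k<n. holding_time T \<omega> k)"

definition explosion_time :: "('i, 'm) tree_data_scheme \<Rightarrow> 'i sample \<Rightarrow> ennreal" where
  "explosion_time T \<omega> = (SUP n. jump_time T \<omega> n)"

text \<open>The position at time \<open>t\<close>; it is meaningful for \<open>t < explosion_time T \<omega>\<close> only.\<close>

definition chain :: "('i, 'm) tree_data_scheme \<Rightarrow> ennreal \<Rightarrow> 'i sample \<Rightarrow> 'i option" where
  "chain T t \<omega> = fst \<omega> (THE n. jump_time T \<omega> n \<le> t \<and> t < jump_time T \<omega> (Suc n))"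

definition absorption_time :: "('i, 'm) tree_data_scheme \<Rightarrow> 'i sample \<Rightarrow> ennreal" where
  "absorption_time T \<omega> = Inf {t. t < explosion_time T \<omega> \<and> chain T t \<omega> = None}"

definition chain_lifetime :: "('i, 'm) tree_data_scheme \<Rightarrow> 'i sample \<Rightarrow> ennreal" where
  "chain_lifetime T \<omega> = min (absorption_time T \<omega>) (explosion_time T \<omega>)"

text \<open>The event that the terminal position of the chain is the boundary point \<open>\<xi>\<close>, and the event
  that it lies in a set of boundary points.\<close>

definition exits_at :: "('i, 'm) tree_data_scheme \<Rightarrow> (nat \<Rightarrow> 'i) \<Rightarrow> 'i sample \<Rightarrow> bool" where
  "exits_at T \<xi> \<omega> \<longleftrightarrow> absorption_time T \<omega> = \<infinity> \<and> \<xi> \<in> boundary T \<and>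
     filterlim (\<lambda>t. chain T t \<omega>) (filtermap Some (toward T \<xi>)) (at_left (chain_lifetime T \<omega>))"

definition exits_in :: "('i, 'm) tree_data_scheme \<Rightarrow> (nat \<Rightarrow> 'i) set \<Rightarrow> 'i sample \<Rightarrow> bool" where
  "exits_in T A \<omega> \<longleftrightarrow> (\<exists>\<xi>\<in>A. exits_at T \<xi> \<omega>)"

definition transient :: "('i, 'm) tree_data_scheme \<Rightarrow> bool" where
  "transient T \<longleftrightarrow> 0 < \<P>(\<omega> in chain_law T (origin T). exits_in T (boundary T) \<omega>)"

definition exit_law :: "('i, 'm) tree_data_scheme \<Rightarrow> (nat \<Rightarrow> 'i) measure" where
  "exit_law T = measure_of (space (boundary_borel T)) (sets (boundary_borel T))
     (\<lambda>A. ennreal (\<P>(\<omega> in chain_law T (origin T). exits_in T A \<omega> \<bar> exits_in T (boundary T) \<omega>)))"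

definition regular_boundary :: "('i, 'm) tree_data_scheme \<Rightarrow> (nat \<Rightarrow> 'i) set" where
  "regular_boundary T = {\<eta> \<in> boundary T.
     ((\<lambda>j. \<P>(\<omega> in chain_law T j. absorption_time T \<omega> < \<infinity>)) \<longlongrightarrow> 0) (toward T \<eta>)}"


section \<open>Right-continuous sub-Markov processes with a transition density\<close>

text \<open>
  Processes with lifetime are modelled as processes indexed by the nonnegative reals, with the
  coffin state \<open>None\<close> as an isolated point added to the state space.
\<close>

definition add_coffin :: "'a topology \<Rightarrow> 'a option topology" where
  "add_coffin X = topology_generated_by (insert {None} {Some ` U |U. openin X U})"

definition rcll :: "'a topology \<Rightarrow> (real \<Rightarrow> 'a) \<Rightarrow> bool" where
  "rcll X z \<longleftrightarrow> (\<forall>t\<ge>0. limitin X z (z t) (at_right t)) \<and>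
                (\<forall>t>0. \<exists>l. limitin X z l (at_left t))"

definition lifetime :: "(real \<Rightarrow> 'a option) \<Rightarrow> ereal" where
  "lifetime z = Inf {ereal t |t. 0 \<le> t \<and> z t = None}"

definition sub_kernel ::
  "'a measure \<Rightarrow> (real \<Rightarrow> 'a \<Rightarrow> 'a \<Rightarrow> ennreal) \<Rightarrow> real \<Rightarrow> 'a option \<Rightarrow> 'a option set \<Rightarrow> ennreal" where
  "sub_kernel \<mu> p t x A =
     (case x of
        None \<Rightarrow> indicator A None
      | Some \<xi> \<Rightarrow> (\<integral>\<^sup>+\<eta>. p t \<xi> \<eta> * indicator A (Some \<eta>) \<partial>\<mu>) +
                 (1 - (\<integral>\<^sup>+\<eta>. p t \<xi> \<eta> \<partial>\<mu>)) * indicator A None)"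

definition past :: "'w measure \<Rightarrow> 'b measure \<Rightarrow> (real \<Rightarrow> 'w \<Rightarrow> 'b) \<Rightarrow> real \<Rightarrow> 'w measure" where
  "past M E Z s = sigma (space M) (\<Union>u\<in>{0..s}. {Z u -` A \<inter> space M |A. A \<in> sets E})"

text \<open>
  \<open>Z\<close> is a right-continuous with left limits Markov process, defined on the probability space
  \<open>M\<close>, with live states in the topological space \<open>X\<close>, initial distribution \<open>\<nu>\<close> and sub-Markov
  transition density \<open>p\<close> with respect to \<open>\<mu>\<close>.
\<close>

definition sub_markov_process ::
  "'a topology \<Rightarrow> 'a measure \<Rightarrow> (real \<Rightarrow> 'a \<Rightarrow> 'a \<Rightarrow> ennreal) \<Rightarrow> 'a measure \<Rightarrow>
   'w measure \<Rightarrow> (real \<Rightarrow> 'w \<Rightarrow> 'a option) \<Rightarrow> bool" where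
  "sub_markov_process X \<mu> p \<nu> M Z \<longleftrightarrow>
     (let E = borel_of_top (add_coffin X) in
      prob_space M \<and>
      (\<forall>t\<ge>0. Z t \<in> measurable M E) \<and>
      (\<forall>\<omega>\<in>space M. rcll (add_coffin X) (\<lambda>t. Z t \<omega>)) \<and>
      (\<forall>\<omega>\<in>space M. \<forall>s t. 0 \<le> s \<longrightarrow> s \<le> t \<longrightarrow> Z s \<omega> = None \<longrightarrow> Z t \<omega> = None) \<and>
      (\<forall>A\<in>sets E. emeasure M (Z 0 -` A \<inter> space M) = emeasure \<nu> (Some -` A)) \<and>
      (\<forall>s t. \<forall>A\<in>sets E. 0 \<le> s \<longrightarrow> s < t \<longrightarrow>
         (AE \<omega> in M. nn_cond_exp M (past M E Z s) (\<lambda>\<omega>. indicator A (Z t \<omega>)) \<omega> =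
                     sub_kernel \<mu> p (t - s) (Z s \<omega>) A)))"

text \<open>The path of a process, as an element of the product of the state spaces over all times.\<close>

definition path_of :: "(real \<Rightarrow> 'w \<Rightarrow> 'b) \<Rightarrow> 'w \<Rightarrow> real \<Rightarrow> 'b" where
  "path_of Z \<omega> = (\<lambda>t\<in>{0..}. Z t \<omega>)"

definition path_space :: "'a topology \<Rightarrow> (real \<Rightarrow> 'a option) measure" where
  "path_space X = PiM {0..} (\<lambda>_. borel_of_top (add_coffin X))"


text \<open>Independence of two random elements; \<open>prob_space.indep_var\<close> covers only the case of equal value
  types.\<close>

definition independent_elements ::
  "'w measure \<Rightarrow> 'a measure \<Rightarrow> ('w \<Rightarrow> 'a) \<Rightarrow> 'b measure \<Rightarrow> ('w \<Rightarrow> 'b) \<Rightarrow> bool" where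
  "independent_elements M E X F Y \<longleftrightarrow>
     X \<in> measurable M E \<and> Y \<in> measurable M F \<and>
     prob_space.indep_set M {X -` A \<inter> space M |A. A \<in> sets E} {Y -` A \<inter> space M |A. A \<in> sets F}"


section \<open>The processes in the boundary\<close>

definition G :: "('i, 'm) tree_data_scheme \<Rightarrow> nat \<Rightarrow> (nat \<Rightarrow> 'i) \<Rightarrow> real" where
  "G T n \<xi> = (\<Sum>k. increment (weight T) (n + k) * measure (exit_law T) (cell T (n + k) \<xi>))"

definition density_Xi ::
  "('i, 'm) tree_data_scheme \<Rightarrow> real \<Rightarrow> (nat \<Rightarrow> 'i) \<Rightarrow> (nat \<Rightarrow> 'i) \<Rightarrow> ennreal" where
  "density_Xi T t \<xi> \<eta> =
     (\<Sum>n. if enat n \<le> meet \<xi> \<eta>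
          then ennreal ((exp (- t / G T n \<xi>) - exp (- t / G T (Suc n) \<xi>)) /
                        measure (exit_law T) (cell T n \<xi>))
          else 0)"

definition regular_top :: "('i, 'm) tree_data_scheme \<Rightarrow> (nat \<Rightarrow> 'i) topology" where
  "regular_top T = subtopology (boundary_top T) (regular_boundary T)"

definition process_Xi ::
  "('i, 'm) tree_data_scheme \<Rightarrow> (nat \<Rightarrow> 'i) measure \<Rightarrow>
   'w measure \<Rightarrow> (real \<Rightarrow> 'w \<Rightarrow> (nat \<Rightarrow> 'i) option) \<Rightarrow> bool" where
  "process_Xi T = sub_markov_process (regular_top T) (exit_law T) (density_Xi T)"

text \<open>
  The analogous objects for the subtree rooted at a successor \<open>r1\<close> of the root.  A ray of the subtree
  is represented by the ray of the whole tree which extends it, so that the \<open>n\<close>-th cell of the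
  subtree is the \<open>n + 1\<close>-st cell of the whole tree, and \<open>meet\<close> decreases by 1.
\<close>

definition bar_law :: "('i, 'm) tree_data_scheme \<Rightarrow> 'i \<Rightarrow> (nat \<Rightarrow> 'i) measure" where
  "bar_law T r1 = uniform_measure (exit_law T) (boundary_at T r1)"

definition bar_weight :: "('i, 'm) tree_data_scheme \<Rightarrow> 'i \<Rightarrow> nat \<Rightarrow> real" where
  "bar_weight T r1 n =
     (\<Sum>k\<le>n. measure (exit_law T) (boundary_at T r1) * increment (weight T) (k + 1))"

definition bar_cell :: "('i, 'm) tree_data_scheme \<Rightarrow> nat \<Rightarrow> (nat \<Rightarrow> 'i) \<Rightarrow> (nat \<Rightarrow> 'i) set" where
  "bar_cell T n \<xi> = cell T (n + 1) \<xi>"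

definition bar_G :: "('i, 'm) tree_data_scheme \<Rightarrow> 'i \<Rightarrow> nat \<Rightarrow> (nat \<Rightarrow> 'i) \<Rightarrow> real" where
  "bar_G T r1 n \<xi> =
     (\<Sum>k. increment (bar_weight T r1) (n + k) * measure (bar_law T r1) (bar_cell T (n + k) \<xi>))"

definition density_Xi_bar ::
  "('i, 'm) tree_data_scheme \<Rightarrow> 'i \<Rightarrow> real \<Rightarrow> (nat \<Rightarrow> 'i) \<Rightarrow> (nat \<Rightarrow> 'i) \<Rightarrow> ennreal" where
  "density_Xi_bar T r1 t \<xi> \<eta> =
     (\<Sum>n. if enat n \<le> meet \<xi> \<eta> - 1
          then ennreal ((exp (- t / bar_G T r1 n \<xi>) - exp (- t / bar_G T r1 (Suc n) \<xi>)) /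
                        measure (bar_law T r1) (bar_cell T n \<xi>))
          else 0)"

definition bar_regular_boundary :: "('i, 'm) tree_data_scheme \<Rightarrow> 'i \<Rightarrow> (nat \<Rightarrow> 'i) set" where
  "bar_regular_boundary T r1 = regular_boundary T \<inter> boundary_at T r1"

definition bar_regular_top :: "('i, 'm) tree_data_scheme \<Rightarrow> 'i \<Rightarrow> (nat \<Rightarrow> 'i) topology" where
  "bar_regular_top T r1 = subtopology (boundary_top T) (bar_regular_boundary T r1)"

definition process_Xi_bar ::
  "('i, 'm) tree_data_scheme \<Rightarrow> 'i \<Rightarrow> (nat \<Rightarrow> 'i) measure \<Rightarrow>
   'w measure \<Rightarrow> (real \<Rightarrow> 'w \<Rightarrow> (nat \<Rightarrow> 'i) option) \<Rightarrow> bool" where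
  "process_Xi_bar T r1 =
     sub_markov_process (bar_regular_top T r1) (bar_law T r1) (density_Xi_bar T r1)"

definition glue ::
  "(real \<Rightarrow> 'w \<Rightarrow> 'a option) \<Rightarrow> ('w \<Rightarrow> bool) \<Rightarrow> (real \<Rightarrow> 'w \<Rightarrow> 'a option) \<Rightarrow>
   real \<Rightarrow> 'w \<Rightarrow> 'a option" where
  "glue Y B Z t \<omega> =
     (if ereal t < lifetime (\<lambda>s. Y s \<omega>) then Y t \<omega>
      else if \<not> B \<omega> then None
      else Z (t - real_of_ereal (lifetime (\<lambda>s. Y s \<omega>))) \<omega>)"

end

(*
  The chain in the tree plays no role: all that is needed about mu and the G_n is forced by the
  existence of the two given processes.  Right-continuity excludes points at which G_n degenerates,
  since a process started there would leave its cell or die at once, and the Chapman-Kolmogorov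
  equation for the survival probability exp (- t / G_0) forces G_0 to be constant mu-almost
  everywhere.  Hence the residual lifetime of the process of the subtree, given its past, is
  exponential of parameter 1 / G_1, mu is quasi-stationary for the whole process with decay rate
  1 / G_0, and the two semigroups satisfy

    P_t f = Pbar_t f + (exp (- t / G_0) - exp (- t / G_1)) mu(f)

  on the subtree.  The factor is the probability that an exponential time of parameter 1 / G_1 has
  elapsed before t, followed by a successful coin toss of probability 1 - G_1 / G_0 and by survival
  at rate 1 / G_0 for the remaining time.  Decomposing a cylinder event according to the interval
  of its time points in which the lifetime falls then turns the finite-dimensional distributions of
  the glued process into those given by P_t.
*)
theory Submission
  imports Defs
begin

text \<open>The success probability 1 - G_1 / G_0 is forced. With a = 1 / G_1 and b = 1 / G_0, the
  integral of a exp (- a r) exp (- b (t - r)) over 0 \<le> r \<le> t equals a / (a - b) times exp (-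
  b t) - exp (- a t), so exactly the factor 1 - b / a = (a - b) / a turns the contribution of the
  restart into the second term of the decomposition of P_t.

  The obstacle is that the restart happens at a random time. No strong Markov property is invoked:
  the lifetime is enclosed in deterministic intervals, independence is used at fixed times, and the
  mesh tends to 0. The Markov property of the glued process with respect to its own past is then
  recovered from its cylinder probabilities, since cylinder events generate that past.

  Kernels are treated as functionals on nonnegative functions, which agree as soon as they agree on
  cells. Identities known only at nondegenerate points are applied either almost everywhere or along
  a path, which at a given time almost surely sits at such a point.\<close>

section \<open>Paths, rays and cells of the tree\<close>

lemma weighted_tree_adj:
  "weighted_tree T \<Longrightarrow> adj T i j \<Longrightarrow> i \<in> sites T \<and> j \<in> sites T \<and> i \<noteq> j \<and> adj T j i"
  unfolding weighted_tree_def by blast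

lemma origin_in_sites: "weighted_tree T \<Longrightarrow> origin T \<in> sites T"
  by (simp add: weighted_tree_def)

lemma countable_sites: "weighted_tree T \<Longrightarrow> countable (sites T)"
  by (simp add: weighted_tree_def)

lemma last_in_path: "path_between T i j xs \<Longrightarrow> j \<in> set xs"
  unfolding path_between_def by (metis last_in_set)

lemma path_between_prefix:
  assumes "path_between T i j (ys @ k # zs)"
  shows "path_between T i k (ys @ [k])"
proof -
  have "successively (adj T) ((ys @ [k]) @ zs)" using assms by (simp add: path_between_def)
  then have "successively (adj T) (ys @ [k])" by (simp only: successively_append_iff)
  then show ?thesis using assms unfolding path_between_def by (cases ys) auto
qed

lemma geodesic_eqI:
  assumes "weighted_tree T" "path_between T (origin T) j xs"
  shows "geodesic T (origin T) j = xs"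
proof -
  have "j \<in> sites T" "origin T \<in> sites T"
    using assms last_in_path[OF assms(2)] by (auto simp: weighted_tree_def path_between_def)
  then have "\<exists>!xs. path_between T (origin T) j xs"
    using assms by (auto simp: weighted_tree_def)
  with assms(2) show ?thesis unfolding geodesic_def by (auto intro: the_equality)
qed

lemma geodesic_path:
  assumes "weighted_tree T" "j \<in> sites T"
  shows "path_between T (origin T) j (geodesic T (origin T) j)"
proof -
  have "\<exists>!xs. path_between T (origin T) j xs"
    using assms by (auto simp: weighted_tree_def)
  then show ?thesis unfolding geodesic_def by (rule theI')
qed

text \<open>\<open>parent\<close> is a definite description, so a unique neighbour of smaller depth
  has to be produced. It is the last but one vertex k of the path from the root: if m is any such
  neighbour, then j does not lie on the path to m, which therefore extends by j to the path to j and
  must end in k.\<close>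

lemma depth_parent:
  assumes T: "weighted_tree T" and j: "j \<in> sites T" "j \<noteq> origin T"
  shows "depth T j = Suc (depth T (parent T j))"
proof -
  define xs where "xs = geodesic T (origin T) j"
  have xs: "path_between T (origin T) j xs"
    unfolding xs_def using geodesic_path[OF T j(1)] .
  obtain ys k where ysk: "xs = ys @ [k, j]"
  proof -
    have "xs \<noteq> []" "last xs = j" "hd xs = origin T" using xs by (auto simp: path_between_def)
    then obtain us where us: "xs = us @ [j]" by (metis append_butlast_last_id)
    then have "us \<noteq> []" using \<open>hd xs = origin T\<close> j(2) by auto
    then have "xs = butlast us @ [last us, j]" using us by simp
    then show ?thesis using that by blast
  qed
  have pk: "path_between T (origin T) k (ys @ [k])"
    using xs path_between_prefix[of T "origin T" j ys k "[j]"] ysk by simp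
  have dk: "depth T k = length ys" using geodesic_eqI[OF T pk] by (simp add: depth_def)
  have dj: "depth T j = Suc (length ys)" using ysk by (simp add: depth_def flip: xs_def)
  have akj: "adj T k j" using xs ysk by (auto simp: path_between_def successively_append_iff)
  then have ajk: "adj T j k" using weighted_tree_adj[OF T] by blast
  have uniq: "m = k" if m: "adj T j m" "depth T m < depth T j" for m
  proof -
    have ms: "m \<in> sites T" and mj: "adj T m j" using weighted_tree_adj[OF T m(1)] by auto
    let ?g = "geodesic T (origin T) m"
    have pm: "path_between T (origin T) m ?g" using geodesic_path[OF T ms] .
    have "j \<notin> set ?g"
    proof
      assume "j \<in> set ?g"
      then obtain us vs where uv: "?g = us @ j # vs" by (meson split_list)
      then have "path_between T (origin T) j (us @ [j])"
        using pm path_between_prefix by metis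
      then have "depth T j = length us" using geodesic_eqI[OF T] by (simp add: depth_def)
      moreover have "depth T m \<ge> length us" using uv by (simp add: depth_def)
      ultimately show False using m by simp
    qed
    then have "path_between T (origin T) j (?g @ [j])"
      using pm mj j by (auto simp: path_between_def successively_append_iff)
    then have "?g @ [j] = xs" using geodesic_eqI[OF T] unfolding xs_def by metis
    then have "?g = ys @ [k]" using ysk by simp
    then have "last ?g = k" by simp
    then show "m = k" using pm by (simp add: path_between_def)
  qed
  have "parent T j = k" unfolding parent_def
    by (rule the_equality) (simp add: ajk dk dj, blast intro: uniq)
  then show ?thesis using dk dj by simp
qed

lemma ray_site:
  assumes "weighted_tree T" "x \<in> boundary T"
  shows "x n \<in> sites T"
  using assms origin_in_sites[OF assms(1)] by (cases n) (auto simp: boundary_def successors_def)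

lemma depth_ray:
  assumes T: "weighted_tree T" and x: "x \<in> boundary T"
  shows "depth T (x n) = n"
proof (induction n)
  case 0
  have "path_between T (origin T) (origin T) [origin T]"
    using T by (auto simp: path_between_def weighted_tree_def)
  then show ?case using x geodesic_eqI[OF T] by (simp add: depth_def boundary_def)
next
  case (Suc n)
  have "x (Suc n) \<in> successors T (x n)" using x by (auto simp: boundary_def)
  then show ?case using depth_parent[OF T] Suc by (auto simp: successors_def)
qed

text \<open>Each vertex of a ray is the parent of the next one, so agreement spreads towards the
  root.\<close>

lemma ray_agree_mono:
  assumes "x \<in> boundary T" "y \<in> boundary T" "x n = y n" "m \<le> n"
  shows "x m = y m"
  using assms(4,3)
proof (induction n rule: dec_induct)
  case (step n)
  have "parent T (x (Suc n)) = x n" "parent T (y (Suc n)) = y n"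
    using assms(1,2) by (auto simp: boundary_def successors_def)
  then show ?case using step by simp
qed simp

text \<open>The levels at which two rays agree form an initial segment, finite for distinct rays, so
  the maximum in \<open>meet\<close> is attained and the condition reduces to equality at a single
  level.\<close>

lemma enat_le_meet_iff:
  assumes "x \<in> boundary T" "y \<in> boundary T"
  shows "enat n \<le> meet x y \<longleftrightarrow> x n = y n"
proof (cases "x = y")
  case False
  then obtain N where N: "x N \<noteq> y N" by auto
  let ?A = "{n. x n = y n}"
  have sub: "?A \<subseteq> {..<N}" using ray_agree_mono[OF assms] N by (force simp: not_less[symmetric])
  then have fin: "finite ?A" using finite_subset by blast
  have "0 \<in> ?A" using assms by (auto simp: boundary_def)
  then have "Max ?A \<in> ?A" using fin by (intro Max_in) auto
  then have "n \<le> Max ?A \<longleftrightarrow> x n = y n"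
    using ray_agree_mono[OF assms, of "Max ?A" n] fin by auto
  then show ?thesis using False by (simp add: meet_def)
qed (simp add: meet_def)

lemma boundary_at_ray:
  assumes "weighted_tree T" "x \<in> boundary T"
  shows "boundary_at T (x n) = {y \<in> boundary T. y n = x n}"
  using depth_ray[OF assms] by (auto simp: boundary_at_def)

lemma boundary_at_eqI:
  assumes T: "weighted_tree T" and x: "x \<in> boundary T" "x n = i"
  shows "boundary_at T i = {y \<in> boundary T. y n = i}"
  using boundary_at_ray[OF T x(1), of n] x(2) by simp

lemma boundary_at_origin:
  assumes T: "weighted_tree T"
  shows "boundary_at T (origin T) = boundary T"
proof -
  have "path_between T (origin T) (origin T) [origin T]"
    using T by (auto simp: path_between_def weighted_tree_def)
  then have "depth T (origin T) = 0" using geodesic_eqI[OF T] by (simp add: depth_def)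
  then show ?thesis by (auto simp: boundary_at_def boundary_def)
qed

text \<open>Cells are nested or disjoint, because a ray common to both fixes the ancestors of the
  deeper site. With the empty set added, they are closed under intersection.\<close>

lemma boundary_at_Int:
  assumes T: "weighted_tree T"
  shows "boundary_at T i \<inter> boundary_at T j \<in> {{}, boundary_at T i, boundary_at T j}"
proof -
  have *: "boundary_at T i \<inter> boundary_at T j = {} \<or> boundary_at T i \<inter> boundary_at T j = boundary_at T j"
    if "depth T i \<le> depth T j" for i j
  proof (cases "boundary_at T i \<inter> boundary_at T j = {}")
    case False
    then obtain x where x: "x \<in> boundary T" "x (depth T i) = i" "x (depth T j) = j"
      by (auto simp: boundary_at_def)
    have "boundary_at T j \<subseteq> boundary_at T i"
    proof
      fix y assume "y \<in> boundary_at T j"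
      then have "y \<in> boundary T" "y (depth T j) = x (depth T j)" using x by (auto simp: boundary_at_def)
      then have "y (depth T i) = x (depth T i)" using ray_agree_mono[OF _ x(1) _ that] by blast
      then show "y \<in> boundary_at T i" using x \<open>y \<in> boundary T\<close> by (simp add: boundary_at_def)
    qed
    then show ?thesis by auto
  qed auto
  show ?thesis using *[of i j] *[of j i] linear[of "depth T i" "depth T j"] by (auto simp: Int_commute)
qed

section \<open>Topology and Borel sets of the boundary\<close>

lemma openin_boundary_top_boundary_at: "i \<in> sites T \<Longrightarrow> openin (boundary_top T) (boundary_at T i)"
  unfolding boundary_top_def by (intro topology_generated_by_Basis) auto

lemma topspace_boundary_top:
  assumes "weighted_tree T" shows "topspace (boundary_top T) = boundary T"
proof -
  have "boundary_at T (origin T) \<in> boundary_at T ` sites T"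
    using origin_in_sites[OF assms] by auto
  then show ?thesis using boundary_at_origin[OF assms]
    unfolding boundary_top_def topology_generated_by_topspace by (auto simp: boundary_at_def)
qed

lemma openin_boundary_top_subset:
  "weighted_tree T \<Longrightarrow> openin (boundary_top T) U \<Longrightarrow> U \<subseteq> boundary T"
  using openin_subset[of "boundary_top T" U] by (simp add: topspace_boundary_top)

text \<open>The cells are a base and not just a subbase: the cells around \<open>x\<close> at levels
  m and n both contain the one at level max m n.\<close>

lemma openin_boundary_top_cell:
  assumes T: "weighted_tree T" and U: "openin (boundary_top T) U" and x: "x \<in> U"
  shows "\<exists>n. boundary_at T (x n) \<subseteq> U"
proof -
  have "generate_topology_on (boundary_at T ` sites T) U"
    using U unfolding boundary_top_def by (simp add: openin_topology_generated_by_iff)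
  then show ?thesis using x
  proof (induction arbitrary: x rule: generate_topology_on.induct)
    case (Int a b)
    have "openin (boundary_top T) a"
      using Int(1) by (simp add: boundary_top_def openin_topology_generated_by_iff)
    then have xb: "x \<in> boundary T" using openin_boundary_top_subset[OF T] Int.prems by blast
    obtain m n where "boundary_at T (x m) \<subseteq> a" "boundary_at T (x n) \<subseteq> b" using Int by blast
    moreover have "boundary_at T (x (max m n)) \<subseteq> boundary_at T (x m) \<inter> boundary_at T (x n)"
      unfolding boundary_at_ray[OF T xb]
      by (blast intro: ray_agree_mono[OF _ xb] max.cobounded1 max.cobounded2)
    ultimately show ?case by blast
  next
    case (Basis s)
    then obtain i where i: "s = boundary_at T i" by auto
    then have "x (depth T i) = i" using Basis by (auto simp: boundary_at_def)
    then show ?case using i by (intro exI[of _ "depth T i"]) simp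
  next
    case (UN K)
    then show ?case by blast
  qed auto
qed

lemma space_boundary_borel [simp]:
  "weighted_tree T \<Longrightarrow> space (boundary_borel T) = boundary T"
  unfolding boundary_borel_def borel_of_top_def
  by (subst space_measure_of) (use openin_boundary_top_subset in \<open>auto simp: topspace_boundary_top\<close>)

text \<open>Every open set is the union of the cells inside it, and this union is countable because
  the sites are.\<close>

lemma sets_boundary_borel:
  assumes T: "weighted_tree T"
  shows "sets (boundary_borel T) = sigma_sets (boundary T) (boundary_at T ` sites T)"
proof -
  have "sets (boundary_borel T) = sigma_sets (boundary T) {U. openin (boundary_top T) U}"
    unfolding boundary_borel_def borel_of_top_def topspace_boundary_top[OF T]
    by (rule sets_measure_of) (use openin_boundary_top_subset[OF T] in auto)
  also have "\<dots> = sigma_sets (boundary T) (boundary_at T ` sites T)"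
  proof (rule sigma_sets_eqI)
    fix U assume "U \<in> {U. openin (boundary_top T) U}"
    then have U: "openin (boundary_top T) U" by simp
    let ?I = "{i \<in> sites T. boundary_at T i \<subseteq> U}"
    have "U = (\<Union>i\<in>?I. boundary_at T i)"
    proof (intro equalityI subsetI)
      fix x assume x: "x \<in> U"
      then have xb: "x \<in> boundary T" using openin_subset[OF U] topspace_boundary_top[OF T] by auto
      obtain n where "boundary_at T (x n) \<subseteq> U" using openin_boundary_top_cell[OF T U x] by blast
      moreover have "x \<in> boundary_at T (x n)" using boundary_at_ray[OF T xb] xb by auto
      ultimately show "x \<in> (\<Union>i\<in>?I. boundary_at T i)" using ray_site[OF T xb] by blast
    qed auto
    moreover have "countable ?I" by (rule countable_subset[OF _ countable_sites[OF T]]) auto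
    moreover have "(\<Union>i\<in>?I. boundary_at T i) \<in> sigma_sets (boundary T) (boundary_at T ` sites T)"
      using calculation(2) by (intro sigma_sets_UNION) (auto intro: sigma_sets.Basic)
    ultimately show "U \<in> sigma_sets (boundary T) (boundary_at T ` sites T)" by simp
  next
    fix b assume "b \<in> boundary_at T ` sites T"
    then show "b \<in> sigma_sets (boundary T) {U. openin (boundary_top T) U}"
      using openin_boundary_top_boundary_at by (auto intro!: sigma_sets.Basic)
  qed
  finally show ?thesis .
qed

lemma boundary_at_in_sets:
  "weighted_tree T \<Longrightarrow> i \<in> sites T \<Longrightarrow> boundary_at T i \<in> sets (boundary_borel T)"
  by (auto simp: sets_boundary_borel intro: sigma_sets.Basic)

lemma measurable_level:
  assumes T: "weighted_tree T"
  shows "(\<lambda>x. x n) \<in> measurable (boundary_borel T) (count_space (sites T))"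
proof -
  have c: "countable (sites T)" using T by (simp add: weighted_tree_def)
  have 1: "(\<lambda>x. x n) \<in> space (boundary_borel T) \<rightarrow> sites T"
    using ray_site[OF T] by (simp add: Pi_def T)
  have 2: "(\<lambda>x. x n) -` {i} \<inter> space (boundary_borel T) \<in> sets (boundary_borel T)"
    if i: "i \<in> sites T" for i
  proof (cases "\<exists>x\<in>boundary T. x n = i")
    case True
    then obtain x where "x \<in> boundary T" "x n = i" by blast
    from boundary_at_eqI[OF T this]
    have "(\<lambda>x. x n) -` {i} \<inter> space (boundary_borel T) = boundary_at T i"
      unfolding space_boundary_borel[OF T] by blast
    then show ?thesis using boundary_at_in_sets[OF T i] by simp
  next
    case False
    then have "(\<lambda>x. x n) -` {i} \<inter> space (boundary_borel T) = {}"
      unfolding space_boundary_borel[OF T] by blast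
    then show ?thesis by simp
  qed
  show ?thesis
    by (rule measurable_count_space_eq_countable[OF c, THEN iffD2]) (intro conjI ballI 1 2)
qed

lemma measurable_level_comp:
  assumes T: "weighted_tree T"
  shows "(\<lambda>x. f (x n)) \<in> measurable (boundary_borel T) (borel :: 'a :: topological_space measure)"
proof -
  have "f \<in> measurable (count_space (sites T)) borel" by simp
  from measurable_comp[OF measurable_level[OF T] this]
  show ?thesis by (simp only: comp_def)
qed

section \<open>The coffin state\<close>

lemma option_set_eq: "V = (if None \<in> V then {None} \<union> Some ` (Some -` V) else Some ` (Some -` V))"
proof (rule set_eqI)
  fix w show "w \<in> V \<longleftrightarrow> w \<in> (if None \<in> V then {None} \<union> Some ` (Some -` V) else Some ` (Some -` V))"
    by (cases w) auto
qed

lemma openin_add_coffin_iff: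
  "openin (add_coffin X) V \<longleftrightarrow> V \<subseteq> insert None (Some ` topspace X) \<and> openin X (Some -` V)"
proof
  let ?B = "insert {None} {Some ` U |U. openin X U}"
  assume "openin (add_coffin X) V"
  then have "generate_topology_on ?B V"
    unfolding add_coffin_def by (simp add: openin_topology_generated_by_iff)
  then show "V \<subseteq> insert None (Some ` topspace X) \<and> openin X (Some -` V)"
  proof induction
    case (UN K)
    have "Some -` (\<Union>K) = (\<Union>k\<in>K. Some -` k)" by auto
    with UN show ?case by (auto intro!: openin_Union)
  next
    case (Basis s)
    moreover have "Some -` (Some ` U) = U" for U :: "'a set" by auto
    ultimately show ?case using openin_subset by (fastforce simp: vimage_def)
  qed auto
next
  let ?B = "insert {None} {Some ` U |U. openin X U}"
  assume V: "V \<subseteq> insert None (Some ` topspace X) \<and> openin X (Some -` V)"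
  have 1: "openin (add_coffin X) (Some ` (Some -` V))"
    unfolding add_coffin_def using V by (intro topology_generated_by_Basis) auto
  have 2: "openin (add_coffin X) {None}"
    unfolding add_coffin_def by (intro topology_generated_by_Basis) auto
  have "V = (if None \<in> V then {None} \<union> Some ` (Some -` V) else Some ` (Some -` V))"
    by (rule option_set_eq)
  then show "openin (add_coffin X) V"
    using openin_Un[OF 2 1] 1 by metis
qed

lemma topspace_add_coffin: "topspace (add_coffin X) = insert None (Some ` topspace X)"
proof -
  have "Some -` insert None (Some ` topspace X) = topspace X" by auto
  then have "openin (add_coffin X) (insert None (Some ` topspace X))"
    by (simp add: openin_add_coffin_iff)
  then show ?thesis
    by (metis openin_add_coffin_iff openin_subset openin_topspace subset_antisym)
qed

text \<open>An open set of the larger state space has an open trace on the smaller one. This lets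
  the paths of the subtree process be read in the state space of the whole process.\<close>

lemma limitin_add_coffin_mono:
  assumes "limitin (add_coffin (subtopology X S)) f l F" "S \<subseteq> S'"
  shows "limitin (add_coffin (subtopology X S')) f l F"
  unfolding limitin_def
proof (intro conjI allI impI)
  show "l \<in> topspace (add_coffin (subtopology X S'))"
    using assms by (auto simp: limitin_def topspace_add_coffin)
  fix U assume U: "openin (add_coffin (subtopology X S')) U \<and> l \<in> U"
  let ?V = "U \<inter> insert None (Some ` topspace (subtopology X S))"
  obtain O' where O': "openin X O'" "Some -` U = O' \<inter> S'"
    using U by (auto simp: openin_add_coffin_iff openin_subtopology)
  have "Some -` ?V = O' \<inter> S" using O' assms(2) openin_subset[OF O'(1)] by auto
  then have "openin (add_coffin (subtopology X S)) ?V"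
    using O' by (auto simp: openin_add_coffin_iff openin_subtopology)
  moreover have "l \<in> ?V" using assms U by (auto simp: limitin_def topspace_add_coffin)
  ultimately have "eventually (\<lambda>x. f x \<in> ?V) F" using assms(1) unfolding limitin_def by blast
  then show "eventually (\<lambda>x. f x \<in> U) F" by eventually_elim auto
qed

definition coffin_borel :: "('i, 'm) tree_data_scheme \<Rightarrow> (nat \<Rightarrow> 'i) set \<Rightarrow> (nat \<Rightarrow> 'i) option measure" where
  "coffin_borel T R = borel_of_top (add_coffin (subtopology (boundary_top T) R))"

lemma topspace_coffin:
  assumes "weighted_tree T" "R \<subseteq> boundary T"
  shows "topspace (add_coffin (subtopology (boundary_top T) R)) = insert None (Some ` R)"
  using assms topspace_boundary_top[OF assms(1)] by (auto simp: topspace_add_coffin)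

lemma space_coffin_borel:
  assumes "weighted_tree T" "R \<subseteq> boundary T"
  shows "space (coffin_borel T R) = insert None (Some ` R)"
  unfolding coffin_borel_def borel_of_top_def topspace_coffin[OF assms, symmetric]
  by (rule space_measure_of) (auto dest: openin_subset)

text \<open>Live cells suffice as generators: the cell of the root gives the set of all live states,
  whose complement is the coffin.\<close>

lemma sets_coffin_borel:
  assumes T: "weighted_tree T" and R: "R \<subseteq> boundary T"
  shows "sets (coffin_borel T R) =
    sigma_sets (insert None (Some ` R)) ((\<lambda>i. Some ` (boundary_at T i \<inter> R)) ` sites T)"
proof -
  let ?O = "insert None (Some ` R)" and ?X = "subtopology (boundary_top T) R"
  let ?G = "(\<lambda>i. Some ` (boundary_at T i \<inter> R)) ` sites T"
  have "sets (coffin_borel T R) = sigma_sets ?O {U. openin (add_coffin ?X) U}"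
    unfolding coffin_borel_def borel_of_top_def topspace_coffin[OF T R]
    by (rule sets_measure_of) (auto simp flip: topspace_coffin[OF T R] dest: openin_subset)
  also have "\<dots> = sigma_sets ?O ?G"
  proof (rule sigma_sets_eqI)
    have root: "origin T \<in> sites T" by (rule origin_in_sites[OF T])
    have "Some ` R \<in> sigma_sets ?O ?G"
      using boundary_at_origin[OF T] R root by (auto intro!: sigma_sets.Basic image_eqI[of _ _ "origin T"])
    then have "?O - Some ` R \<in> sigma_sets ?O ?G" by (rule sigma_sets.Compl)
    moreover have "?O - Some ` R = {None}" by auto
    ultimately have none: "{None} \<in> sigma_sets ?O ?G" by simp
    fix V assume "V \<in> {V. openin (add_coffin ?X) V}"
    then have V: "V \<subseteq> ?O" "openin ?X (Some -` V)"
      using topspace_boundary_top[OF T] R by (auto simp: openin_add_coffin_iff)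
    then obtain U where U: "openin (boundary_top T) U" "Some -` V = U \<inter> R"
      by (auto simp: openin_subtopology)
    let ?I = "{i \<in> sites T. boundary_at T i \<subseteq> U}"
    have "Some -` V = (\<Union>i\<in>?I. boundary_at T i \<inter> R)"
    proof (intro equalityI subsetI)
      fix x assume x: "x \<in> Some -` V"
      then have xb: "x \<in> boundary T" "x \<in> U" "x \<in> R" using U R by auto
      obtain n where "boundary_at T (x n) \<subseteq> U" using openin_boundary_top_cell[OF T U(1)] xb by blast
      moreover have "x \<in> boundary_at T (x n)" using boundary_at_ray[OF T xb(1)] xb by auto
      ultimately show "x \<in> (\<Union>i\<in>?I. boundary_at T i \<inter> R)" using ray_site[OF T xb(1)] xb by blast
    qed (use U in auto)
    then have "Some ` (Some -` V) = (\<Union>i\<in>?I. Some ` (boundary_at T i \<inter> R))" by auto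
    moreover have "countable ?I" by (rule countable_subset[OF _ countable_sites[OF T]]) auto
    moreover have "(\<Union>i\<in>?I. Some ` (boundary_at T i \<inter> R)) \<in> sigma_sets ?O ?G"
      using calculation(2) by (intro sigma_sets_UNION) (auto intro: sigma_sets.Basic)
    ultimately have live: "Some ` (Some -` V) \<in> sigma_sets ?O ?G" by simp
    have "V = (if None \<in> V then {None} \<union> Some ` (Some -` V) else Some ` (Some -` V))"
      by (rule option_set_eq)
    then show "V \<in> sigma_sets ?O ?G"
      using sigma_sets_Un[OF none live] live by metis
  next
    fix b assume "b \<in> ?G"
    then obtain i where i: "i \<in> sites T" "b = Some ` (boundary_at T i \<inter> R)" by auto
    have "Some -` b = boundary_at T i \<inter> R" using i by auto
    then have "openin (add_coffin ?X) b"
      using i R openin_boundary_top_boundary_at[OF i(1)] topspace_boundary_top[OF T]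
      by (auto simp: openin_add_coffin_iff openin_subtopology)
    then show "b \<in> sigma_sets ?O {U. openin (add_coffin ?X) U}" by (auto intro!: sigma_sets.Basic)
  qed
  finally show ?thesis .
qed

lemma in_sets_coffin_borel_iff:
  assumes T: "weighted_tree T" and R: "R \<in> sets (boundary_borel T)"
  shows "A \<in> sets (coffin_borel T R) \<longleftrightarrow>
    A \<subseteq> insert None (Some ` R) \<and> Some -` A \<in> sets (boundary_borel T)"
proof -
  let ?O = "insert None (Some ` R)"
  have Rb: "R \<subseteq> boundary T" using sets.sets_into_space[OF R] T by simp
  have fwd: "Some -` A \<in> sets (boundary_borel T)" if "A \<in> sets (coffin_borel T R)" for A
    using that unfolding sets_coffin_borel[OF T Rb]
  proof (induction rule: sigma_sets.induct)
    case (Basic a)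
    then obtain i where "i \<in> sites T" "a = Some ` (boundary_at T i \<inter> R)" by auto
    moreover have "Some -` (Some ` (boundary_at T i \<inter> R)) = boundary_at T i \<inter> R" by auto
    ultimately show ?case using boundary_at_in_sets[OF T] R by simp
  next
    case (Compl a)
    have "Some -` (?O - a) = R - Some -` a" by auto
    then show ?case using Compl R by simp
  next
    case (Union a)
    have "Some -` (\<Union>i. a i) = (\<Union>i. Some -` a i)" by auto
    then show ?case using Union by auto
  qed simp
  have none: "{None} \<in> sets (coffin_borel T R)" and live: "Some ` R \<in> sets (coffin_borel T R)"
  proof -
    have root: "origin T \<in> sites T" by (rule origin_in_sites[OF T])
    show *: "Some ` R \<in> sets (coffin_borel T R)" unfolding sets_coffin_borel[OF T Rb]
      using boundary_at_origin[OF T] Rb root by (auto intro!: sigma_sets.Basic image_eqI[of _ _ "origin T"])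
    have "space (coffin_borel T R) - Some ` R = {None}" using space_coffin_borel[OF T Rb] by auto
    with sets.compl_sets[OF *] show "{None} \<in> sets (coffin_borel T R)" by simp
  qed
  have bwd: "Some ` (U \<inter> R) \<in> sets (coffin_borel T R)" if "U \<in> sets (boundary_borel T)" for U
    using that unfolding sets_boundary_borel[OF T]
  proof (induction rule: sigma_sets.induct)
    case (Basic a)
    then show ?case unfolding sets_coffin_borel[OF T Rb] by (auto intro!: sigma_sets.Basic)
  next
    case (Compl a)
    have "Some ` ((boundary T - a) \<inter> R) = Some ` R - Some ` (a \<inter> R)" using Rb by auto
    then show ?case using Compl live by simp
  next
    case (Union a)
    have "Some ` ((\<Union>i. a i) \<inter> R) = (\<Union>i. Some ` (a i \<inter> R))" by auto
    then show ?case using Union by auto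
  qed simp
  show ?thesis
  proof
    assume "A \<in> sets (coffin_borel T R)"
    then show "A \<subseteq> ?O \<and> Some -` A \<in> sets (boundary_borel T)"
      using fwd sets.sets_into_space space_coffin_borel[OF T Rb] by blast
  next
    assume A: "A \<subseteq> ?O \<and> Some -` A \<in> sets (boundary_borel T)"
    have live: "Some -` A \<inter> R = Some -` A" using A by auto
    have "A = (if None \<in> A then {None} \<union> Some ` (Some -` A \<inter> R) else Some ` (Some -` A \<inter> R))"
      unfolding live by (rule option_set_eq)
    then show "A \<in> sets (coffin_borel T R)"
      using sets.Un[OF none bwd[of "Some -` A"]] bwd[of "Some -` A"] A by metis
  qed
qed

section \<open>Sigma-linear functionals\<close>

text \<open>The functionals that behave like integration of nonnegative functions against a measure
  on \<open>B\<close>. Kernels, their iterates and expectations along a process are handled in this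
  form, so that no measure has to be constructed for them. The first clause allows values outside
  the space of \<open>B\<close> to be ignored.\<close>

definition sigma_linear :: "'a measure \<Rightarrow> (('a \<Rightarrow> ennreal) \<Rightarrow> ennreal) \<Rightarrow> bool" where
  "sigma_linear B L \<longleftrightarrow>
     (\<forall>g h. (\<forall>x\<in>space B. g x = h x) \<longrightarrow> L g = L h) \<and>
     (\<forall>c. \<forall>g\<in>borel_measurable B. L (\<lambda>x. c * g x) = c * L g) \<and>
     (\<forall>g\<in>borel_measurable B. \<forall>h\<in>borel_measurable B. L (\<lambda>x. g x + h x) = L g + L h) \<and>
     (\<forall>g. (\<forall>i::nat. g i \<in> borel_measurable B) \<longrightarrow> incseq g \<longrightarrow>
        L (\<lambda>x. SUP i. g i x) = (SUP i. L (g i)))"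

lemma sigma_linear_cong:
  "sigma_linear B L \<Longrightarrow> (\<And>x. x \<in> space B \<Longrightarrow> g x = h x) \<Longrightarrow> L g = L h"
  unfolding sigma_linear_def by blast

lemma sigma_linear_cmult:
  "sigma_linear B L \<Longrightarrow> g \<in> borel_measurable B \<Longrightarrow> L (\<lambda>x. c * g x) = c * L g"
  unfolding sigma_linear_def by blast

lemma sigma_linear_add:
  "sigma_linear B L \<Longrightarrow> g \<in> borel_measurable B \<Longrightarrow> h \<in> borel_measurable B \<Longrightarrow>
    L (\<lambda>x. g x + h x) = L g + L h"
  unfolding sigma_linear_def by blast

lemma sigma_linear_SUP:
  "sigma_linear B L \<Longrightarrow> (\<And>i::nat. g i \<in> borel_measurable B) \<Longrightarrow> incseq g \<Longrightarrow>
    L (\<lambda>x. SUP i. g i x) = (SUP i. L (g i))"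
  unfolding sigma_linear_def by blast

text \<open>Monotonicity is not a clause of the definition; it comes from continuity along the
  increasing sequence g, h, h, and so on.\<close>

lemma sigma_linear_mono:
  assumes L: "sigma_linear B L" and g: "g \<in> borel_measurable B" "h \<in> borel_measurable B" "g \<le> h"
  shows "L g \<le> L h"
proof -
  let ?f = "\<lambda>i::nat. if i = 0 then g else h"
  have S: "(SUP i. ?f i x) = h x" for x
  proof (rule antisym)
    show "(SUP i. ?f i x) \<le> h x" using g(3) by (intro SUP_least) (auto simp: le_fun_def)
    have "?f 1 x \<le> (SUP i. ?f i x)" by (rule SUP_upper) simp
    then show "h x \<le> (SUP i. ?f i x)" by simp
  qed
  have "L (\<lambda>x. SUP i. ?f i x) = (SUP i. L (?f i))"
    using g by (intro sigma_linear_SUP[OF L]) (auto simp: incseq_def)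
  moreover have "L g \<le> (SUP i. L (?f i))" by (rule SUP_upper2[of 0]) auto
  ultimately show ?thesis by (simp only: S)
qed

lemma sigma_linear_zero: "sigma_linear B L \<Longrightarrow> L (\<lambda>_. 0) = 0"
  using sigma_linear_cmult[of B L "\<lambda>_. 0" 0] by simp

lemma sigma_linear_suminf:
  assumes L: "sigma_linear B L" and g: "\<And>i::nat. g i \<in> borel_measurable B"
  shows "L (\<lambda>x. \<Sum>i. g i x) = (\<Sum>i. L (g i))"
proof -
  have sum: "L (\<lambda>x. \<Sum>i<n. g i x) = (\<Sum>i<n. L (g i))" for n
  proof (induction n)
    case (Suc n)
    have "L (\<lambda>x. (\<Sum>i<n. g i x) + g n x) = L (\<lambda>x. \<Sum>i<n. g i x) + L (g n)"
      by (intro sigma_linear_add[OF L] borel_measurable_sum g)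
    then show ?case using Suc by simp
  qed (simp add: sigma_linear_zero[OF L])
  have "L (\<lambda>x. \<Sum>i. g i x) = L (\<lambda>x. SUP n. \<Sum>i<n. g i x)"
    by (simp add: suminf_eq_SUP)
  also have "\<dots> = (SUP n. L (\<lambda>x. \<Sum>i<n. g i x))"
    by (rule sigma_linear_SUP[OF L]) (auto intro!: incseq_SucI le_funI borel_measurable_sum simp: g)
  finally show ?thesis by (simp add: sum suminf_eq_SUP)
qed

lemma sigma_linear_eval: "x \<in> space B \<Longrightarrow> sigma_linear B (\<lambda>g. g x)"
  by (auto simp: sigma_linear_def)

lemma sigma_linear_zero_fun: "sigma_linear B (\<lambda>g. 0)"
  by (auto simp: sigma_linear_def)

lemma sigma_linear_scale:
  assumes "sigma_linear B L" shows "sigma_linear B (\<lambda>g. c * L g)"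
  unfolding sigma_linear_def
proof (intro conjI allI ballI impI)
  fix g h :: "'a \<Rightarrow> ennreal" assume "\<forall>x\<in>space B. g x = h x"
  then have "L g = L h" by (intro sigma_linear_cong[OF assms]) simp
  then show "c * L g = c * L h" by simp
qed (simp_all add: sigma_linear_cmult[OF assms] sigma_linear_add[OF assms] sigma_linear_SUP[OF assms]
      SUP_mult_left_ennreal distrib_left mult.left_commute)

lemma sigma_linear_nn_integral:
  assumes L: "\<And>\<omega>. \<omega> \<in> space N \<Longrightarrow> sigma_linear B (Q \<omega>)"
    and m: "\<And>g. g \<in> borel_measurable B \<Longrightarrow> (\<lambda>\<omega>. Q \<omega> g) \<in> borel_measurable N"
  shows "sigma_linear B (\<lambda>g. \<integral>\<^sup>+\<omega>. Q \<omega> g \<partial>N)"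
  unfolding sigma_linear_def
proof (intro conjI allI ballI impI)
  fix g h :: "'b \<Rightarrow> ennreal" assume "\<forall>x\<in>space B. g x = h x"
  then show "(\<integral>\<^sup>+\<omega>. Q \<omega> g \<partial>N) = (\<integral>\<^sup>+\<omega>. Q \<omega> h \<partial>N)"
    by (intro nn_integral_cong sigma_linear_cong[OF L]) auto
next
  fix c and g :: "'b \<Rightarrow> ennreal" assume g: "g \<in> borel_measurable B"
  have "(\<integral>\<^sup>+\<omega>. Q \<omega> (\<lambda>x. c * g x) \<partial>N) = (\<integral>\<^sup>+\<omega>. c * Q \<omega> g \<partial>N)"
    by (intro nn_integral_cong sigma_linear_cmult[OF L] g)
  then show "(\<integral>\<^sup>+\<omega>. Q \<omega> (\<lambda>x. c * g x) \<partial>N) = c * (\<integral>\<^sup>+\<omega>. Q \<omega> g \<partial>N)"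
    by (simp add: nn_integral_cmult m g)
next
  fix g h :: "'b \<Rightarrow> ennreal" assume g: "g \<in> borel_measurable B" "h \<in> borel_measurable B"
  have "(\<integral>\<^sup>+\<omega>. Q \<omega> (\<lambda>x. g x + h x) \<partial>N) = (\<integral>\<^sup>+\<omega>. Q \<omega> g + Q \<omega> h \<partial>N)"
    by (intro nn_integral_cong sigma_linear_add[OF L] g)
  then show "(\<integral>\<^sup>+\<omega>. Q \<omega> (\<lambda>x. g x + h x) \<partial>N) = (\<integral>\<^sup>+\<omega>. Q \<omega> g \<partial>N) + (\<integral>\<^sup>+\<omega>. Q \<omega> h \<partial>N)"
    by (simp add: nn_integral_add m g)
next
  fix g :: "nat \<Rightarrow> 'b \<Rightarrow> ennreal" assume g: "\<forall>i. g i \<in> borel_measurable B" "incseq g"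
  have "(\<integral>\<^sup>+\<omega>. Q \<omega> (\<lambda>x. SUP i. g i x) \<partial>N) = (\<integral>\<^sup>+\<omega>. (SUP i. Q \<omega> (g i)) \<partial>N)"
    using g by (intro nn_integral_cong sigma_linear_SUP[OF L]) auto
  also have "\<dots> = (SUP i. \<integral>\<^sup>+\<omega>. Q \<omega> (g i) \<partial>N)"
  proof (rule nn_integral_monotone_convergence_SUP_AE)
    show "AE \<omega> in N. Q \<omega> (g i) \<le> Q \<omega> (g (Suc i))" for i
      using g by (intro AE_I2 sigma_linear_mono[OF L]) (auto simp: incseq_Suc_iff)
  qed (use g m in auto)
  finally show "(\<integral>\<^sup>+\<omega>. Q \<omega> (\<lambda>x. SUP i. g i x) \<partial>N) = (SUP i. \<integral>\<^sup>+\<omega>. Q \<omega> (g i) \<partial>N)" .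
qed

lemma sigma_linear_compose:
  assumes L: "sigma_linear B L"
    and Q: "\<And>y. y \<in> space B \<Longrightarrow> sigma_linear C (Q y)"
    and m: "\<And>f. f \<in> borel_measurable C \<Longrightarrow> (\<lambda>y. Q y f) \<in> borel_measurable B"
  shows "sigma_linear C (\<lambda>f. L (\<lambda>y. Q y f))"
  unfolding sigma_linear_def
proof (intro conjI allI ballI impI)
  fix f h :: "'b \<Rightarrow> ennreal" assume "\<forall>x\<in>space C. f x = h x"
  then show "L (\<lambda>y. Q y f) = L (\<lambda>y. Q y h)"
    by (intro sigma_linear_cong[OF L] sigma_linear_cong[OF Q]) auto
next
  fix c and f :: "'b \<Rightarrow> ennreal" assume f: "f \<in> borel_measurable C"
  have "L (\<lambda>y. Q y (\<lambda>x. c * f x)) = L (\<lambda>y. c * Q y f)"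
    by (intro sigma_linear_cong[OF L] sigma_linear_cmult[OF Q] f)
  then show "L (\<lambda>y. Q y (\<lambda>x. c * f x)) = c * L (\<lambda>y. Q y f)"
    by (simp only: sigma_linear_cmult[OF L m[OF f]])
next
  fix f h :: "'b \<Rightarrow> ennreal" assume f: "f \<in> borel_measurable C" and h: "h \<in> borel_measurable C"
  have "L (\<lambda>y. Q y (\<lambda>x. f x + h x)) = L (\<lambda>y. Q y f + Q y h)"
    by (intro sigma_linear_cong[OF L] sigma_linear_add[OF Q] f h)
  then show "L (\<lambda>y. Q y (\<lambda>x. f x + h x)) = L (\<lambda>y. Q y f) + L (\<lambda>y. Q y h)"
    by (simp only: sigma_linear_add[OF L m[OF f] m[OF h]])
next
  fix f :: "nat \<Rightarrow> 'b \<Rightarrow> ennreal" assume f: "\<forall>i. f i \<in> borel_measurable C" "incseq f"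
  \<comment> \<open>\<open>Q y\<close> is known to be monotone only for y in the space of
    \<open>B\<close>; the value 0 elsewhere makes the sequence increasing as a sequence of
    functions.\<close>
  let ?Q = "\<lambda>i y. if y \<in> space B then Q y (f i) else 0"
  have Qm: "?Q i \<in> borel_measurable B" for i
  proof -
    have "?Q i \<in> borel_measurable B \<longleftrightarrow> (\<lambda>y. Q y (f i)) \<in> borel_measurable B"
      by (rule measurable_cong) simp
    then show ?thesis using m f by simp
  qed
  have inc: "incseq ?Q"
  proof (rule incseq_SucI, rule le_funI)
    fix n y show "?Q n y \<le> ?Q (Suc n) y"
    proof (cases "y \<in> space B")
      case True
      have "f n \<le> f (Suc n)" using f(2) by (simp add: incseq_Suc_iff)
      from sigma_linear_mono[OF Q[OF True] _ _ this] show ?thesis using f(1) True by simp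
    qed simp
  qed
  have "L (\<lambda>y. Q y (\<lambda>x. SUP i. f i x)) = L (\<lambda>y. SUP i. ?Q i y)"
  proof (rule sigma_linear_cong[OF L])
    fix y assume y: "y \<in> space B"
    then show "Q y (\<lambda>x. SUP i. f i x) = (SUP i. ?Q i y)"
      using sigma_linear_SUP[OF Q[OF y] _ f(2)] f(1) by simp
  qed
  also have "\<dots> = (SUP i. L (?Q i))" by (rule sigma_linear_SUP[OF L Qm inc])
  also have "\<dots> = (SUP i. L (\<lambda>y. Q y (f i)))"
    by (intro SUP_cong refl sigma_linear_cong[OF L]) simp
  finally show "L (\<lambda>y. Q y (\<lambda>x. SUP i. f i x)) = (SUP i. L (\<lambda>y. Q y (f i)))" .
qed

text \<open>The pi-lambda argument for functionals. In the complement step the value at the set is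
  cancelled from the total, which is legitimate because the total is finite; functions are then
  reached by monotone approximation.\<close>

lemma sigma_linear_eqI:
  assumes L: "sigma_linear B L" "sigma_linear B L'"
    and G: "Int_stable \<C>" "\<C> \<subseteq> Pow (space B)" "sets B = sigma_sets (space B) \<C>"
    and fin: "L (\<lambda>_. 1) \<noteq> \<infinity>" and one: "L (\<lambda>_. 1) = L' (\<lambda>_. 1)"
    and eq: "\<And>A. A \<in> \<C> \<Longrightarrow> L (indicator A) = L' (indicator A)"
    and g: "g \<in> borel_measurable B"
  shows "L g = L' g"
proof -
  have ind: "L (indicator A) = L' (indicator A)" if "A \<in> sets B" for A
    using G(1,2) that unfolding G(3)
  proof (induction rule: sigma_sets_induct_disjoint)
    case (basic A)
    then show ?case by (rule eq)
  next
    case empty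
    show ?case using L[THEN sigma_linear_zero] by (simp add: indicator_def)
  next
    case (compl A)
    have A: "A \<in> sets B" using compl G(3) by simp
    have split: "K (\<lambda>_. 1) = K (indicator (space B - A)) + K (indicator A)" if K: "sigma_linear B K" for K
    proof -
      have "K (\<lambda>_. 1) = K (\<lambda>x. indicator (space B - A) x + indicator A x)"
        using sets.sets_into_space[OF A] by (intro sigma_linear_cong[OF K]) (auto simp: indicator_def)
      also have "\<dots> = K (indicator (space B - A)) + K (indicator A)"
        using A by (intro sigma_linear_add[OF K]) auto
      finally show ?thesis .
    qed
    have "L (indicator A) \<noteq> \<infinity>" using fin unfolding split[OF L(1)] by auto
    then show ?case using one compl unfolding split[OF L(1)] split[OF L(2)]
      by (metis add.commute ennreal_add_left_cancel infinity_ennreal_def)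
  next
    case (union A)
    have A: "A i \<in> sets B" for i using union G(3) by auto
    have "K (indicator (\<Union>i. A i)) = (\<Sum>i. K (indicator (A i)))" if K: "sigma_linear B K" for K
    proof -
      have "indicator (\<Union>i. A i) = (\<lambda>x. \<Sum>i. indicator (A i) x :: ennreal)"
        using union(1) by (auto simp: suminf_indicator)
      then show ?thesis using sigma_linear_suminf[OF K, of "\<lambda>i. indicator (A i)"] A by simp
    qed
    from this[OF L(1)] this[OF L(2)] show ?case by (simp only: union)
  qed
  show ?thesis using g
  proof (induction rule: borel_measurable_induct)
    case (cong f g)
    have "L f = L g" by (rule sigma_linear_cong[OF L(1) cong(3)])
    moreover have "L' f = L' g" by (rule sigma_linear_cong[OF L(2) cong(3)])
    ultimately show ?case using cong by simp
  next
    case (set A)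
    then show ?case by (rule ind)
  next
    case (mult u c)
    then show ?case by (simp only: sigma_linear_cmult[OF L(1) mult(2)] sigma_linear_cmult[OF L(2) mult(2)])
  next
    case (add u v)
    have m: "u \<in> borel_measurable B" "v \<in> borel_measurable B" by fact+
    show ?case
      by (simp only: add.IH sigma_linear_add[OF L(1) m(2,1)] sigma_linear_add[OF L(2) m(2,1)])
  next
    case (seq U)
    have "(SUP i. U i) = (\<lambda>x. SUP i. U i x)" by (rule ext) (rule SUP_apply)
    then show ?case
      using sigma_linear_SUP[OF L(1) seq(1) \<open>incseq U\<close>] sigma_linear_SUP[OF L(2) seq(1) \<open>incseq U\<close>] seq.IH
      by (simp only:)
  qed
qed

lemma Int_stable_boundary_at:
  assumes "weighted_tree T"
  shows "Int_stable (insert {} (boundary_at T ` sites T))"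
  using boundary_at_Int[OF assms] by (fastforce simp: Int_stable_def)

text \<open>The cell of the root is the whole boundary, so agreement on cells already contains
  agreement of the totals.\<close>

lemma sigma_linear_ray_eqI:
  assumes T: "weighted_tree T"
    and L: "sigma_linear (boundary_borel T) L" "sigma_linear (boundary_borel T) L'"
    and fin: "L (\<lambda>_. 1) \<noteq> \<infinity>"
    and eq: "\<And>i. i \<in> sites T \<Longrightarrow> L (indicator (boundary_at T i)) = L' (indicator (boundary_at T i))"
    and g: "g \<in> borel_measurable (boundary_borel T)"
  shows "L g = L' g"
proof (rule sigma_linear_eqI[OF L _ _ _ fin _ _ g])
  let ?G = "insert {} (boundary_at T ` sites T)"
  show "Int_stable ?G" by (rule Int_stable_boundary_at[OF T])
  show "?G \<subseteq> Pow (space (boundary_borel T))" using T by (auto simp: boundary_at_def)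
  show "sets (boundary_borel T) = sigma_sets (space (boundary_borel T)) ?G"
    unfolding sets_boundary_borel[OF T] space_boundary_borel[OF T]
    by (rule sigma_sets_eqI) (auto intro: sigma_sets.Empty sigma_sets.Basic)
  have "K (\<lambda>_. 1) = K (indicator (boundary_at T (origin T)))" if "sigma_linear (boundary_borel T) K" for K
    using boundary_at_origin[OF T] T by (intro sigma_linear_cong[OF that]) auto
  from this[OF L(1)] this[OF L(2)] show "L (\<lambda>_. 1) = L' (\<lambda>_. 1)"
    using eq[OF origin_in_sites[OF T]] by simp
  show "L (indicator A) = L' (indicator A)" if "A \<in> ?G" for A
    using that eq sigma_linear_zero[OF L(1)] sigma_linear_zero[OF L(2)] by (auto simp: indicator_def[abs_def])
qed

text \<open>The measures \<open>a\<close> and \<open>b\<close> may have more measurable sets than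
  the generated ones. This is the situation of two densities over M that are to be compared only on
  the past of a process.\<close>

lemma emeasure_eq_sigma_sets:
  assumes G: "Int_stable \<C>" "\<C> \<subseteq> Pow \<Omega>" and sp: "space a = \<Omega>" "space b = \<Omega>"
    and sub: "sigma_sets \<Omega> \<C> \<subseteq> sets a" "sigma_sets \<Omega> \<C> \<subseteq> sets b"
    and eq: "\<And>A. A \<in> \<C> \<Longrightarrow> emeasure a A = emeasure b A"
    and tot: "emeasure a \<Omega> = emeasure b \<Omega>" "emeasure a \<Omega> \<noteq> \<infinity>"
    and A: "A \<in> sigma_sets \<Omega> \<C>"
  shows "emeasure a A = emeasure b A"
  using G A
proof (induction rule: sigma_sets_induct_disjoint)
  case (compl A)
  have A: "A \<in> sets a" "A \<in> sets b" using compl sub by auto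
  have "emeasure a A \<le> emeasure a \<Omega>" using emeasure_space[of a A] sp by simp
  then have "emeasure a A \<noteq> \<infinity>" using tot(2) by (metis infinity_ennreal_def top_unique)
  then show ?case using emeasure_compl[OF A(1)] emeasure_compl[OF A(2)] compl.IH tot(1) sp by simp
next
  case (union A)
  have A: "range A \<subseteq> sets a" "range A \<subseteq> sets b" using union sub by auto
  have "emeasure a (\<Union>i. A i) = (\<Sum>i. emeasure a (A i))"
    using suminf_emeasure[OF A(1) union(1)] by simp
  also have "\<dots> = (\<Sum>i. emeasure b (A i))" by (simp only: union.IH)
  also have "\<dots> = emeasure b (\<Union>i. A i)" using suminf_emeasure[OF A(2) union(1)] by simp
  finally show ?case .
qed (auto intro: eq)

section \<open>Cylinder events\<close>

text \<open>Only live cells are prescribed; being dead at a given time enters through complements,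
  so these events still generate all the information of the process.\<close>

definition hits :: "('i, 'm) tree_data_scheme \<Rightarrow> 'w set \<Rightarrow> (real \<Rightarrow> 'w \<Rightarrow> (nat \<Rightarrow> 'i) option) \<Rightarrow>
    (real \<times> 'i) list \<Rightarrow> 'w set" where
  "hits T \<Omega> W l = {\<omega> \<in> \<Omega>. \<forall>(t, i)\<in>set l. W t \<omega> \<in> Some ` boundary_at T i}"

text \<open>Sorting the list does not change the event, which depends on the set of its entries
  only; in order of time the event can be evaluated by successive conditioning.\<close>

definition cylinders :: "('i, 'm) tree_data_scheme \<Rightarrow> 'w set \<Rightarrow> (real \<Rightarrow> 'w \<Rightarrow> (nat \<Rightarrow> 'i) option) \<Rightarrow>
    real set \<Rightarrow> 'w set set" where
  "cylinders T \<Omega> W I = {hits T \<Omega> W l |l. sorted (map fst l) \<and> set l \<subseteq> I \<times> sites T}"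

lemma hits_Nil [simp]: "hits T \<Omega> W [] = \<Omega>"
  by (simp add: hits_def)

lemma hits_Cons: "hits T \<Omega> W ((t, i) # l) = {\<omega> \<in> \<Omega>. W t \<omega> \<in> Some ` boundary_at T i} \<inter> hits T \<Omega> W l"
  by (auto simp: hits_def)

lemma hits_append: "hits T \<Omega> W (l @ l') = hits T \<Omega> W l \<inter> hits T \<Omega> W l'"
  unfolding hits_def set_append by blast

lemma Int_stable_cylinders: "Int_stable (cylinders T \<Omega> W I)"
  unfolding Int_stable_def
proof (intro ballI)
  fix a b assume "a \<in> cylinders T \<Omega> W I" "b \<in> cylinders T \<Omega> W I"
  then obtain l l' where l: "a = hits T \<Omega> W l" "b = hits T \<Omega> W l'"
    "set l \<subseteq> I \<times> sites T" "set l' \<subseteq> I \<times> sites T" by (auto simp: cylinders_def)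
  have "hits T \<Omega> W (sort_key fst (l @ l')) = hits T \<Omega> W (l @ l')" by (simp add: hits_def)
  then have "a \<inter> b = hits T \<Omega> W (sort_key fst (l @ l'))" by (simp add: hits_append l)
  then show "a \<inter> b \<in> cylinders T \<Omega> W I" using l unfolding cylinders_def
    by (auto intro!: exI[of _ "sort_key fst (l @ l')"])
qed

lemma cylinders_subset: "cylinders T \<Omega> W I \<subseteq> Pow \<Omega>"
  by (auto simp: cylinders_def hits_def)

lemma space_in_cylinders: "\<Omega> \<in> cylinders T \<Omega> W I"
  unfolding cylinders_def by (auto intro!: exI[of _ "[]"])

lemma sigma_sets_cylinders:
  assumes T: "weighted_tree T" and R: "R \<subseteq> boundary T"
    and W: "\<And>u \<omega>. u \<in> I \<Longrightarrow> \<omega> \<in> \<Omega> \<Longrightarrow> W u \<omega> \<in> insert None (Some ` R)"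
  shows "sigma_sets \<Omega> (\<Union>u\<in>I. {W u -` A \<inter> \<Omega> |A. A \<in> sets (coffin_borel T R)}) =
    sigma_sets \<Omega> (cylinders T \<Omega> W I)"
proof (rule sigma_sets_eqI)
  have W_iff: "W u -` Some ` (boundary_at T i \<inter> R) \<inter> \<Omega> = hits T \<Omega> W [(u, i)]" if "u \<in> I" for u i
  proof (rule set_eqI)
    fix \<omega> show "\<omega> \<in> W u -` Some ` (boundary_at T i \<inter> R) \<inter> \<Omega> \<longleftrightarrow> \<omega> \<in> hits T \<Omega> W [(u, i)]"
      using W[OF that, of \<omega>] by (cases "W u \<omega>") (auto simp: hits_def)
  qed
  fix a assume "a \<in> (\<Union>u\<in>I. {W u -` A \<inter> \<Omega> |A. A \<in> sets (coffin_borel T R)})"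
  then obtain u A where u: "u \<in> I" and A: "A \<in> sets (coffin_borel T R)" and a: "a = W u -` A \<inter> \<Omega>"
    by blast
  from A show "a \<in> sigma_sets \<Omega> (cylinders T \<Omega> W I)"
    unfolding sets_coffin_borel[OF T R] a
  proof (induction rule: sigma_sets.induct)
    case (Basic a)
    then obtain i where "i \<in> sites T" "a = Some ` (boundary_at T i \<inter> R)" by auto
    then have "W u -` a \<inter> \<Omega> = hits T \<Omega> W [(u, i)]" using W_iff[OF u] by simp
    moreover have "hits T \<Omega> W [(u, i)] \<in> cylinders T \<Omega> W I"
      unfolding cylinders_def using u \<open>i \<in> sites T\<close> by (intro CollectI exI[of _ "[(u, i)]"]) simp
    ultimately show ?case by (simp add: sigma_sets.Basic)
  next
    case (Compl a)
    have "W u -` (insert None (Some ` R) - a) \<inter> \<Omega> = \<Omega> - (W u -` a \<inter> \<Omega>)" using W[OF u] by blast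
    then show ?case using sigma_sets.Compl[OF Compl(2)] by simp
  next
    case (Union a)
    have "W u -` (\<Union>i. a i) \<inter> \<Omega> = (\<Union>i. W u -` a i \<inter> \<Omega>)" by blast
    then show ?case using sigma_sets.Union[OF Union(2)] by simp
  next
    case Empty
    show ?case unfolding vimage_empty Int_empty_left by (rule sigma_sets.Empty)
  qed
next
  define \<G> where "\<G> = (\<Union>u\<in>I. {W u -` A \<inter> \<Omega> |A. A \<in> sets (coffin_borel T R)})"
  define N where "N = sigma \<Omega> \<G>"
  have sub: "\<G> \<subseteq> Pow \<Omega>" unfolding \<G>_def by blast
  have sN: "sets N = sigma_sets \<Omega> \<G>" and spN: "space N = \<Omega>"
    using sub unfolding N_def by (simp_all add: sets_measure_of space_measure_of)
  have one: "{\<omega> \<in> \<Omega>. W u \<omega> \<in> Some ` boundary_at T i} \<in> sets N" if "u \<in> I" "i \<in> sites T" for u i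
  proof -
    have "{\<omega> \<in> \<Omega>. W u \<omega> \<in> Some ` boundary_at T i} = W u -` Some ` (boundary_at T i \<inter> R) \<inter> \<Omega>"
    proof (rule set_eqI)
      fix \<omega> show "\<omega> \<in> {\<omega> \<in> \<Omega>. W u \<omega> \<in> Some ` boundary_at T i} \<longleftrightarrow>
        \<omega> \<in> W u -` Some ` (boundary_at T i \<inter> R) \<inter> \<Omega>"
        using W[OF that(1), of \<omega>] by (cases "W u \<omega>") auto
    qed
    moreover have "Some ` (boundary_at T i \<inter> R) \<in> sets (coffin_borel T R)"
      unfolding sets_coffin_borel[OF T R] by (intro sigma_sets.Basic imageI that)
    ultimately have "{\<omega> \<in> \<Omega>. W u \<omega> \<in> Some ` boundary_at T i} \<in> \<G>"
      unfolding \<G>_def using that(1) by blast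
    then show ?thesis unfolding sN by (rule sigma_sets.Basic)
  qed
  fix b assume "b \<in> cylinders T \<Omega> W I"
  then obtain l where l: "b = hits T \<Omega> W l" "set l \<subseteq> I \<times> sites T"
    unfolding cylinders_def by blast
  have "hits T \<Omega> W l \<in> sets N" using l(2)
  proof (induction l)
    case (Cons p l)
    obtain t i where p: "p = (t, i)" by force
    have "{\<omega> \<in> \<Omega>. W t \<omega> \<in> Some ` boundary_at T i} \<in> sets N" using Cons.prems p by (intro one) auto
    moreover have "hits T \<Omega> W l \<in> sets N" using Cons by simp
    ultimately show ?case unfolding p hits_Cons by (rule sets.Int)
  next
    case Nil
    show ?case unfolding hits_Nil using sets.top[of N] spN by simp
  qed
  then show "b \<in> sigma_sets \<Omega> (\<Union>u\<in>I. {W u -` A \<inter> \<Omega> |A. A \<in> sets (coffin_borel T R)})"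
    by (simp only: l(1) sN \<G>_def)
qed

lemma sets_past:
  assumes T: "weighted_tree T" and R: "R \<subseteq> boundary T"
    and W: "\<And>u \<omega>. 0 \<le> u \<Longrightarrow> u \<le> s \<Longrightarrow> \<omega> \<in> space M \<Longrightarrow> W u \<omega> \<in> insert None (Some ` R)"
  shows "sets (past M (coffin_borel T R) W s) = sigma_sets (space M) (cylinders T (space M) W {0..s})"
proof -
  have "sets (past M (coffin_borel T R) W s) =
      sigma_sets (space M) (\<Union>u\<in>{0..s}. {W u -` A \<inter> space M |A. A \<in> sets (coffin_borel T R)})"
    unfolding past_def by (rule sets_measure_of) auto
  also have "\<dots> = sigma_sets (space M) (cylinders T (space M) W {0..s})"
    using W by (intro sigma_sets_cylinders[OF T R]) auto
  finally show ?thesis .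
qed

lemma space_past [simp]: "space (past M E W s) = space M"
  unfolding past_def by (rule space_measure_of) auto

lemma path_of_measurable:
  assumes "\<And>t. 0 \<le> t \<Longrightarrow> W t \<in> measurable M (borel_of_top (add_coffin X))"
  shows "path_of W \<in> measurable M (path_space X)"
  unfolding path_of_def path_space_def by (rule measurable_restrict) (use assms in auto)

lemma sets_path_space:
  assumes T: "weighted_tree T" and R: "R \<subseteq> boundary T"
  shows "sets (path_space (subtopology (boundary_top T) R)) =
    sigma_sets (space (path_space (subtopology (boundary_top T) R)))
      (cylinders T (space (path_space (subtopology (boundary_top T) R))) (\<lambda>t z. z t) {0..})"
proof -
  let ?E = "coffin_borel T R" and ?P = "path_space (subtopology (boundary_top T) R)"
  have P: "?P = PiM {0..} (\<lambda>_. ?E)" by (simp add: path_space_def coffin_borel_def)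
  have "sets ?P = sigma_sets (space ?P) (\<Union>u\<in>{0..}. {(\<lambda>z. z u) -` A \<inter> space ?P |A. A \<in> sets ?E})"
    unfolding P sets_PiM_single space_PiM
    by (intro arg_cong2[where f=sigma_sets] set_eqI iffI) (auto simp: vimage_def Int_def conj_commute)
  also have "\<dots> = sigma_sets (space ?P) (cylinders T (space ?P) (\<lambda>t z. z t) {0..})"
    by (rule sigma_sets_cylinders[OF T R]) (auto simp: P space_PiM PiE_iff space_coffin_borel[OF T R])
  finally show ?thesis .
qed

text \<open>Cylinders with live cells are closed under intersection and generate the product
  sigma-algebra on paths, so they determine the law.\<close>

lemma path_law_eqI:
  assumes T: "weighted_tree T" and R: "R \<subseteq> boundary T"
    and pM: "prob_space M" and pN: "prob_space N"
    and W: "\<And>t. 0 \<le> t \<Longrightarrow> W t \<in> measurable M (coffin_borel T R)"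
    and V: "\<And>t. 0 \<le> t \<Longrightarrow> V t \<in> measurable N (coffin_borel T R)"
    and eq: "\<And>l. sorted (map fst l) \<Longrightarrow> set l \<subseteq> {0..} \<times> sites T \<Longrightarrow>
      emeasure M (hits T (space M) W l) = emeasure N (hits T (space N) V l)"
  shows "distr M (path_space (subtopology (boundary_top T) R)) (path_of W) =
    distr N (path_space (subtopology (boundary_top T) R)) (path_of V)"
proof -
  let ?P = "path_space (subtopology (boundary_top T) R)"
  interpret M: prob_space M by fact
  interpret N: prob_space N by fact
  have mW: "path_of W \<in> measurable M ?P" and mV: "path_of V \<in> measurable N ?P"
    using W V by (auto intro!: path_of_measurable simp flip: coffin_borel_def)
  interpret dM: prob_space "distr M ?P (path_of W)" by (rule M.prob_space_distr[OF mW])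
  interpret dN: prob_space "distr N ?P (path_of V)" by (rule N.prob_space_distr[OF mV])
  let ?G = "cylinders T (space ?P) (\<lambda>t z. z t) {0..}"
  have sub: "?G \<subseteq> sets ?P" unfolding sets_path_space[OF T R] by auto
  have vim: "path_of W -` hits T (space ?P) (\<lambda>t z. z t) l \<inter> space M = hits T (space M) W l"
    if "path_of W \<in> measurable M ?P" "set l \<subseteq> {0..} \<times> sites T" for M :: "'x measure" and W l
    using measurable_space[OF that(1)] that(2) by (fastforce simp: hits_def path_of_def)
  show ?thesis
  proof (rule measure_eqI)
    fix A assume "A \<in> sets (distr M ?P (path_of W))"
    then have A: "A \<in> sigma_sets (space ?P) ?G" using sets_path_space[OF T R] by simp
    show "emeasure (distr M ?P (path_of W)) A = emeasure (distr N ?P (path_of V)) A"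
    proof (rule emeasure_eq_sigma_sets[OF Int_stable_cylinders cylinders_subset _ _ _ _ _ _ _ A])
      fix B assume B: "B \<in> ?G"
      then obtain l where l: "B = hits T (space ?P) (\<lambda>t z. z t) l" "sorted (map fst l)"
        "set l \<subseteq> {0..} \<times> sites T" by (auto simp: cylinders_def)
      then show "emeasure (distr M ?P (path_of W)) B = emeasure (distr N ?P (path_of V)) B"
        using B sub eq vim[OF mW, of l] vim[OF mV, of l] by (simp add: emeasure_distr mW mV subset_iff)
    qed (use dM.emeasure_space_1 dN.emeasure_space_1 sets_path_space[OF T R] in auto)
  qed simp
qed

section \<open>The semigroup of a hierarchy of cells\<close>

text \<open>One computation serves the whole tree and the subtree. Since a ray of the subtree is
  represented by its extension to the whole tree, the n-th cell is read at level n + d, with d = 0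
  or d = 1. \<open>D\<close> is the sequence of weight increments, and \<open>i0\<close> is the root
  of the tree or subtree, through which almost all rays pass.\<close>

locale ray_hierarchy = prob_space \<mu> for \<mu> :: "(nat \<Rightarrow> 'i) measure" +
  fixes T :: "'i tree_data" and d :: nat and D :: "nat \<Rightarrow> real" and i0 :: 'i
  assumes tree: "weighted_tree T"
    and sets_\<mu>: "sets \<mu> = sets (boundary_borel T)"
    and D_pos: "D n > 0"
    and base: "AE x in \<mu>. x d = i0"
begin

definition mass :: "nat \<Rightarrow> (nat \<Rightarrow> 'i) \<Rightarrow> real" where
  "mass n x = measure \<mu> {y \<in> boundary T. y (n + d) = x (n + d)}"

definition g :: "nat \<Rightarrow> (nat \<Rightarrow> 'i) \<Rightarrow> real" where
  "g n x = (\<Sum>k. D (n + k) * mass (n + k) x)"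

definition coef :: "real \<Rightarrow> nat \<Rightarrow> (nat \<Rightarrow> 'i) \<Rightarrow> ennreal" where
  "coef t n x = ennreal ((exp (- t / g n x) - exp (- t / g (Suc n) x)) / mass n x)"

definition p :: "real \<Rightarrow> (nat \<Rightarrow> 'i) \<Rightarrow> (nat \<Rightarrow> 'i) \<Rightarrow> ennreal" where
  "p t x y = (\<Sum>n. if x (n + d) = y (n + d) then coef t n x else 0)"

text \<open>The density \<open>p 0\<close> is identically \<open>0\<close>, whence the separate clause for \<open>t = 0\<close>.\<close>

definition P :: "real \<Rightarrow> ((nat \<Rightarrow> 'i) \<Rightarrow> ennreal) \<Rightarrow> (nat \<Rightarrow> 'i) \<Rightarrow> ennreal" where
  "P t f x = (if t = 0 then f x else \<integral>\<^sup>+y. p t x y * f y \<partial>\<mu>)"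

text \<open>The nondegenerate points. At the others, a vanishing mass makes a quotient in
  \<open>coef\<close> equal to 0 by convention, or \<open>suminf\<close> in \<open>g\<close> is
  applied to a divergent series, and \<open>p\<close> no longer has its intended meaning.\<close>

definition good :: "(nat \<Rightarrow> 'i) \<Rightarrow> bool" where
  "good x \<longleftrightarrow> (\<forall>n. 0 < mass n x) \<and> summable (\<lambda>k. D k * mass k x)"

abbreviation "\<B> \<equiv> boundary_borel T"

lemma space_\<mu>: "space \<mu> = boundary T"
  using sets_eq_imp_space_eq[OF sets_\<mu>] tree by simp

lemma measurable_\<mu>: "measurable \<mu> N = measurable \<B> N"
  by (rule measurable_cong_sets[OF sets_\<mu> refl])

lemma level_set_in_sets: "{y \<in> boundary T. y n = i} \<in> sets \<B>"
proof -
  have "(\<lambda>y. indicator {i} (y n) :: real) \<in> borel_measurable \<B>"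
    by (rule measurable_level_comp[OF tree])
  from measurable_sets[OF this, of "{1}"]
  have "(\<lambda>y. indicator {i} (y n) :: real) -` {1} \<inter> space \<B> \<in> sets \<B>" by simp
  also have "(\<lambda>y. indicator {i} (y n) :: real) -` {1} \<inter> space \<B> = {y \<in> boundary T. y n = i}"
    using tree by (auto simp: indicator_def split: if_splits)
  finally show ?thesis .
qed

lemma mass_measurable [measurable]: "mass n \<in> borel_measurable \<B>"
  unfolding mass_def[abs_def]
  by (rule measurable_level_comp[OF tree, where f="\<lambda>i. measure \<mu> {y \<in> boundary T. y (n + d) = i}"])

lemma g_measurable [measurable]: "g n \<in> borel_measurable \<B>"
  unfolding g_def[abs_def] by measurable

lemma coef_measurable [measurable]: "coef t n \<in> borel_measurable \<B>"
  unfolding coef_def[abs_def] by measurable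

lemma agree_measurable [measurable]:
  "Measurable.pred (\<B> \<Otimes>\<^sub>M \<B>) (\<lambda>z. fst z n = snd z n)"
proof -
  have "{z \<in> space (\<B> \<Otimes>\<^sub>M \<B>). fst z n = snd z n} =
      (\<Union>i\<in>sites T. {y \<in> boundary T. y n = i} \<times> {y \<in> boundary T. y n = i})"
    using ray_site[OF tree] tree by (auto simp: space_pair_measure)
  also have "\<dots> \<in> sets (\<B> \<Otimes>\<^sub>M \<B>)"
    by (intro sets.countable_UN' countable_sites[OF tree]) (auto intro!: pair_measureI level_set_in_sets)
  finally show ?thesis unfolding pred_def .
qed

lemma p_measurable_pair: "(\<lambda>z. p t (fst z) (snd z)) \<in> borel_measurable (\<B> \<Otimes>\<^sub>M \<B>)"
  unfolding p_def by measurable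

lemma p_measurable2 [measurable]: "x \<in> boundary T \<Longrightarrow> p t x \<in> borel_measurable \<B>"
  using measurable_compose[OF measurable_Pair1' p_measurable_pair, of x t] tree by simp

lemma P_measurable [measurable]:
  assumes f: "f \<in> borel_measurable \<B>"
  shows "P t f \<in> borel_measurable \<B>"
proof (cases "t = 0")
  case False
  have pr: "sets (\<B> \<Otimes>\<^sub>M \<mu>) = sets (\<B> \<Otimes>\<^sub>M \<B>)" by (intro sets_pair_measure_cong sets_\<mu> refl)
  have "(\<lambda>z. p t (fst z) (snd z) * f (snd z)) \<in> borel_measurable (\<B> \<Otimes>\<^sub>M \<B>)"
    using p_measurable_pair[of t] f by measurable
  then have "(\<lambda>(x, y). p t x y * f y) \<in> borel_measurable (\<B> \<Otimes>\<^sub>M \<mu>)"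
    unfolding measurable_cong_sets[OF pr refl] by (simp add: split_beta')
  then have "(\<lambda>x. \<integral>\<^sup>+y. p t x y * f y \<partial>\<mu>) \<in> borel_measurable \<B>"
    by (rule borel_measurable_nn_integral)
  then show ?thesis using False by (simp add: P_def[abs_def])
qed (use f in \<open>simp add: P_def[abs_def]\<close>)

lemma P_sigma_linear:
  assumes x: "x \<in> boundary T" shows "sigma_linear \<B> (\<lambda>f. P t f x)"
proof (cases "t = 0")
  case True
  then show ?thesis using x tree by (simp add: P_def sigma_linear_eval)
next
  case False
  have "sigma_linear \<B> (\<lambda>f. \<integral>\<^sup>+y. p t x y * f y \<partial>\<mu>)"
  proof (rule sigma_linear_nn_integral)
    show "sigma_linear \<B> (\<lambda>f. p t x y * f y)" if "y \<in> space \<mu>" for y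
      using that space_\<mu> tree by (intro sigma_linear_scale sigma_linear_eval) simp
    show "(\<lambda>y. p t x y * f y) \<in> borel_measurable \<mu>" if "f \<in> borel_measurable \<B>" for f
      unfolding measurable_\<mu> using that x by measurable
  qed
  then show ?thesis using False by (simp add: P_def)
qed

lemma mass_nonneg: "0 \<le> mass n x"
  by (simp add: mass_def)

lemma D_mass_nonneg: "0 \<le> D k * mass k x"
  by (rule mult_nonneg_nonneg[OF less_imp_le[OF D_pos] mass_nonneg])

text \<open>
  All tails of a divergent series have the same unspecified \<open>suminf\<close>, so the differences in \<open>coef\<close>
  vanish.
\<close>

lemma p_zero_of_not_summable:
  assumes "\<not> summable (\<lambda>k. D k * mass k x)"
  shows "p t x y = 0"
proof -
  have ns: "\<not> summable (\<lambda>k. D (n + k) * mass (n + k) x)" for n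
    using assms summable_iff_shift[of "\<lambda>k. D k * mass k x" n] by (simp add: add.commute)
  have "(\<lambda>s. (\<lambda>k. D (n + k) * mass (n + k) x) sums s) = (\<lambda>s. False)" for n
    using ns[of n] by (auto simp: summable_def)
  then have "g n x = (THE s. False)" for n
    unfolding g_def suminf_def by simp
  then have "g n x = g (Suc n) x" for n by metis
  then have c: "coef t n x = 0" for n unfolding coef_def by simp
  show ?thesis unfolding p_def c by simp
qed

text \<open>Convergence of a series of nonnegative terms is expressed as finiteness of its sum in
  \<open>ennreal\<close>, which depends measurably on the point.\<close>

lemma good_measurable: "{x \<in> boundary T. good x} \<in> sets \<B>"
proof -
  have "{x \<in> boundary T. good x} = {x \<in> space \<B>. (\<forall>n. 0 < mass n x) \<and> (\<Sum>k. ennreal (D k * mass k x)) < \<infinity>}"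
  proof (intro set_eqI iffI)
    fix x assume x: "x \<in> {x \<in> boundary T. good x}"
    then have "(\<Sum>k. ennreal (D k * mass k x)) = ennreal (\<Sum>k. D k * mass k x)"
      by (intro suminf_ennreal2) (auto simp: good_def D_mass_nonneg)
    then show "x \<in> {x \<in> space \<B>. (\<forall>n. 0 < mass n x) \<and> (\<Sum>k. ennreal (D k * mass k x)) < \<infinity>}"
      using x tree by (simp add: good_def)
  next
    fix x assume x: "x \<in> {x \<in> space \<B>. (\<forall>n. 0 < mass n x) \<and> (\<Sum>k. ennreal (D k * mass k x)) < \<infinity>}"
    then have "summable (\<lambda>k. D k * mass k x)"
      by (intro summable_suminf_not_top) (auto simp: D_mass_nonneg)
    then show "x \<in> {x \<in> boundary T. good x}" using x tree by (simp add: good_def)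
  qed
  also have "\<dots> \<in> sets \<B>" by measurable
  finally show ?thesis .
qed

context
  fixes x assumes x: "x \<in> boundary T" and good: "good x"
begin

lemma mass_pos: "0 < mass n x"
  using good by (simp add: good_def)

lemma g_summable: "summable (\<lambda>k. D (n + k) * mass (n + k) x)"
  using good summable_iff_shift[of "\<lambda>k. D k * mass k x" n] by (simp add: good_def add.commute)

lemma g_pos: "0 < g n x"
  unfolding g_def by (rule suminf_pos[OF g_summable]) (simp add: mass_pos D_pos)

lemma g_Suc: "g n x = D n * mass n x + g (Suc n) x"
  using suminf_split_head[OF g_summable, of n] unfolding g_def by simp

lemma g_Suc_less: "g (Suc n) x < g n x"
  using g_Suc[of n] mass_pos[of n] D_pos[of n] by simp

lemma g_tendsto: "(\<lambda>n. g n x) \<longlonglongrightarrow> 0"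
proof -
  have "(\<lambda>n. \<Sum>k. D (k + n) * mass (k + n) x) \<longlonglongrightarrow> 0"
    using suminf_exist_split2[of "\<lambda>k. D k * mass k x"] good by (simp add: good_def)
  then show ?thesis by (simp add: g_def add.commute)
qed

text \<open>The cell of a good point at level 0 has positive mass, whereas almost every ray passes
  through \<open>i0\<close>.\<close>

lemma base_point: "x d = i0"
proof (rule ccontr)
  assume "x d \<noteq> i0"
  then have "AE y in \<mu>. \<not> (y \<in> {y \<in> boundary T. y (0 + d) = x (0 + d)})"
    using base \<open>x d \<noteq> i0\<close> by (auto elim!: eventually_mono)
  then have "{y \<in> boundary T. y (0 + d) = x (0 + d)} \<in> null_sets \<mu>"
    using level_set_in_sets[of "0 + d" "x (0 + d)"] by (subst AE_iff_null_sets) (simp_all add: sets_\<mu>)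
  then have "mass 0 x = 0" by (simp add: mass_def measure_eq_0_null_sets)
  then show False using mass_pos[of 0] by simp
qed

lemma mass_0: "mass 0 x = 1"
proof -
  have "AE y in \<mu>. y \<in> {y \<in> boundary T. y (0 + d) = x (0 + d)}"
    using base AE_space by eventually_elim (auto simp: base_point space_\<mu>)
  then show ?thesis unfolding mass_def using level_set_in_sets[of "0 + d" "x (0 + d)"]
    by (subst prob_eq_1) (simp_all add: sets_\<mu>)
qed

lemma exp_g_mono: "0 \<le> t \<Longrightarrow> exp (- t / g (Suc n) x) \<le> exp (- t / g n x)"
  using g_pos[of n] g_pos[of "Suc n"] g_Suc_less[of n] by (simp add: frac_le)

text \<open>The sum telescopes, and exp (- t / g n x) tends to 0 because g n x does and t >
  0.\<close>

lemma exp_g_sums: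
  assumes t: "0 < t"
  shows "(\<lambda>n. exp (- t / g n x) - exp (- t / g (Suc n) x)) sums exp (- t / g 0 x)"
proof -
  have "filterlim (\<lambda>n. inverse (g n x)) at_top sequentially"
    using g_tendsto by (rule filterlim_inverse_at_top) (simp add: g_pos)
  then have "filterlim (\<lambda>n. t * inverse (g n x)) at_top sequentially"
    by (rule filterlim_tendsto_pos_mult_at_top[OF tendsto_const t])
  then have "filterlim (\<lambda>n. - t / g n x) at_bot sequentially"
    by (simp add: filterlim_uminus_at_bot divide_inverse)
  then have "(\<lambda>n. exp (- t / g n x)) \<longlonglongrightarrow> 0"
    by (rule filterlim_compose[OF exp_at_bot])
  from telescope_sums'[OF this] show ?thesis by simp
qed

text \<open>Integrating \<open>p\<close> term by term, the mass of each cell cancels the denominator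
  in \<open>coef\<close> and a telescoping sum remains: from a good point the survival probability
  decays exponentially at rate 1 / g 0 x.\<close>

lemma P_one:
  assumes t: "0 \<le> t"
  shows "P t (\<lambda>_. 1) x = (if t = 0 then 1 else ennreal (exp (- t / g 0 x)))"
proof (cases "t = 0")
  case False
  with t have t: "0 < t" by simp
  have "P t (\<lambda>_. 1) x = (\<integral>\<^sup>+y. (\<Sum>n. coef t n x * indicator {y \<in> boundary T. y (n + d) = x (n + d)} y) \<partial>\<mu>)"
    using False space_\<mu> unfolding P_def p_def
    by (auto intro!: nn_integral_cong suminf_cong simp: indicator_def)
  also have "\<dots> = (\<Sum>n. \<integral>\<^sup>+y. coef t n x * indicator {y \<in> boundary T. y (n + d) = x (n + d)} y \<partial>\<mu>)"
    by (intro nn_integral_suminf borel_measurable_times_ennreal borel_measurable_const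
        borel_measurable_indicator) (simp add: sets_\<mu> level_set_in_sets)
  also have "\<dots> = (\<Sum>n. coef t n x * emeasure \<mu> {y \<in> boundary T. y (n + d) = x (n + d)})"
    by (intro suminf_cong nn_integral_cmult_indicator) (simp add: sets_\<mu> level_set_in_sets)
  also have "\<dots> = (\<Sum>n. ennreal (exp (- t / g n x) - exp (- t / g (Suc n) x)))"
  proof (intro suminf_cong)
    fix n
    have "coef t n x * emeasure \<mu> {y \<in> boundary T. y (n + d) = x (n + d)} = coef t n x * ennreal (mass n x)"
      by (simp add: emeasure_eq_measure mass_def)
    also have "\<dots> = ennreal (exp (- t / g n x) - exp (- t / g (Suc n) x))"
      unfolding coef_def using mass_pos[of n] exp_g_mono[of t n] t
      by (subst ennreal_mult[symmetric]) auto
    finally show "coef t n x * emeasure \<mu> {y \<in> boundary T. y (n + d) = x (n + d)} =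
      ennreal (exp (- t / g n x) - exp (- t / g (Suc n) x))" .
  qed
  also have "\<dots> = ennreal (\<Sum>n. exp (- t / g n x) - exp (- t / g (Suc n) x))"
    using exp_g_mono[of t] t sums_summable[OF exp_g_sums[OF t]] by (intro suminf_ennreal2) auto
  also have "(\<Sum>n. exp (- t / g n x) - exp (- t / g (Suc n) x)) = exp (- t / g 0 x)"
    using exp_g_sums[OF t] by (simp add: sums_iff)
  finally show ?thesis using False by simp
qed (simp add: P_def)

lemma g_eq_diff: "g n x = g 0 x - (\<Sum>k<n. D k * mass k x)"
proof (induction n)
  case (Suc n)
  then show ?case using g_Suc[of n] by simp
qed simp

end

lemma singleton_in_sets:
  assumes x: "x \<in> boundary T" shows "{x} \<in> sets \<B>"
proof -
  have "{x} = (\<Inter>n. {y \<in> boundary T. y n = x n})" using x by (auto simp: fun_eq_iff)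
  also have "\<dots> \<in> sets \<B>"
    by (rule sets.countable_INT) (auto intro: level_set_in_sets)
  finally show ?thesis .
qed

lemma P_null:
  assumes "0 < t" "AE y in \<mu>. f y = 0" shows "P t f x = 0"
proof -
  have "AE y in \<mu>. p t x y * f y = 0" using assms(2) by eventually_elim simp
  then have "(\<integral>\<^sup>+y. p t x y * f y \<partial>\<mu>) = (\<integral>\<^sup>+y. 0 \<partial>\<mu>)" by (rule nn_integral_cong_AE)
  then show ?thesis using assms(1) by (simp add: P_def)
qed

lemma P_one_good:
  assumes "x \<in> boundary T" "good x" "0 < t"
  shows "P t (\<lambda>_. 1) x = ennreal (exp (- t / g 0 x))"
  using P_one[OF assms(1,2), of t] assms(3) by simp

lemma P_one_le:
  assumes "x \<in> boundary T" "good x" "0 < t"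
  shows "P t (\<lambda>_. 1) x \<le> 1"
  unfolding P_one_good[OF assms] using g_pos[OF assms(1,2), of 0] assms(3)
  by (simp add: ennreal_le_1)

lemma mass_cong:
  assumes "x \<in> boundary T" "y \<in> boundary T" "x (n + d) = y (n + d)" "k \<le> n"
  shows "mass k x = mass k y"
proof -
  have "x (k + d) = y (k + d)" using ray_agree_mono[OF assms(1-3)] assms(4) by simp
  then show ?thesis by (simp only: mass_def)
qed

text \<open>Only levels at which the two rays agree contribute. At such a level the masses of all
  earlier cells coincide, and \<open>g_eq_diff\<close> recovers both tails in \<open>coef\<close>
  from these masses and the common value of \<open>g 0\<close>.\<close>

lemma p_symmetric:
  assumes x: "x \<in> boundary T" "good x" and y: "y \<in> boundary T" "good y" and eq: "g 0 x = g 0 y"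
  shows "p t x y = p t y x"
proof -
  have "coef t n x = coef t n y" if "x (n + d) = y (n + d)" for n
  proof -
    have m: "mass k x = mass k y" if "k \<le> n" for k
      using mass_cong[OF x(1) y(1) \<open>x (n + d) = y (n + d)\<close> that] .
    have "g n x = g n y"
      using g_eq_diff[OF x, of n] g_eq_diff[OF y, of n] eq m by simp
    moreover have "g (Suc n) x = g (Suc n) y"
      using g_eq_diff[OF x, of "Suc n"] g_eq_diff[OF y, of "Suc n"] eq m by simp
    ultimately show ?thesis using m by (simp add: coef_def)
  qed
  then show ?thesis unfolding p_def by (intro suminf_cong) auto
qed

text \<open>Symmetry of the density allows Fubini to exchange the roles of the two points; the inner
  integral is then the survival probability, the same constant for almost every starting
  point.\<close>

lemma nn_integral_P:
  assumes AEg: "AE x in \<mu>. good x \<and> g 0 x = c" and t: "0 < t" and f: "f \<in> borel_measurable \<B>"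
  shows "(\<integral>\<^sup>+x. P t f x \<partial>\<mu>) = ennreal (exp (- t / c)) * (\<integral>\<^sup>+x. f x \<partial>\<mu>)"
proof -
  interpret pair_sigma_finite \<mu> \<mu> by standard
  have pr: "sets (\<mu> \<Otimes>\<^sub>M \<mu>) = sets (\<B> \<Otimes>\<^sub>M \<B>)" by (intro sets_pair_measure_cong sets_\<mu>)
  have m: "(\<lambda>(x, y). p t y x * f y) \<in> borel_measurable (\<mu> \<Otimes>\<^sub>M \<mu>)"
  proof -
    have "(\<lambda>z. p t (fst z) (snd z)) \<in> borel_measurable (\<mu> \<Otimes>\<^sub>M \<mu>)"
      unfolding measurable_cong_sets[OF pr refl] by (rule p_measurable_pair)
    from measurable_pair_swap[OF this]
    have "(\<lambda>z. p t (snd z) (fst z)) \<in> borel_measurable (\<mu> \<Otimes>\<^sub>M \<mu>)" by (simp add: split_beta')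
    moreover have "f \<in> borel_measurable \<mu>" using f by (simp add: measurable_\<mu>)
    ultimately show ?thesis unfolding split_beta' by measurable
  qed
  have "(\<integral>\<^sup>+x. P t f x \<partial>\<mu>) = (\<integral>\<^sup>+x. (\<integral>\<^sup>+y. p t y x * f y \<partial>\<mu>) \<partial>\<mu>)"
  proof (rule nn_integral_cong_AE)
    show "AE x in \<mu>. P t f x = (\<integral>\<^sup>+y. p t y x * f y \<partial>\<mu>)"
      using AEg AE_space
    proof eventually_elim
      case (elim x)
      have "AE y in \<mu>. p t x y * f y = p t y x * f y"
        using AEg AE_space by eventually_elim (use elim p_symmetric[of x] space_\<mu> in auto)
      then show ?case using t by (simp add: P_def cong: nn_integral_cong_AE)
    qed
  qed
  also have "\<dots> = (\<integral>\<^sup>+y. (\<integral>\<^sup>+x. p t y x * f y \<partial>\<mu>) \<partial>\<mu>)"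
    using Fubini'[OF m] by simp
  also have "\<dots> = (\<integral>\<^sup>+y. ennreal (exp (- t / c)) * f y \<partial>\<mu>)"
  proof (rule nn_integral_cong_AE)
    show "AE y in \<mu>. (\<integral>\<^sup>+x. p t y x * f y \<partial>\<mu>) = ennreal (exp (- t / c)) * f y"
      using AEg AE_space
    proof eventually_elim
      case (elim y)
      then have y: "y \<in> boundary T" "good y" "g 0 y = c" using space_\<mu> by auto
      have "(\<integral>\<^sup>+x. p t y x * f y \<partial>\<mu>) = (\<integral>\<^sup>+x. p t y x \<partial>\<mu>) * f y"
        using p_measurable2[OF y(1)] by (simp add: nn_integral_multc measurable_\<mu>)
      then show ?case using P_one[OF y(1,2), of t] t y(3) by (simp add: P_def)
    qed
  qed
  also have "\<dots> = ennreal (exp (- t / c)) * (\<integral>\<^sup>+x. f x \<partial>\<mu>)"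
    using f by (simp add: nn_integral_cmult measurable_\<mu>)
  finally show ?thesis .
qed

text \<open>The finite-dimensional distributions prescribed by the semigroup: started at the given
  point at time s, this is the expectation of \<open>f\<close> at the last listed time on the event
  that the listed cells are hit. For the empty list the last time is s itself.\<close>

fun \<Phi> :: "real \<Rightarrow> (real \<times> 'i) list \<Rightarrow> ((nat \<Rightarrow> 'i) \<Rightarrow> ennreal) \<Rightarrow> (nat \<Rightarrow> 'i) \<Rightarrow> ennreal" where
  "\<Phi> s [] f = f"
| "\<Phi> s ((t, i) # l) f = P (t - s) (\<lambda>y. indicator (boundary_at T i) y * \<Phi> t l f y)"

lemma \<Phi>_measurable:
  assumes "f \<in> borel_measurable \<B>" "snd ` set l \<subseteq> sites T"
  shows "\<Phi> s l f \<in> borel_measurable \<B>"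
  using assms
  by (induction s l f rule: \<Phi>.induct)
    (auto intro!: P_measurable borel_measurable_times_ennreal borel_measurable_indicator
      boundary_at_in_sets[OF tree])

lemma \<Phi>_sigma_linear:
  assumes "snd ` set l \<subseteq> sites T" "x \<in> boundary T"
  shows "sigma_linear \<B> (\<lambda>f. \<Phi> s l f x)"
  using assms
proof (induction l arbitrary: s x)
  case Nil
  then show ?case using tree by (simp add: sigma_linear_eval)
next
  case (Cons a l)
  obtain t i where a: "a = (t, i)" by force
  have "sigma_linear \<B> (\<lambda>f. P (t - s) (\<lambda>y. indicator (boundary_at T i) y * \<Phi> t l f y) x)"
  proof (rule sigma_linear_compose[OF P_sigma_linear[OF Cons.prems(2)]])
    fix y assume "y \<in> space \<B>"
    then show "sigma_linear \<B> (\<lambda>f. indicator (boundary_at T i) y * \<Phi> t l f y)"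
      using Cons tree by (intro sigma_linear_scale) simp
  next
    fix f :: "(nat \<Rightarrow> 'i) \<Rightarrow> ennreal" assume "f \<in> borel_measurable \<B>"
    then show "(\<lambda>y. indicator (boundary_at T i) y * \<Phi> t l f y) \<in> borel_measurable \<B>"
      using Cons.prems a by (intro borel_measurable_times_ennreal borel_measurable_indicator
          boundary_at_in_sets[OF tree] \<Phi>_measurable) auto
  qed
  then show ?case by (simp only: a \<Phi>.simps)
qed

lemma \<Phi>_snoc:
  "\<Phi> u (l @ [(s, i), (t, j)]) f =
    \<Phi> u (l @ [(s, i)]) (P (t - s) (\<lambda>y. indicator (boundary_at T j) y * f y))"
  by (induction l arbitrary: u) auto

text \<open>The cell of the root imposes no restriction on a ray, so an entry for it merely moves
  the evaluation of \<open>f\<close> to time s. This is the bridge between test functions at the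
  last time and hits of a last cell.\<close>

lemma \<Phi>_last:
  "\<Phi> u (l @ [(s, origin T)]) (indicator (boundary_at T i)) = \<Phi> u (l @ [(s, i)]) (\<lambda>_. 1)"
proof (induction l arbitrary: u)
  case Nil
  have "(\<lambda>y. indicator (boundary_at T (origin T)) y * indicator (boundary_at T i) y :: ennreal) =
      (\<lambda>y. indicator (boundary_at T i) y * 1)"
    unfolding boundary_at_origin[OF tree] by (auto simp: indicator_def boundary_at_def fun_eq_iff)
  then show ?case by simp
qed auto

lemma \<Phi>_shift: "\<Phi> (s + c) (map (\<lambda>(t, i). (t + c, i)) l) f = \<Phi> s l f"
  by (induction l arbitrary: s) auto

end

definition lift :: "('a \<Rightarrow> ennreal) \<Rightarrow> 'a option \<Rightarrow> ennreal" where
  "lift f w = (case w of None \<Rightarrow> 0 | Some x \<Rightarrow> f x)"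

lemma lift_simps [simp]: "lift f None = 0" "lift f (Some x) = f x"
  by (simp_all add: lift_def)

lemma lift_measurable:
  assumes T: "weighted_tree T" and R: "R \<in> sets (boundary_borel T)"
    and f: "f \<in> borel_measurable (boundary_borel T)"
  shows "lift f \<in> borel_measurable (coffin_borel T R)"
proof (rule measurableI)
  have Rb: "R \<subseteq> boundary T" using sets.sets_into_space[OF R] T by simp
  fix A :: "ennreal set" assume "A \<in> sets borel"
  from measurable_sets[OF f this] have "(f -` A \<inter> space (boundary_borel T)) \<inter> R \<in> sets (boundary_borel T)"
    using R by simp
  moreover have "Some -` (lift f -` A \<inter> insert None (Some ` R)) = (f -` A \<inter> space (boundary_borel T)) \<inter> R"
    using Rb T by auto
  ultimately show "lift f -` A \<inter> space (coffin_borel T R) \<in> sets (coffin_borel T R)"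
    unfolding in_sets_coffin_borel_iff[OF T R] space_coffin_borel[OF T Rb] by auto
qed simp

section \<open>Processes in the boundary\<close>

lemma openin_boundary_at_Compl:
  assumes T: "weighted_tree T"
  shows "openin (boundary_top T) (boundary T - boundary_at T i)"
proof (subst openin_subopen, intro ballI)
  fix x assume x: "x \<in> boundary T - boundary_at T i"
  let ?U = "boundary_at T (x (depth T i))"
  have U: "?U = {y \<in> boundary T. y (depth T i) = x (depth T i)}"
    using boundary_at_ray[OF T] x by simp
  have "x \<in> ?U" "?U \<subseteq> boundary T - boundary_at T i"
    unfolding U using x by (auto simp: boundary_at_def)
  then show "\<exists>U. openin (boundary_top T) U \<and> x \<in> U \<and> U \<subseteq> boundary T - boundary_at T i"
    using openin_boundary_top_boundary_at[OF ray_site[OF T]] x by blast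
qed

text \<open>Cells are open and closed, also after the isolated coffin is added, so a
  right-continuous path keeps its membership in a cell for a short while.\<close>

lemma rcll_hits_eventually:
  assumes T: "weighted_tree T" and R: "R \<subseteq> boundary T" and i: "i \<in> sites T"
    and z: "rcll (add_coffin (subtopology (boundary_top T) R)) z" and s: "0 \<le> s"
  shows "eventually (\<lambda>u. z u \<in> Some ` boundary_at T i \<longleftrightarrow> z s \<in> Some ` boundary_at T i) (at_right s)"
proof -
  let ?X = "add_coffin (subtopology (boundary_top T) R)"
  have lim: "limitin ?X z (z s) (at_right s)" using z s by (simp add: rcll_def)
  have top: "z s \<in> insert None (Some ` R)"
    using limitin_topspace[OF lim] topspace_coffin[OF T R] by simp
  have 1: "openin ?X (Some ` (boundary_at T i \<inter> R))"
  proof -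
    have "Some -` (Some ` (boundary_at T i \<inter> R)) = boundary_at T i \<inter> R" by auto
    then show ?thesis using openin_boundary_top_boundary_at[OF i] R topspace_boundary_top[OF T]
      by (auto simp: openin_add_coffin_iff openin_subtopology)
  qed
  have 2: "openin ?X (insert None (Some ` (R - boundary_at T i)))"
  proof -
    have "Some -` (insert None (Some ` (R - boundary_at T i))) = (boundary T - boundary_at T i) \<inter> R"
      using R by auto
    then show ?thesis using openin_boundary_at_Compl[OF T, of i] R topspace_boundary_top[OF T]
      by (auto simp: openin_add_coffin_iff openin_subtopology)
  qed
  show ?thesis
  proof (cases "z s \<in> Some ` boundary_at T i")
    case True
    then have "z s \<in> Some ` (boundary_at T i \<inter> R)" using top by auto
    then have "eventually (\<lambda>u. z u \<in> Some ` (boundary_at T i \<inter> R)) (at_right s)"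
      using lim 1 by (simp add: limitin_def)
    then show ?thesis using True by (auto elim!: eventually_mono)
  next
    case False
    then have "z s \<in> insert None (Some ` (R - boundary_at T i))" using top by auto
    then have "eventually (\<lambda>u. z u \<in> insert None (Some ` (R - boundary_at T i))) (at_right s)"
      using lim 2 unfolding limitin_def by blast
    then show ?thesis using False by (auto elim!: eventually_mono)
  qed
qed

lemma eventually_at_right_sequence:
  assumes "eventually Q (at_right (s::real))"
  shows "eventually (\<lambda>k. Q (s + 1 / real (Suc k))) sequentially"
proof -
  have "filterlim (\<lambda>k. s + 1 / real (Suc k)) (at_right s) sequentially"
  proof (rule tendsto_imp_filterlim_at_right)
    have "(\<lambda>k. s + 1 / real (Suc k)) \<longlonglongrightarrow> s + 0"
      by (intro tendsto_intros LIMSEQ_Suc[OF lim_inverse_n'])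
    then show "(\<lambda>k. s + 1 / real (Suc k)) \<longlonglongrightarrow> s" by simp
  qed simp
  then show ?thesis using assms by (auto simp: filterlim_iff)
qed

text \<open>Measurability and path regularity without the Markov property. They are kept apart
  because the glued process is first placed here, and its Markov property is derived inside this
  locale from its cylinder probabilities.\<close>

locale ray_path = ray_hierarchy \<mu> T d D i0 + M: prob_space M
  for \<mu> :: "(nat \<Rightarrow> 'i) measure" and T d D i0 and M :: "'w measure" +
  fixes R :: "(nat \<Rightarrow> 'i) set" and dens :: "real \<Rightarrow> (nat \<Rightarrow> 'i) \<Rightarrow> (nat \<Rightarrow> 'i) \<Rightarrow> ennreal"
    and W :: "real \<Rightarrow> 'w \<Rightarrow> (nat \<Rightarrow> 'i) option"
  assumes R_sets: "R \<in> sets (boundary_borel T)"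
    and R_full: "AE x in \<mu>. x \<in> R"
    and dens_eq: "0 < t \<Longrightarrow> x \<in> R \<Longrightarrow> y \<in> R \<Longrightarrow> dens t x y = p t x y"
    and W_measurable: "0 \<le> t \<Longrightarrow> W t \<in> measurable M (coffin_borel T R)"
    and W_rcll: "\<omega> \<in> space M \<Longrightarrow> rcll (add_coffin (subtopology (boundary_top T) R)) (\<lambda>t. W t \<omega>)"
    and W_absorbed: "\<omega> \<in> space M \<Longrightarrow> 0 \<le> s \<Longrightarrow> s \<le> t \<Longrightarrow> W s \<omega> = None \<Longrightarrow> W t \<omega> = None"
begin

abbreviation "E \<equiv> coffin_borel T R"
abbreviation "Pst \<equiv> past M (coffin_borel T R) W"

lemma R_sub: "R \<subseteq> boundary T"
  using sets.sets_into_space[OF R_sets] tree by simp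

lemma W_range: "0 \<le> t \<Longrightarrow> \<omega> \<in> space M \<Longrightarrow> W t \<omega> \<in> insert None (Some ` R)"
  using measurable_space[OF W_measurable, of t \<omega>] space_coffin_borel[OF tree R_sub] by simp

lemma W_live: "0 \<le> t \<Longrightarrow> \<omega> \<in> space M \<Longrightarrow> W t \<omega> = Some x \<Longrightarrow> x \<in> R \<and> x \<in> boundary T"
  using W_range[of t \<omega>] R_sub by auto

lemma sets_Pst: "0 \<le> s \<Longrightarrow> sets (Pst s) = sigma_sets (space M) (cylinders T (space M) W {0..s})"
  by (rule sets_past[OF tree R_sub]) (use W_range in auto)

lemma measurable_Pst:
  assumes "0 \<le> u" "u \<le> s" shows "W u \<in> measurable (Pst s) E"
proof (rule measurableI)
  fix \<omega> assume "\<omega> \<in> space (Pst s)"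
  then show "W u \<omega> \<in> space E" using measurable_space[OF W_measurable[OF assms(1)]] by simp
next
  fix A assume "A \<in> sets E"
  then have "W u -` A \<inter> space M \<in> (\<Union>u\<in>{0..s}. {W u -` A \<inter> space M |A. A \<in> sets E})"
    using assms by (intro UN_I[of u]) auto
  then show "W u -` A \<inter> space (Pst s) \<in> sets (Pst s)"
    unfolding space_past unfolding past_def by (subst sets_measure_of) (auto intro: sigma_sets.Basic)
qed

lemma sets_Pst_sub: "sets (Pst s) \<subseteq> sets M"
proof -
  have "(\<Union>u\<in>{0..s}. {W u -` A \<inter> space M |A. A \<in> sets E}) \<subseteq> sets M"
    using measurable_sets[OF W_measurable] by auto
  then have "sigma_sets (space M) (\<Union>u\<in>{0..s}. {W u -` A \<inter> space M |A. A \<in> sets E}) \<subseteq> sets M"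
    by (rule sets.sigma_sets_subset)
  then show ?thesis unfolding past_def by (subst sets_measure_of) auto
qed

lemma Pst_mono: "s \<le> t \<Longrightarrow> sets (Pst s) \<subseteq> sets (Pst t)"
proof -
  assume "s \<le> t"
  then have "(\<Union>u\<in>{0..s}. {W u -` A \<inter> space M |A. A \<in> sets E}) \<subseteq>
      (\<Union>u\<in>{0..t}. {W u -` A \<inter> space M |A. A \<in> sets E})"
    by (intro UN_mono) auto
  from sigma_sets_mono'[OF this] show ?thesis
    unfolding past_def by (subst (1 2) sets_measure_of) auto
qed

lemma Pst_sigma_finite: "sigma_finite_subalgebra M (Pst s)"
proof -
  have "subalgebra M (Pst s)" using sets_Pst_sub by (simp add: subalgebra_def)
  then interpret finite_measure_subalgebra M "Pst s" by unfold_locales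
  show ?thesis by unfold_locales
qed

lemma live_in_Pst:
  assumes "0 \<le> u" "u \<le> s" "U \<in> sets \<B>"
  shows "{\<omega> \<in> space M. W u \<omega> \<in> Some ` U} \<in> sets (Pst s)"
proof -
  have "Some ` (U \<inter> R) \<in> sets E"
  proof -
    have "Some -` (Some ` (U \<inter> R)) = U \<inter> R" by auto
    then show ?thesis unfolding in_sets_coffin_borel_iff[OF tree R_sets] using assms R_sets by auto
  qed
  from measurable_sets[OF measurable_Pst[OF assms(1,2)] this]
  have "W u -` Some ` (U \<inter> R) \<inter> space M \<in> sets (Pst s)" by simp
  also have "W u -` Some ` (U \<inter> R) \<inter> space M = {\<omega> \<in> space M. W u \<omega> \<in> Some ` U}"
  proof (rule set_eqI)
    fix \<omega> show "\<omega> \<in> W u -` Some ` (U \<inter> R) \<inter> space M \<longleftrightarrow> \<omega> \<in> {\<omega> \<in> space M. W u \<omega> \<in> Some ` U}"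
      using W_range[OF assms(1), of \<omega>] by (cases "W u \<omega>") auto
  qed
  finally show ?thesis .
qed

lemma alive_in_Pst:
  assumes "0 \<le> u" "u \<le> s"
  shows "{\<omega> \<in> space M. W u \<omega> \<noteq> None} \<in> sets (Pst s)"
proof -
  have "{\<omega> \<in> space M. W u \<omega> \<noteq> None} = {\<omega> \<in> space M. W u \<omega> \<in> Some ` space \<B>}"
  proof (rule set_eqI)
    fix \<omega> show "\<omega> \<in> {\<omega> \<in> space M. W u \<omega> \<noteq> None} \<longleftrightarrow> \<omega> \<in> {\<omega> \<in> space M. W u \<omega> \<in> Some ` space \<B>}"
      using W_live[OF assms(1), of \<omega>] tree by (cases "W u \<omega>") auto
  qed
  then show ?thesis using live_in_Pst[OF assms sets.top] by simp
qed

lemma lift_W_measurable: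
  "0 \<le> u \<Longrightarrow> u \<le> s \<Longrightarrow> f \<in> borel_measurable \<B> \<Longrightarrow> (\<lambda>\<omega>. lift f (W u \<omega>)) \<in> borel_measurable (Pst s)"
  by (rule measurable_compose[OF measurable_Pst lift_measurable[OF tree R_sets]])

lemma lift_W_measurable_M:
  "0 \<le> u \<Longrightarrow> f \<in> borel_measurable \<B> \<Longrightarrow> (\<lambda>\<omega>. lift f (W u \<omega>)) \<in> borel_measurable M"
  by (rule measurable_compose[OF W_measurable lift_measurable[OF tree R_sets]])

lemma sub_kernel_live:
  assumes u: "0 < u" and x: "x \<in> R" and A: "A \<in> sets E"
  shows "sub_kernel \<mu> dens u (Some x) A =
    P u (indicator (Some -` A)) x + (1 - P u (\<lambda>_. 1) x) * indicator A None"
proof -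
  have AEd: "AE y in \<mu>. dens u x y = p u x y"
    using R_full by eventually_elim (simp add: dens_eq[OF u x])
  have 1: "(\<integral>\<^sup>+y. dens u x y * indicator A (Some y) \<partial>\<mu>) = P u (indicator (Some -` A)) x"
  proof -
    have "AE y in \<mu>. dens u x y * indicator A (Some y) = p u x y * indicator (Some -` A) y"
      using AEd by eventually_elim (simp add: indicator_def)
    then show ?thesis using u by (simp add: P_def cong: nn_integral_cong_AE)
  qed
  have 2: "(\<integral>\<^sup>+y. dens u x y \<partial>\<mu>) = P u (\<lambda>_. 1) x"
    using AEd u by (simp add: P_def nn_integral_cong_AE)
  show ?thesis by (simp add: sub_kernel_def 1 2)
qed

lemma lift_sigma_linear:
  assumes "0 \<le> t" "\<omega> \<in> space M"
  shows "sigma_linear \<B> (\<lambda>f. lift f (W t \<omega>))"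
  using W_live[OF assms] tree
  by (cases "W t \<omega>") (auto intro: sigma_linear_zero_fun sigma_linear_eval)

lemma lift_P_sigma_linear:
  assumes "0 \<le> t" "\<omega> \<in> space M"
  shows "sigma_linear \<B> (\<lambda>f. lift (P u f) (W t \<omega>))"
  using W_live[OF assms] tree
  by (cases "W t \<omega>") (auto intro: sigma_linear_zero_fun P_sigma_linear)

lemma hits_in_Pst:
  "set l \<subseteq> {0..s} \<times> sites T \<Longrightarrow> 0 \<le> s \<Longrightarrow> hits T (space M) W l \<in> sets (Pst s)"
proof (induction l)
  case Nil
  show ?case unfolding hits_Nil using sets.top[of "Pst s"] by simp
next
  case (Cons a l)
  obtain t i where a: "a = (t, i)" by force
  have "{\<omega> \<in> space M. W t \<omega> \<in> Some ` boundary_at T i} \<in> sets (Pst s)"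
    using Cons.prems a by (intro live_in_Pst boundary_at_in_sets[OF tree]) auto
  moreover have "hits T (space M) W l \<in> sets (Pst s)" using Cons by simp
  ultimately show ?case unfolding a hits_Cons by (rule sets.Int)
qed

lemma alive_iff_hits_origin:
  assumes "0 \<le> t" "\<omega> \<in> space M"
  shows "W t \<omega> \<in> Some ` boundary_at T (origin T) \<longleftrightarrow> W t \<omega> \<noteq> None"
  using W_live[OF assms] boundary_at_origin[OF tree] by (cases "W t \<omega>") auto

lemma hits_eventually:
  assumes "\<omega> \<in> space M" "0 \<le> s" "i \<in> sites T"
  shows "eventually (\<lambda>u. W u \<omega> \<in> Some ` boundary_at T i \<longleftrightarrow> W s \<omega> \<in> Some ` boundary_at T i) (at_right s)"
  using rcll_hits_eventually[OF tree R_sub assms(3) W_rcll[OF assms(1)] assms(2)] .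

lemma measurable_live: "0 \<le> s \<Longrightarrow> U \<in> sets \<B> \<Longrightarrow> {\<omega> \<in> space M. W s \<omega> \<in> Some ` U} \<in> sets M"
  using live_in_Pst[of s s U] sets_Pst_sub[of s] by auto

lemma hits_snoc: "hits T \<Omega> V (l @ [(s, i)]) = hits T \<Omega> V l \<inter> {\<omega> \<in> \<Omega>. V s \<omega> \<in> Some ` boundary_at T i}"
  unfolding hits_append hits_Cons hits_Nil by (auto simp: hits_def)

text \<open>Independence is assumed for whole paths; this transfers it to events of the
  pasts.\<close>

lemma Pst_path:
  assumes s: "0 \<le> s" and F: "F \<in> sets (Pst s)"
  shows "\<exists>A\<in>sets (path_space (subtopology (boundary_top T) R)). F = path_of W -` A \<inter> space M"
proof -
  let ?P = "path_space (subtopology (boundary_top T) R)"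
  have Peq: "?P = PiM {0..} (\<lambda>_. E)" by (simp add: path_space_def coffin_borel_def)
  have mp: "path_of W \<in> measurable M ?P"
    using W_measurable by (intro path_of_measurable) (simp add: coffin_borel_def)
  have fn: "path_of W \<in> space M \<rightarrow> space ?P" using measurable_space[OF mp] by auto
  let ?V = "vimage_algebra (space M) (path_of W) ?P"
  have sV: "sets ?V = {path_of W -` A \<inter> space M |A. A \<in> sets ?P}" by (rule sets_vimage_algebra2[OF fn])
  have "(\<Union>u\<in>{0..s}. {W u -` A \<inter> space M |A. A \<in> sets E}) \<subseteq> sets ?V"
  proof
    fix X assume "X \<in> (\<Union>u\<in>{0..s}. {W u -` A \<inter> space M |A. A \<in> sets E})"
    then obtain u A where u: "0 \<le> u" and A: "A \<in> sets E" and X: "X = W u -` A \<inter> space M" by auto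
    have "(\<lambda>z. z u) \<in> measurable ?P E" unfolding Peq using u by (intro measurable_component_singleton) simp
    from measurable_sets[OF this A] have S: "(\<lambda>z. z u) -` A \<inter> space ?P \<in> sets ?P" .
    have "X = path_of W -` ((\<lambda>z. z u) -` A \<inter> space ?P) \<inter> space M"
      using fn u unfolding X by (auto simp: path_of_def)
    then show "X \<in> sets ?V" using S unfolding sV by blast
  qed
  from sets.sigma_sets_subset[OF this]
  have "sigma_sets (space M) (\<Union>u\<in>{0..s}. {W u -` A \<inter> space M |A. A \<in> sets E}) \<subseteq> sets ?V" by simp
  moreover have "F \<in> sigma_sets (space M) (\<Union>u\<in>{0..s}. {W u -` A \<inter> space M |A. A \<in> sets E})"
    using F unfolding past_def by (subst (asm) sets_measure_of) auto
  ultimately have "F \<in> sets ?V" by blast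
  then show ?thesis unfolding sV by blast
qed

text \<open>The infimum in \<open>lifetime\<close> is not approached from a live state: by
  right-continuity a path alive at t stays alive on an interval after t, which gives the strict
  inequality.\<close>

lemma less_lifetime_iff:
  assumes \<omega>: "\<omega> \<in> space M" and t: "0 \<le> t"
  shows "ereal t < lifetime (\<lambda>s. W s \<omega>) \<longleftrightarrow> W t \<omega> \<noteq> None"
proof
  assume "ereal t < lifetime (\<lambda>s. W s \<omega>)"
  moreover have "lifetime (\<lambda>s. W s \<omega>) \<le> ereal t" if "W t \<omega> = None"
    unfolding lifetime_def using t that by (intro Inf_lower) auto
  ultimately show "W t \<omega> \<noteq> None" by (meson leD)
next
  assume alive: "W t \<omega> \<noteq> None"
  then have "W t \<omega> \<in> Some ` boundary_at T (origin T)" using alive_iff_hits_origin[OF t \<omega>] by simp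
  then have "eventually (\<lambda>u. W u \<omega> \<in> Some ` boundary_at T (origin T)) (at_right t)"
    using hits_eventually[OF \<omega> t origin_in_sites[OF tree]] by simp
  then obtain e where e: "t < e" "\<And>u. t < u \<Longrightarrow> u < e \<Longrightarrow> W u \<omega> \<in> Some ` boundary_at T (origin T)"
    unfolding eventually_at_right_field by blast
  have "ereal e \<le> lifetime (\<lambda>s. W s \<omega>)"
    unfolding lifetime_def
  proof (rule Inf_greatest)
    fix v assume "v \<in> {ereal s |s. 0 \<le> s \<and> W s \<omega> = None}"
    then obtain s where s: "v = ereal s" "0 \<le> s" "W s \<omega> = None" by auto
    have "\<not> s \<le> t" using W_absorbed[OF \<omega> s(2) _ s(3), of t] alive by auto
    then have "e \<le> s" using e(2)[of s] s(3) by (metis image_iff not_le_imp_less not_less option.distinct(1))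
    then show "ereal e \<le> v" using s by simp
  qed
  moreover have "ereal t < ereal e" using e by simp
  ultimately show "ereal t < lifetime (\<lambda>s. W s \<omega>)" by (rule less_le_trans[rotated])
qed

text \<open>\<open>real_of_ereal\<close> sends infinity to 0, so the value is meaningful only for
  paths that die; the facts about it assume death by some finite time.\<close>

definition L :: "'w \<Rightarrow> real" where
  "L \<omega> = real_of_ereal (lifetime (\<lambda>s. W s \<omega>))"

lemma lifetime_nonneg: "0 \<le> lifetime z"
  unfolding lifetime_def by (rule Inf_greatest) auto

lemma lifetime_eq_L:
  assumes \<omega>: "\<omega> \<in> space M" and t: "0 \<le> t" and dead: "W t \<omega> = None"
  shows "lifetime (\<lambda>s. W s \<omega>) = ereal (L \<omega>)" "0 \<le> L \<omega>" "L \<omega> \<le> t"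
proof -
  have "lifetime (\<lambda>s. W s \<omega>) \<le> ereal t" using less_lifetime_iff[OF \<omega> t] dead by (simp add: not_less)
  with lifetime_nonneg[of "\<lambda>s. W s \<omega>"] show 1: "lifetime (\<lambda>s. W s \<omega>) = ereal (L \<omega>)"
    unfolding L_def by (cases "lifetime (\<lambda>s. W s \<omega>)") auto
  show "0 \<le> L \<omega>" "L \<omega> \<le> t"
    using lifetime_nonneg[of "\<lambda>s. W s \<omega>"] \<open>lifetime (\<lambda>s. W s \<omega>) \<le> ereal t\<close> unfolding 1 by auto
qed

lemma less_L_iff:
  assumes \<omega>: "\<omega> \<in> space M" and t: "0 \<le> t" and dead: "W t \<omega> = None" and s: "0 \<le> s"
  shows "s < L \<omega> \<longleftrightarrow> W s \<omega> \<noteq> None"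
  using less_lifetime_iff[OF \<omega> s] lifetime_eq_L(1)[OF \<omega> t dead] by simp

lemma lift_ind_hits:
  assumes "0 \<le> t" "F \<in> sets M" "U \<in> sets \<B>"
  shows "(\<integral>\<^sup>+\<omega>. lift (indicator U) (W t \<omega>) * indicator F \<omega> \<partial>M) =
    emeasure M (F \<inter> {\<omega> \<in> space M. W t \<omega> \<in> Some ` U})"
proof -
  have m: "F \<inter> {\<omega> \<in> space M. W t \<omega> \<in> Some ` U} \<in> sets M"
    using measurable_live[OF assms(1,3)] assms(2) by auto
  have "(\<integral>\<^sup>+\<omega>. lift (indicator U) (W t \<omega>) * indicator F \<omega> \<partial>M) =
      (\<integral>\<^sup>+\<omega>. indicator (F \<inter> {\<omega> \<in> space M. W t \<omega> \<in> Some ` U}) \<omega> \<partial>M)"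
  proof (rule nn_integral_cong)
    fix \<omega> assume "\<omega> \<in> space M"
    then show "lift (indicator U) (W t \<omega>) * indicator F \<omega> =
      (indicator (F \<inter> {\<omega> \<in> space M. W t \<omega> \<in> Some ` U}) \<omega> :: ennreal)"
      by (cases "W t \<omega>") (auto simp: indicator_def)
  qed
  then show ?thesis using m by simp
qed

lemma integral_lift_sigma_linear:
  assumes "0 \<le> t" "F \<in> sets M"
  shows "sigma_linear \<B> (\<lambda>f. \<integral>\<^sup>+\<omega>. lift f (W t \<omega>) * indicator F \<omega> \<partial>M)"
proof (rule sigma_linear_nn_integral)
  show "sigma_linear \<B> (\<lambda>f. lift f (W t \<omega>) * indicator F \<omega>)" if "\<omega> \<in> space M" for \<omega>
    using sigma_linear_scale[OF lift_sigma_linear[OF assms(1) that], of "indicator F \<omega>"]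
    by (simp only: mult.commute)
  show "(\<lambda>\<omega>. lift f (W t \<omega>) * indicator F \<omega>) \<in> borel_measurable M" if "f \<in> borel_measurable \<B>" for f
    using lift_W_measurable_M[OF assms(1) that] assms(2) by measurable
qed

lemma integral_lift_P_sigma_linear:
  assumes "0 \<le> t" "F \<in> sets M"
  shows "sigma_linear \<B> (\<lambda>f. \<integral>\<^sup>+\<omega>. lift (P u f) (W t \<omega>) * indicator F \<omega> \<partial>M)"
proof (rule sigma_linear_nn_integral)
  show "sigma_linear \<B> (\<lambda>f. lift (P u f) (W t \<omega>) * indicator F \<omega>)" if "\<omega> \<in> space M" for \<omega>
    using sigma_linear_scale[OF lift_P_sigma_linear[OF assms(1) that], of "indicator F \<omega>" u]
    by (simp only: mult.commute)
  show "(\<lambda>\<omega>. lift (P u f) (W t \<omega>) * indicator F \<omega>) \<in> borel_measurable M" if "f \<in> borel_measurable \<B>" for f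
    using lift_W_measurable_M[OF assms(1) P_measurable[OF that]] assms(2) by measurable
qed

lemma integral_lift_finite:
  "(\<integral>\<^sup>+\<omega>. lift (\<lambda>_. 1) (W t \<omega>) * indicator F \<omega> \<partial>M) \<noteq> \<infinity>"
proof -
  have "(\<integral>\<^sup>+\<omega>. lift (\<lambda>_. 1) (W t \<omega>) * indicator F \<omega> \<partial>M) \<le> (\<integral>\<^sup>+\<omega>. 1 \<partial>M)"
    by (intro nn_integral_mono) (auto simp: lift_def indicator_def split: option.split)
  also have "\<dots> = 1" by (simp add: M.emeasure_space_1)
  finally show ?thesis by (auto simp: top_unique)
qed

end

lemma sub_markov_processD:
  assumes "sub_markov_process (subtopology (boundary_top T) R) \<mu> dens \<nu> M W"
  shows "prob_space M"
    and "\<And>t. 0 \<le> t \<Longrightarrow> W t \<in> measurable M (coffin_borel T R)"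
    and "\<And>\<omega>. \<omega> \<in> space M \<Longrightarrow> rcll (add_coffin (subtopology (boundary_top T) R)) (\<lambda>t. W t \<omega>)"
    and "\<And>\<omega> s t. \<omega> \<in> space M \<Longrightarrow> 0 \<le> s \<Longrightarrow> s \<le> t \<Longrightarrow> W s \<omega> = None \<Longrightarrow> W t \<omega> = None"
    and "\<And>A. A \<in> sets (coffin_borel T R) \<Longrightarrow> emeasure M (W 0 -` A \<inter> space M) = emeasure \<nu> (Some -` A)"
    and "\<And>A s t. A \<in> sets (coffin_borel T R) \<Longrightarrow> 0 \<le> s \<Longrightarrow> s < t \<Longrightarrow>
      AE \<omega> in M. nn_cond_exp M (past M (coffin_borel T R) W s) (\<lambda>\<omega>. indicator A (W t \<omega>)) \<omega> =
        sub_kernel \<mu> dens (t - s) (W s \<omega>) A"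
  using assms unfolding sub_markov_process_def Let_def coffin_borel_def by blast+

locale ray_process = ray_path \<mu> T d D i0 M R dens W
  for \<mu> :: "(nat \<Rightarrow> 'i) measure" and T d D i0 and M :: "'w measure" and R dens W +
  fixes \<nu> :: "(nat \<Rightarrow> 'i) measure"
  assumes proc: "sub_markov_process (subtopology (boundary_top T) R) \<mu> dens \<nu> M W"
begin

lemmas W_initial = sub_markov_processD(5)[OF proc]

lemmas W_cond_exp = sub_markov_processD(6)[OF proc]

text \<open>Both sides are sigma-linear in \<open>f\<close>, so cells suffice, and for these the
  defining property of the conditional expectation applies. The clause for time 0 in
  \<open>P\<close> covers s = t.\<close>

lemma markov_integral:
  assumes s: "0 \<le> s" and st: "s \<le> t" and F: "F \<in> sets (Pst s)" and f: "f \<in> borel_measurable \<B>"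
  shows "(\<integral>\<^sup>+\<omega>. lift f (W t \<omega>) * indicator F \<omega> \<partial>M) =
    (\<integral>\<^sup>+\<omega>. lift (P (t - s) f) (W s \<omega>) * indicator F \<omega> \<partial>M)"
proof (cases "t = s")
  case True
  have "P 0 f = f" by (simp add: P_def fun_eq_iff)
  then show ?thesis using True by simp
next
  case False
  with st have st: "s < t" by simp
  then have t: "0 \<le> t" using s by simp
  have FM: "F \<in> sets M" using F sets_Pst_sub by auto
  show ?thesis
  proof (rule sigma_linear_ray_eqI[OF tree _ _ _ _ f])
    show "sigma_linear \<B> (\<lambda>f. \<integral>\<^sup>+\<omega>. lift f (W t \<omega>) * indicator F \<omega> \<partial>M)"
      by (rule integral_lift_sigma_linear[OF t FM])
    show "sigma_linear \<B> (\<lambda>f. \<integral>\<^sup>+\<omega>. lift (P (t - s) f) (W s \<omega>) * indicator F \<omega> \<partial>M)"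
      by (rule integral_lift_P_sigma_linear[OF s FM])
    show "(\<integral>\<^sup>+\<omega>. lift (\<lambda>_. 1) (W t \<omega>) * indicator F \<omega> \<partial>M) \<noteq> \<infinity>"
      by (rule integral_lift_finite)
    fix i assume i: "i \<in> sites T"
    let ?U = "boundary_at T i" and ?A = "Some ` (boundary_at T i \<inter> R)"
    have vA: "Some -` ?A = ?U \<inter> R" by auto
    have A: "?A \<in> sets E"
      unfolding in_sets_coffin_borel_iff[OF tree R_sets] vA using boundary_at_in_sets[OF tree i] R_sets by auto
    interpret sigma_finite_subalgebra M "Pst s" by (rule Pst_sigma_finite)
    have "(\<integral>\<^sup>+\<omega>. lift (indicator ?U) (W t \<omega>) * indicator F \<omega> \<partial>M) =
        (\<integral>\<^sup>+\<omega>. indicator ?A (W t \<omega>) * indicator F \<omega> \<partial>M)"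
    proof (rule nn_integral_cong)
      fix \<omega> assume "\<omega> \<in> space M"
      then show "lift (indicator ?U) (W t \<omega>) * indicator F \<omega> = indicator ?A (W t \<omega>) * indicator F \<omega>"
        using W_live[OF t] by (cases "W t \<omega>") (auto simp: indicator_def)
    qed
    also have "\<dots> = (\<integral>\<^sup>+\<omega>. nn_cond_exp M (Pst s) (\<lambda>\<omega>. indicator ?A (W t \<omega>)) \<omega> * indicator F \<omega> \<partial>M)"
    proof -
      have "(\<lambda>\<omega>. indicator ?A (W t \<omega>) :: ennreal) \<in> borel_measurable M"
        using W_measurable[OF t] A by measurable
      from nn_cond_exp_intg[OF borel_measurable_indicator[OF F] this] show ?thesis
        by (simp only: mult.commute)
    qed
    also have "\<dots> = (\<integral>\<^sup>+\<omega>. lift (P (t - s) (indicator ?U)) (W s \<omega>) * indicator F \<omega> \<partial>M)"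
    proof (rule nn_integral_cong_AE)
      show "AE \<omega> in M. nn_cond_exp M (Pst s) (\<lambda>\<omega>. indicator ?A (W t \<omega>)) \<omega> * indicator F \<omega> =
          lift (P (t - s) (indicator ?U)) (W s \<omega>) * indicator F \<omega>"
        using W_cond_exp[OF A s st] AE_space
      proof eventually_elim
        case (elim \<omega>)
        have "sub_kernel \<mu> dens (t - s) (W s \<omega>) ?A = lift (P (t - s) (indicator ?U)) (W s \<omega>)"
        proof (cases "W s \<omega>")
          case None
          then show ?thesis by (simp add: sub_kernel_def)
        next
          case (Some x)
          then have x: "x \<in> R" using W_live[OF s elim(2)] by simp
          \<comment> \<open>\<open>R\<close> carries all of \<mu>, so replacing a cell by its trace
            on \<open>R\<close> does not change the kernel.\<close>
          have "AE y in \<mu>. p (t - s) x y * indicator (?U \<inter> R) y = p (t - s) x y * indicator ?U y"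
            using R_full by eventually_elim (simp add: indicator_def)
          then have "P (t - s) (indicator (?U \<inter> R)) x = P (t - s) (indicator ?U) x"
            using st by (simp add: P_def cong: nn_integral_cong_AE)
          then show ?thesis using sub_kernel_live[OF _ x A, of "t - s"] st Some by (simp add: vA)
        qed
        with elim show ?case by simp
      qed
    qed
    finally show "(\<integral>\<^sup>+\<omega>. lift (indicator ?U) (W t \<omega>) * indicator F \<omega> \<partial>M) =
      (\<integral>\<^sup>+\<omega>. lift (P (t - s) (indicator ?U)) (W s \<omega>) * indicator F \<omega> \<partial>M)" .
  qed
qed

text \<open>In the induction the first hit is absorbed into \<open>F\<close>, which therefore has to
  range over all events of the past on which the process is alive. Aliveness also settles the empty
  list, where the lift of 1 must be 1 on \<open>F\<close>.\<close>

lemma emeasure_hits: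
  assumes "F \<in> sets (Pst s)" "0 \<le> s" "\<forall>\<omega>\<in>F. W s \<omega> \<noteq> None"
    "sorted (map fst l)" "set l \<subseteq> {s..} \<times> sites T"
  shows "emeasure M (F \<inter> hits T (space M) W l) =
    (\<integral>\<^sup>+\<omega>. lift (\<Phi> s l (\<lambda>_. 1)) (W s \<omega>) * indicator F \<omega> \<partial>M)"
  using assms
proof (induction l arbitrary: s F)
  case Nil
  have F: "F \<in> sets M" using Nil sets_Pst_sub by auto
  have "(\<integral>\<^sup>+\<omega>. lift (\<Phi> s [] (\<lambda>_. 1)) (W s \<omega>) * indicator F \<omega> \<partial>M) = (\<integral>\<^sup>+\<omega>. indicator F \<omega> \<partial>M)"
  proof (rule nn_integral_cong)
    fix \<omega> show "lift (\<Phi> s [] (\<lambda>_. 1)) (W s \<omega>) * indicator F \<omega> = indicator F \<omega>"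
      using Nil(3) by (cases "W s \<omega>") (auto simp: indicator_def)
  qed
  then show ?case using F sets.sets_into_space[OF F] by (simp add: Int_absorb2)
next
  case (Cons a l)
  obtain t i where a: "a = (t, i)" by force
  have st: "s \<le> t" and i: "i \<in> sites T" using Cons.prems a by auto
  let ?h = "\<lambda>y. indicator (boundary_at T i) y * \<Phi> t l (\<lambda>_. 1) y"
  let ?F = "F \<inter> {\<omega> \<in> space M. W t \<omega> \<in> Some ` boundary_at T i}"
  have F': "?F \<in> sets (Pst t)"
    using Cons.prems Pst_mono[OF st] st by (intro sets.Int live_in_Pst boundary_at_in_sets[OF tree i]) auto
  have h: "?h \<in> borel_measurable \<B>"
    using Cons.prems a by (intro borel_measurable_times_ennreal borel_measurable_indicator
        boundary_at_in_sets[OF tree i] \<Phi>_measurable) auto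
  have "emeasure M (F \<inter> hits T (space M) W (a # l)) = emeasure M (?F \<inter> hits T (space M) W l)"
    unfolding a hits_Cons by (simp add: Int_assoc)
  also have "\<dots> = (\<integral>\<^sup>+\<omega>. lift (\<Phi> t l (\<lambda>_. 1)) (W t \<omega>) * indicator ?F \<omega> \<partial>M)"
    using Cons.prems a st by (intro Cons.IH F') auto
  also have "\<dots> = (\<integral>\<^sup>+\<omega>. lift ?h (W t \<omega>) * indicator F \<omega> \<partial>M)"
  proof (rule nn_integral_cong)
    fix \<omega> assume "\<omega> \<in> space M"
    then show "lift (\<Phi> t l (\<lambda>_. 1)) (W t \<omega>) * indicator ?F \<omega> = lift ?h (W t \<omega>) * indicator F \<omega>"
      by (cases "W t \<omega>") (auto simp: indicator_def)
  qed
  also have "\<dots> = (\<integral>\<^sup>+\<omega>. lift (P (t - s) ?h) (W s \<omega>) * indicator F \<omega> \<partial>M)"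
    by (rule markov_integral[OF Cons.prems(2) st Cons.prems(1) h])
  finally show ?case by (simp only: a \<Phi>.simps)
qed

end

section \<open>From cylinder probabilities back to the Markov property\<close>

context ray_path
begin

context
  fixes \<xi>
  assumes \<xi>: "\<xi> \<in> R" and init: "AE \<omega> in M. W 0 \<omega> = Some \<xi>"
    and law: "\<And>l. sorted (map fst l) \<Longrightarrow> set l \<subseteq> {0..} \<times> sites T \<Longrightarrow>
      emeasure M (hits T (space M) W l) = \<Phi> 0 l (\<lambda>_. 1) \<xi>"
    and sub: "\<And>u. 0 < u \<Longrightarrow> AE x in \<mu>. P u (\<lambda>_. 1) x \<le> 1"
    and sub_\<xi>: "\<And>u. 0 < u \<Longrightarrow> P u (\<lambda>_. 1) \<xi> \<le> 1"
begin

text \<open>Both sides are sigma-linear in \<open>f\<close>; for the indicator of a cell, the left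
  side is the probability of a cylinder with one more entry, which \<open>law\<close>
  evaluates.\<close>

lemma integral_hits:
  assumes s: "0 \<le> s" and l: "sorted (map fst l)" "set l \<subseteq> {0..s} \<times> sites T"
    and f: "f \<in> borel_measurable \<B>"
  shows "(\<integral>\<^sup>+\<omega>. lift f (W s \<omega>) * indicator (hits T (space M) W l) \<omega> \<partial>M) = \<Phi> 0 (l @ [(s, origin T)]) f \<xi>"
proof (rule sigma_linear_ray_eqI[OF tree _ _ _ _ f])
  have F: "hits T (space M) W l \<in> sets M" using hits_in_Pst[OF l(2) s] sets_Pst_sub by auto
  show "sigma_linear \<B> (\<lambda>f. \<integral>\<^sup>+\<omega>. lift f (W s \<omega>) * indicator (hits T (space M) W l) \<omega> \<partial>M)"
    by (rule integral_lift_sigma_linear[OF s F])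
  show "sigma_linear \<B> (\<lambda>f. \<Phi> 0 (l @ [(s, origin T)]) f \<xi>)"
    using l \<xi> R_sub origin_in_sites[OF tree] by (intro \<Phi>_sigma_linear) auto
  show "(\<integral>\<^sup>+\<omega>. lift (\<lambda>_. 1) (W s \<omega>) * indicator (hits T (space M) W l) \<omega> \<partial>M) \<noteq> \<infinity>"
    by (rule integral_lift_finite)
  fix i assume i: "i \<in> sites T"
  have "(\<integral>\<^sup>+\<omega>. lift (indicator (boundary_at T i)) (W s \<omega>) * indicator (hits T (space M) W l) \<omega> \<partial>M) =
      emeasure M (hits T (space M) W (l @ [(s, i)]))"
    unfolding hits_snoc by (rule lift_ind_hits[OF s F boundary_at_in_sets[OF tree i]])
  also have "\<dots> = \<Phi> 0 (l @ [(s, i)]) (\<lambda>_. 1) \<xi>"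
    using l i s by (intro law) (auto simp: sorted_append)
  finally show "(\<integral>\<^sup>+\<omega>. lift (indicator (boundary_at T i)) (W s \<omega>) * indicator (hits T (space M) W l) \<omega> \<partial>M) =
      \<Phi> 0 (l @ [(s, origin T)]) (indicator (boundary_at T i)) \<xi>"
    unfolding \<Phi>_last .
qed

text \<open>The weight of the coffin in \<open>sub_kernel\<close> is a truncated difference in
  \<open>ennreal\<close>, and this bound makes it an exact one. For s > 0 the distribution of W s on
  live states has a density with respect to \<mu>, so the exceptional null set is not visited; at s
  = 0 the position is \<xi>.\<close>

lemma AE_sub:
  assumes s: "0 \<le> s" and u: "0 < u"
  shows "AE \<omega> in M. lift (P u (\<lambda>_. 1)) (W s \<omega>) \<le> 1"
proof (cases "s = 0")
  case True
  show ?thesis using init by eventually_elim (simp add: True sub_\<xi>[OF u])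
next
  case False
  define N where "N = {x \<in> space \<B>. \<not> P u (\<lambda>_. 1) x \<le> 1}"
  have N: "N \<in> sets \<B>"
    unfolding N_def using P_measurable[of "\<lambda>_. 1" u] by measurable
  have NA: "AE y in \<mu>. y \<notin> N" using sub[OF u] by eventually_elim (simp add: N_def)
  have "(\<integral>\<^sup>+\<omega>. lift (indicator N) (W s \<omega>) * indicator (hits T (space M) W []) \<omega> \<partial>M) =
      P s (\<lambda>y. indicator (boundary_at T (origin T)) y * indicator N y) \<xi>"
    using integral_hits[OF s, of "[]" "indicator N"] N by simp
  also have "\<dots> = (\<integral>\<^sup>+y. p s \<xi> y * (indicator (boundary_at T (origin T)) y * indicator N y) \<partial>\<mu>)"
    using False by (simp add: P_def)
  also have "\<dots> = (\<integral>\<^sup>+y. 0 \<partial>\<mu>)"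
    by (rule nn_integral_cong_AE) (use NA in eventually_elim, simp)
  finally have "(\<integral>\<^sup>+\<omega>. lift (indicator N) (W s \<omega>) \<partial>M) = 0"
    unfolding hits_Nil by (simp cong: nn_integral_cong)
  then have "AE \<omega> in M. lift (indicator N) (W s \<omega>) = 0"
    using nn_integral_0_iff_AE[OF lift_W_measurable_M[OF s borel_measurable_indicator[OF N]]] by simp
  then show ?thesis using AE_space
  proof eventually_elim
    case (elim \<omega>)
    then show ?case using W_live[OF s, of \<omega>] tree
      by (cases "W s \<omega>") (auto simp: indicator_def N_def split: if_splits)
  qed
qed

lemma integral_markov_hits:
  assumes s: "0 \<le> s" "s < t" and l: "sorted (map fst l)" "set l \<subseteq> {0..s} \<times> sites T"
    and f: "f \<in> borel_measurable \<B>"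
  shows "(\<integral>\<^sup>+\<omega>. lift f (W t \<omega>) * indicator (hits T (space M) W l) \<omega> \<partial>M) =
    (\<integral>\<^sup>+\<omega>. lift (P (t - s) f) (W s \<omega>) * indicator (hits T (space M) W l) \<omega> \<partial>M)"
proof (rule sigma_linear_ray_eqI[OF tree _ _ _ _ f])
  have t: "0 \<le> t" using s by simp
  have F: "hits T (space M) W l \<in> sets M" using hits_in_Pst[OF l(2) s(1)] sets_Pst_sub by auto
  show "sigma_linear \<B> (\<lambda>f. \<integral>\<^sup>+\<omega>. lift f (W t \<omega>) * indicator (hits T (space M) W l) \<omega> \<partial>M)"
    by (rule integral_lift_sigma_linear[OF t F])
  show "sigma_linear \<B> (\<lambda>f. \<integral>\<^sup>+\<omega>. lift (P (t - s) f) (W s \<omega>) * indicator (hits T (space M) W l) \<omega> \<partial>M)"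
    by (rule integral_lift_P_sigma_linear[OF s(1) F])
  show "(\<integral>\<^sup>+\<omega>. lift (\<lambda>_. 1) (W t \<omega>) * indicator (hits T (space M) W l) \<omega> \<partial>M) \<noteq> \<infinity>"
    by (rule integral_lift_finite)
  fix j assume j: "j \<in> sites T"
  let ?C = "boundary_at T j"
  have C: "?C \<in> sets \<B>" by (rule boundary_at_in_sets[OF tree j])
  \<comment> \<open>The entry for the root at time s adds no condition, since a path alive at t is
    alive at s; it creates the intermediate time at which the kernel is applied.\<close>
  have split: "hits T (space M) W (l @ [(s, origin T), (t, j)]) =
      hits T (space M) W l \<inter> {\<omega> \<in> space M. W t \<omega> \<in> Some ` ?C}"
  proof -
    have "W s \<omega> \<in> Some ` boundary_at T (origin T)" if "\<omega> \<in> space M" "W t \<omega> \<in> Some ` ?C" for \<omega>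
      using alive_iff_hits_origin[OF s(1) that(1)] W_absorbed[OF that(1) s(1), of t] s(2) that(2) by auto
    then show ?thesis unfolding hits_append hits_Cons hits_Nil by (auto simp: hits_def)
  qed
  have "(\<integral>\<^sup>+\<omega>. lift (indicator ?C) (W t \<omega>) * indicator (hits T (space M) W l) \<omega> \<partial>M) =
      emeasure M (hits T (space M) W (l @ [(s, origin T), (t, j)]))"
    unfolding split by (rule lift_ind_hits[OF t F C])
  also have "\<dots> = \<Phi> 0 (l @ [(s, origin T), (t, j)]) (\<lambda>_. 1) \<xi>"
    using l j s origin_in_sites[OF tree] by (intro law) (force simp: sorted_append)+
  also have "\<dots> = \<Phi> 0 (l @ [(s, origin T)]) (P (t - s) (indicator ?C)) \<xi>"
    unfolding \<Phi>_snoc by simp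
  also have "\<dots> = (\<integral>\<^sup>+\<omega>. lift (P (t - s) (indicator ?C)) (W s \<omega>) * indicator (hits T (space M) W l) \<omega> \<partial>M)"
    using C by (intro integral_hits[symmetric] s l P_measurable) simp
  finally show "(\<integral>\<^sup>+\<omega>. lift (indicator ?C) (W t \<omega>) * indicator (hits T (space M) W l) \<omega> \<partial>M) =
      (\<integral>\<^sup>+\<omega>. lift (P (t - s) (indicator ?C)) (W s \<omega>) * indicator (hits T (space M) W l) \<omega> \<partial>M)" .
qed

text \<open>Both sides are values at \<open>F\<close> of measures with densities over M. They agree
  on the cylinders up to time s, which are closed under intersection and generate the past.\<close>

lemma integral_markov_past:
  assumes s: "0 \<le> s" "s < t" and F: "F \<in> sets (Pst s)" and U: "U \<in> sets \<B>"
  shows "(\<integral>\<^sup>+\<omega>. lift (indicator U) (W t \<omega>) * indicator F \<omega> \<partial>M) =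
    (\<integral>\<^sup>+\<omega>. lift (P (t - s) (indicator U)) (W s \<omega>) * indicator F \<omega> \<partial>M)"
proof -
  have t: "0 \<le> t" using s by simp
  let ?f = "\<lambda>\<omega>. lift (indicator U) (W t \<omega>)" and ?g = "\<lambda>\<omega>. lift (P (t - s) (indicator U)) (W s \<omega>)"
  have f: "?f \<in> borel_measurable M" by (rule lift_W_measurable_M[OF t borel_measurable_indicator[OF U]])
  have g: "?g \<in> borel_measurable M"
    by (rule lift_W_measurable_M[OF s(1) P_measurable[OF borel_measurable_indicator[OF U]]])
  have P: "sigma_sets (space M) (cylinders T (space M) W {0..s}) \<subseteq> sets M"
    using sets_Pst[OF s(1)] sets_Pst_sub by auto
  have cyl: "emeasure (density M ?f) A = emeasure (density M ?g) A"
    if AC: "A \<in> cylinders T (space M) W {0..s}" for A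
  proof -
    obtain l where l: "A = hits T (space M) W l" "sorted (map fst l)" "set l \<subseteq> {0..s} \<times> sites T"
      using AC unfolding cylinders_def by blast
    have "A \<in> sets M" using P AC by auto
    then show ?thesis
      using integral_markov_hits[OF s l(2,3) borel_measurable_indicator[OF U]] f g l(1)
      by (simp add: emeasure_density)
  qed
  have "emeasure (density M ?f) F = emeasure (density M ?g) F"
  proof (rule emeasure_eq_sigma_sets[OF Int_stable_cylinders cylinders_subset])
    show "F \<in> sigma_sets (space M) (cylinders T (space M) W {0..s})" using F sets_Pst[OF s(1)] by simp
    show "emeasure (density M ?f) (space M) = emeasure (density M ?g) (space M)"
      by (rule cyl[OF space_in_cylinders])
    have "emeasure (density M ?f) (space M) = (\<integral>\<^sup>+\<omega>. ?f \<omega> * indicator (space M) \<omega> \<partial>M)"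
      using f by (simp add: emeasure_density)
    also have "\<dots> = emeasure M (space M \<inter> {\<omega> \<in> space M. W t \<omega> \<in> Some ` U})"
      by (rule lift_ind_hits[OF t sets.top U])
    finally show "emeasure (density M ?f) (space M) \<noteq> \<infinity>"
      by simp
  qed (use P cyl in auto)
  moreover have "F \<in> sets M" using F sets_Pst_sub by auto
  ultimately show ?thesis using f g by (simp add: emeasure_density)
qed

text \<open>The indicator of \<open>A\<close> at time t splits into a live part, covered by
  \<open>integral_markov_past\<close>, and a multiple of the indicator of death. The death part
  follows by complementation inside \<open>F\<close>, where the finite mass of the surviving paths
  cancels.\<close>

lemma cond_exp_eq_kernel:
  assumes s: "0 \<le> s" "s < t" and A: "A \<in> sets E"
  shows "AE \<omega> in M. nn_cond_exp M (Pst s) (\<lambda>\<omega>. indicator A (W t \<omega>)) \<omega> =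
    sub_kernel \<mu> dens (t - s) (W s \<omega>) A"
proof -
  have t: "0 \<le> t" and u: "0 < t - s" using s by auto
  let ?U = "Some -` A"
  have U: "?U \<in> sets \<B>" using A in_sets_coffin_borel_iff[OF tree R_sets] by simp
  have one: "(\<lambda>_. 1) \<in> borel_measurable \<B>" by simp
  define f where "f \<omega> = lift (indicator ?U) (W t \<omega>) + (1 - lift (\<lambda>_. 1) (W t \<omega>)) * indicator A None" for \<omega>
  define h where "h \<omega> = lift (P (t - s) (indicator ?U)) (W s \<omega>) +
    (1 - lift (P (t - s) (\<lambda>_. 1)) (W s \<omega>)) * indicator A None" for \<omega>
  have f_eq: "indicator A (W t \<omega>) = f \<omega>" for \<omega>
    unfolding f_def by (cases "W t \<omega>") (auto simp: indicator_def)
  have h_eq: "sub_kernel \<mu> dens (t - s) (W s \<omega>) A = h \<omega>" if "\<omega> \<in> space M" for \<omega>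
    using W_live[OF s(1) that] sub_kernel_live[OF u _ A]
    by (cases "W s \<omega>") (auto simp: h_def sub_kernel_def)
  have mf: "(\<lambda>\<omega>. lift k (W t \<omega>)) \<in> borel_measurable M" if "k \<in> borel_measurable \<B>" for k
    by (rule lift_W_measurable_M[OF t that])
  have mh: "(\<lambda>\<omega>. lift k (W s \<omega>)) \<in> borel_measurable (Pst s)" if "k \<in> borel_measurable \<B>" for k
    by (rule lift_W_measurable[OF s(1) order.refl that])
  have mhM: "(\<lambda>\<omega>. lift k (W s \<omega>)) \<in> borel_measurable M" if "k \<in> borel_measurable \<B>" for k
    by (rule lift_W_measurable_M[OF s(1) that])
  note P1 = P_measurable[OF one, of "t - s"] and PU = P_measurable[OF borel_measurable_indicator[OF U], of "t - s"]
  have int: "(\<integral>\<^sup>+\<omega>. f \<omega> * indicator F \<omega> \<partial>M) = (\<integral>\<^sup>+\<omega>. h \<omega> * indicator F \<omega> \<partial>M)" if F: "F \<in> sets (Pst s)" for F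
  proof -
    have FM: "F \<in> sets M" using F sets_Pst_sub by auto
    have bd: "space \<B> \<in> sets \<B>" by simp
    have ones: "lift (indicator (space \<B>)) (W t \<omega>) = lift (\<lambda>_. 1) (W t \<omega>)"
      "lift (P (t - s) (indicator (space \<B>))) (W s \<omega>) = lift (P (t - s) (\<lambda>_. 1)) (W s \<omega>)"
      if "\<omega> \<in> space M" for \<omega>
    proof -
      show "lift (indicator (space \<B>)) (W t \<omega>) = lift (\<lambda>_. 1) (W t \<omega>)"
        by (rule sigma_linear_cong[OF lift_sigma_linear[OF t that]]) simp
      show "lift (P (t - s) (indicator (space \<B>))) (W s \<omega>) = lift (P (t - s) (\<lambda>_. 1)) (W s \<omega>)"
        by (rule sigma_linear_cong[OF lift_P_sigma_linear[OF s(1) that]]) simp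
    qed
    let ?a = "\<integral>\<^sup>+\<omega>. lift (\<lambda>_. 1) (W t \<omega>) * indicator F \<omega> \<partial>M"
    let ?b = "\<integral>\<^sup>+\<omega>. (1 - lift (\<lambda>_. 1) (W t \<omega>)) * indicator F \<omega> \<partial>M"
    let ?c = "\<integral>\<^sup>+\<omega>. (1 - lift (P (t - s) (\<lambda>_. 1)) (W s \<omega>)) * indicator F \<omega> \<partial>M"
    have a: "?a = (\<integral>\<^sup>+\<omega>. lift (P (t - s) (\<lambda>_. 1)) (W s \<omega>) * indicator F \<omega> \<partial>M)"
      using integral_markov_past[OF s F bd] ones by (simp cong: nn_integral_cong)
    have m_a: "(\<lambda>\<omega>. lift (\<lambda>_. 1) (W t \<omega>) * indicator F \<omega>) \<in> borel_measurable M"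
      and m_b: "(\<lambda>\<omega>. (1 - lift (\<lambda>_. 1) (W t \<omega>)) * indicator F \<omega>) \<in> borel_measurable M"
      using mf[OF one] FM by measurable
    have m_c: "(\<lambda>\<omega>. (1 - lift (P (t - s) (\<lambda>_. 1)) (W s \<omega>)) * indicator F \<omega>) \<in> borel_measurable M"
      and m_p: "(\<lambda>\<omega>. lift (P (t - s) (\<lambda>_. 1)) (W s \<omega>) * indicator F \<omega>) \<in> borel_measurable M"
      using mhM[OF P1] FM by measurable
    have m_U: "(\<lambda>\<omega>. lift (indicator ?U) (W t \<omega>) * indicator F \<omega>) \<in> borel_measurable M"
      using mf[OF borel_measurable_indicator[OF U]] FM by measurable
    have m_PU: "(\<lambda>\<omega>. lift (P (t - s) (indicator ?U)) (W s \<omega>) * indicator F \<omega>) \<in> borel_measurable M"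
      using mhM[OF PU] FM by measurable
    have "?a + ?b = (\<integral>\<^sup>+\<omega>. lift (\<lambda>_. 1) (W t \<omega>) * indicator F \<omega> + (1 - lift (\<lambda>_. 1) (W t \<omega>)) * indicator F \<omega> \<partial>M)"
      by (rule nn_integral_add[OF m_a m_b, symmetric])
    also have "\<dots> = (\<integral>\<^sup>+\<omega>. indicator F \<omega> \<partial>M)"
      by (intro nn_integral_cong) (auto simp: lift_def indicator_def split: option.split)
    also have "\<dots> = (\<integral>\<^sup>+\<omega>. lift (P (t - s) (\<lambda>_. 1)) (W s \<omega>) * indicator F \<omega> +
        (1 - lift (P (t - s) (\<lambda>_. 1)) (W s \<omega>)) * indicator F \<omega> \<partial>M)"
    proof (rule nn_integral_cong_AE)
      show "AE \<omega> in M. indicator F \<omega> = lift (P (t - s) (\<lambda>_. 1)) (W s \<omega>) * indicator F \<omega> +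
        (1 - lift (P (t - s) (\<lambda>_. 1)) (W s \<omega>)) * indicator F \<omega>"
        using AE_sub[OF s(1) u] by eventually_elim (auto simp: indicator_def add_diff_inverse_ennreal)
    qed
    also have "\<dots> = ?a + ?c" unfolding a
      by (rule nn_integral_add[OF m_p m_c])
    finally have bc: "?b = ?c" using integral_lift_finite[of t F] by (simp add: ennreal_add_left_cancel)
    have "(\<integral>\<^sup>+\<omega>. f \<omega> * indicator F \<omega> \<partial>M) = (\<integral>\<^sup>+\<omega>. lift (indicator ?U) (W t \<omega>) * indicator F \<omega> +
        ((1 - lift (\<lambda>_. 1) (W t \<omega>)) * indicator F \<omega>) * indicator A None \<partial>M)"
      unfolding f_def by (intro nn_integral_cong) (simp only: distrib_right mult.assoc mult.commute[of "indicator F _"])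
    also have "\<dots> = (\<integral>\<^sup>+\<omega>. lift (indicator ?U) (W t \<omega>) * indicator F \<omega> \<partial>M) + ?b * indicator A None"
      by (subst nn_integral_add[OF m_U borel_measurable_times_ennreal[OF m_b borel_measurable_const]])
        (simp only: nn_integral_multc[OF m_b])
    also have "\<dots> = (\<integral>\<^sup>+\<omega>. lift (P (t - s) (indicator ?U)) (W s \<omega>) * indicator F \<omega> \<partial>M) + ?c * indicator A None"
      by (simp only: bc integral_markov_past[OF s F U])
    also have "\<dots> = (\<integral>\<^sup>+\<omega>. lift (P (t - s) (indicator ?U)) (W s \<omega>) * indicator F \<omega> +
        ((1 - lift (P (t - s) (\<lambda>_. 1)) (W s \<omega>)) * indicator F \<omega>) * indicator A None \<partial>M)"
      by (subst nn_integral_add[OF m_PU borel_measurable_times_ennreal[OF m_c borel_measurable_const]])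
        (simp only: nn_integral_multc[OF m_c])
    also have "\<dots> = (\<integral>\<^sup>+\<omega>. h \<omega> * indicator F \<omega> \<partial>M)"
      unfolding h_def by (intro nn_integral_cong) (simp only: distrib_right mult.assoc mult.commute[of "indicator F _"])
    finally show ?thesis .
  qed
  interpret sigma_finite_subalgebra M "Pst s" by (rule Pst_sigma_finite)
  have "AE \<omega> in M. h \<omega> = nn_cond_exp M (Pst s) f \<omega>"
  proof (rule nn_cond_exp_charact)
    show "f \<in> borel_measurable M"
      unfolding f_def[abs_def] using mf[OF one] mf[OF borel_measurable_indicator[OF U]] by measurable
    show "h \<in> borel_measurable (Pst s)"
      unfolding h_def[abs_def] using mh[OF P1] mh[OF PU] by measurable
  qed (use int in simp)
  then have "AE \<omega> in M. nn_cond_exp M (Pst s) f \<omega> = sub_kernel \<mu> dens (t - s) (W s \<omega>) A"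
    using AE_space by eventually_elim (simp add: h_eq)
  moreover have "(\<lambda>\<omega>. indicator A (W t \<omega>)) = f" using f_eq by (simp add: fun_eq_iff)
  ultimately show ?thesis by (simp only:)
qed

lemma sub_markov_process_of_hits:
  "sub_markov_process (subtopology (boundary_top T) R) \<mu> dens (return \<B> \<xi>) M W"
proof -
  have "emeasure M (W 0 -` A \<inter> space M) = emeasure (return \<B> \<xi>) (Some -` A)" if A: "A \<in> sets E" for A
  proof -
    have U: "Some -` A \<in> sets \<B>" using A in_sets_coffin_borel_iff[OF tree R_sets] by simp
    have "emeasure M (W 0 -` A \<inter> space M) = emeasure M (if Some \<xi> \<in> A then space M else {})"
    proof (rule emeasure_eq_AE)
      show "AE \<omega> in M. \<omega> \<in> W 0 -` A \<inter> space M \<longleftrightarrow> \<omega> \<in> (if Some \<xi> \<in> A then space M else {})"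
        using init AE_space by eventually_elim auto
    qed (use measurable_sets[OF W_measurable A] in auto)
    then show ?thesis using U by (simp add: M.emeasure_space_1 indicator_def)
  qed
  then show ?thesis
    unfolding sub_markov_process_def Let_def coffin_borel_def[symmetric]
    by (intro conjI allI impI ballI M.prob_space_axioms W_measurable W_rcll cond_exp_eq_kernel)
      (use W_absorbed in \<open>assumption | blast\<close>)+
qed

end

end

section \<open>States occupied by a process, and constancy of the decay rate\<close>

context ray_process
begin

text \<open>Paths in U at time s lie in V immediately afterwards, hence at one of the times s + 1 /
  (k + 1). If the kernel from U never charges V, each of these countably many events is null, and so
  is the visit to U.\<close>

lemma AE_leave:
  assumes s: "0 \<le> s" and U: "U \<in> sets \<B>" and V: "V \<in> sets \<B>"
    and zero: "\<And>u x. 0 < u \<Longrightarrow> x \<in> U \<Longrightarrow> P u (indicator V) x = 0"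
    and ev: "\<And>\<omega>. \<omega> \<in> space M \<Longrightarrow> W s \<omega> \<in> Some ` U \<Longrightarrow>
      eventually (\<lambda>u. W u \<omega> \<in> Some ` V) (at_right s)"
  shows "AE \<omega> in M. W s \<omega> \<notin> Some ` U"
proof -
  have "AE \<omega> in M. \<not> (W s \<omega> \<in> Some ` U \<and> W (s + 1 / real (Suc k)) \<omega> \<in> Some ` V)" for k
  proof -
    let ?u = "1 / real (Suc k)"
    let ?F = "{\<omega> \<in> space M. W s \<omega> \<in> Some ` U}"
    have u: "0 < ?u" and su: "s \<le> s + ?u" and t: "0 \<le> s + ?u" using s by auto
    have F: "?F \<in> sets (Pst s)" by (rule live_in_Pst[OF s order.refl U])
    have FM: "?F \<in> sets M" using F sets_Pst_sub by auto
    have m: "?F \<inter> {\<omega> \<in> space M. W (s + ?u) \<omega> \<in> Some ` V} \<in> sets M"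
      using FM measurable_live[OF t V] by auto
    have "emeasure M (?F \<inter> {\<omega> \<in> space M. W (s + ?u) \<omega> \<in> Some ` V}) =
        (\<integral>\<^sup>+\<omega>. lift (indicator V) (W (s + ?u) \<omega>) * indicator ?F \<omega> \<partial>M)"
      by (rule lift_ind_hits[OF t FM V, symmetric])
    also have "\<dots> = (\<integral>\<^sup>+\<omega>. lift (P (s + ?u - s) (indicator V)) (W s \<omega>) * indicator ?F \<omega> \<partial>M)"
      by (rule markov_integral[OF s su F borel_measurable_indicator[OF V]])
    also have "\<dots> = (\<integral>\<^sup>+\<omega>. 0 \<partial>M)"
    proof (rule nn_integral_cong)
      fix \<omega> show "lift (P (s + ?u - s) (indicator V)) (W s \<omega>) * indicator ?F \<omega> = 0"
        using zero[OF u] by (cases "W s \<omega>") (auto simp: indicator_def)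
    qed
    finally have "?F \<inter> {\<omega> \<in> space M. W (s + ?u) \<omega> \<in> Some ` V} \<in> null_sets M"
      using m by (simp add: null_sets_def)
    from AE_not_in[OF this] show ?thesis using AE_space by eventually_elim auto
  qed
  then have "AE \<omega> in M. \<forall>k. \<not> (W s \<omega> \<in> Some ` U \<and> W (s + 1 / real (Suc k)) \<omega> \<in> Some ` V)"
    by (simp only: AE_all_countable simp_thms)
  then show ?thesis using AE_space
  proof eventually_elim
    case (elim \<omega>)
    show ?case
    proof
      assume "W s \<omega> \<in> Some ` U"
      from eventually_at_right_sequence[OF ev[OF elim(2) this]]
      have "\<exists>k. W (s + 1 / real (Suc k)) \<omega> \<in> Some ` V"
        by (rule eventually_happens'[OF sequentially_bot])
      then show False using elim(1) \<open>W s \<omega> \<in> Some ` U\<close> by blast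
    qed
  qed
qed

text \<open>\<open>AE_leave\<close> is applied twice. A null cell is left immediately, since the
  kernel is absolutely continuous with respect to \<mu>; a point with a divergent series is left by
  immediate death, since its density is 0.\<close>

lemma AE_good:
  assumes s: "0 \<le> s"
  shows "AE \<omega> in M. \<forall>x. W s \<omega> = Some x \<longrightarrow> good x"
proof -
  let ?I = "{i \<in> sites T. measure \<mu> (boundary_at T i) = 0}"
  have I: "countable ?I" by (rule countable_subset[OF _ countable_sites[OF tree]]) auto
  have "AE \<omega> in M. W s \<omega> \<notin> Some ` boundary_at T i" if i: "i \<in> ?I" for i
  proof (rule AE_leave[OF s])
    have C: "boundary_at T i \<in> sets \<B>" using boundary_at_in_sets[OF tree] i by simp
    show "boundary_at T i \<in> sets \<B>" "boundary_at T i \<in> sets \<B>" by fact+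
    have "boundary_at T i \<in> null_sets \<mu>"
      using C i by (simp add: null_sets_def sets_\<mu> emeasure_eq_measure)
    from AE_not_in[OF this] have null: "AE y in \<mu>. (indicator (boundary_at T i) y :: ennreal) = 0"
      by eventually_elim simp
    show "P u (indicator (boundary_at T i)) x = 0" if "0 < u" for u x
      by (rule P_null[OF that null])
    show "eventually (\<lambda>u. W u \<omega> \<in> Some ` boundary_at T i) (at_right s)"
      if "\<omega> \<in> space M" "W s \<omega> \<in> Some ` boundary_at T i" for \<omega>
      using hits_eventually[OF that(1) s, of i] i that(2) by simp
  qed
  then have cells: "AE \<omega> in M. \<forall>i\<in>?I. W s \<omega> \<notin> Some ` boundary_at T i"
    unfolding AE_ball_countable[OF I] by (rule ballI)
  \<comment> \<open>These points have charged cells but a divergent series; here V is the set of all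
    live states.\<close>
  let ?N = "{x \<in> space \<B>. \<forall>n. 0 < mass n x} - {x \<in> boundary T. good x}"
  have "AE \<omega> in M. W s \<omega> \<notin> Some ` ?N"
  proof (rule AE_leave[OF s])
    have "{x \<in> space \<B>. \<forall>n. 0 < mass n x} \<in> sets \<B>" by measurable
    then show "?N \<in> sets \<B>" using good_measurable by auto
    show "space \<B> \<in> sets \<B>" by simp
    fix u x assume "0 < (u::real)" "x \<in> ?N"
    then have "\<forall>n. 0 < mass n x" "\<not> good x" using tree by auto
    then have "\<not> summable (\<lambda>k. D k * mass k x)" by (auto simp: good_def)
    from p_zero_of_not_summable[OF this] show "P u (indicator (space \<B>)) x = 0"
      using \<open>0 < u\<close> by (simp add: P_def)
  next
    fix \<omega> assume \<omega>: "\<omega> \<in> space M" "W s \<omega> \<in> Some ` ?N"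
    then have "W s \<omega> \<in> Some ` boundary_at T (origin T)"
      using tree by (auto simp: boundary_at_origin)
    then show "eventually (\<lambda>u. W u \<omega> \<in> Some ` space \<B>) (at_right s)"
      using hits_eventually[OF \<omega>(1) s origin_in_sites[OF tree]] tree
      by (simp add: boundary_at_origin)
  qed
  then show ?thesis using cells AE_space
  proof eventually_elim
    case (elim \<omega>)
    show ?case
    proof (intro allI impI)
      fix x assume x: "W s \<omega> = Some x"
      then have xb: "x \<in> boundary T" using W_live[OF s elim(3)] by simp
      have "0 < mass n x" for n
      proof (rule ccontr)
        assume "\<not> 0 < mass n x"
        then have "mass n x = 0" using mass_nonneg[of n x] by simp
        then have "x (n + d) \<in> ?I"
          using ray_site[OF tree xb] by (simp add: mass_def boundary_at_ray[OF tree xb])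
        then have "W s \<omega> \<notin> Some ` boundary_at T (x (n + d))" using elim(2) by blast
        then show False using x xb boundary_at_ray[OF tree xb, of "n + d"] by auto
      qed
      then show "good x" using elim(1) x xb tree by auto
    qed
  qed
qed

lemma AE_initial:
  assumes sets: "sets \<nu> = sets \<B>" and Q: "{x \<in> boundary T. Q x} \<in> sets \<B>"
    and AE: "AE \<omega> in M. \<forall>x. W 0 \<omega> = Some x \<longrightarrow> Q x"
  shows "AE x in \<nu>. x \<in> R \<longrightarrow> Q x"
proof -
  let ?U = "R - {x \<in> boundary T. Q x}"
  have U: "?U \<in> sets \<B>" using R_sets Q by auto
  have v: "Some -` (Some ` ?U) = ?U" by auto
  have A: "Some ` ?U \<in> sets E" unfolding in_sets_coffin_borel_iff[OF tree R_sets] v using U by auto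
  have "AE \<omega> in M. \<omega> \<notin> W 0 -` (Some ` ?U) \<inter> space M"
    using AE by eventually_elim (use R_sub in auto)
  then have "emeasure M (W 0 -` (Some ` ?U) \<inter> space M) = 0"
    using measurable_sets[OF W_measurable A] by (subst (asm) AE_iff_null_sets[symmetric]) auto
  then have "emeasure \<nu> ?U = 0" using W_initial[OF A] v by simp
  then have "?U \<in> null_sets \<nu>" using U sets by (simp add: null_sets_def)
  from AE_not_in[OF this] show ?thesis
    by eventually_elim (use R_sub in auto)
qed

lemma AE_initial_point:
  assumes \<nu>: "\<nu> = return \<B> \<xi>" and \<xi>: "\<xi> \<in> R"
  shows "AE \<omega> in M. W 0 \<omega> = Some \<xi>"
proof -
  have s: "{\<xi>} \<in> sets \<B>" using singleton_in_sets \<xi> R_sub by auto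
  have v: "Some -` {Some \<xi>} = {\<xi>}" by auto
  have A: "{Some \<xi>} \<in> sets E" unfolding in_sets_coffin_borel_iff[OF tree R_sets] v using s \<xi> by auto
  have "emeasure M (W 0 -` {Some \<xi>} \<inter> space M) = 1"
    using W_initial[OF A] v s \<nu> by simp
  then have "AE \<omega> in M. \<omega> \<in> W 0 -` {Some \<xi>} \<inter> space M"
    using measurable_sets[OF W_measurable A] by (subst M.AE_in_set_eq_1) (auto simp: measure_def)
  then show ?thesis by eventually_elim auto
qed

text \<open>Both sides are versions of the same conditional expectation given the past at s,
  computed directly and through the time s + u. This yields the identity along the process, almost
  surely, rather than at every point.\<close>

lemma chapman_kolmogorov:
  assumes s: "0 \<le> s" and u: "0 \<le> u" and t: "0 \<le> t" and f: "f \<in> borel_measurable \<B>"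
  shows "AE \<omega> in M. lift (P u (P t f)) (W s \<omega>) = lift (P (u + t) f) (W s \<omega>)"
proof -
  interpret sigma_finite_subalgebra M "Pst s" by (rule Pst_sigma_finite)
  let ?h = "\<lambda>\<omega>. lift f (W (s + u + t) \<omega>)"
  have h: "?h \<in> borel_measurable M" using s u t by (intro lift_W_measurable_M f) simp
  have 1: "AE \<omega> in M. lift (P (u + t) f) (W s \<omega>) = nn_cond_exp M (Pst s) ?h \<omega>"
  proof (rule nn_cond_exp_charact[OF _ h])
    show "(\<lambda>\<omega>. lift (P (u + t) f) (W s \<omega>)) \<in> borel_measurable (Pst s)"
      by (rule lift_W_measurable[OF s order.refl P_measurable[OF f]])
    fix F assume F: "F \<in> sets (Pst s)"
    show "(\<integral>\<^sup>+\<omega>\<in>F. ?h \<omega> \<partial>M) = (\<integral>\<^sup>+\<omega>\<in>F. lift (P (u + t) f) (W s \<omega>) \<partial>M)"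
      using markov_integral[OF s _ F f, of "s + u + t"] u t by (simp add: add.assoc)
  qed
  have 2: "AE \<omega> in M. lift (P u (P t f)) (W s \<omega>) = nn_cond_exp M (Pst s) ?h \<omega>"
  proof (rule nn_cond_exp_charact[OF _ h])
    show "(\<lambda>\<omega>. lift (P u (P t f)) (W s \<omega>)) \<in> borel_measurable (Pst s)"
      by (rule lift_W_measurable[OF s order.refl P_measurable[OF P_measurable[OF f]]])
    fix F assume F: "F \<in> sets (Pst s)"
    have F': "F \<in> sets (Pst (s + u))" using F Pst_mono[of s "s + u"] u by auto
    have "(\<integral>\<^sup>+\<omega>\<in>F. ?h \<omega> \<partial>M) = (\<integral>\<^sup>+\<omega>\<in>F. lift (P t f) (W (s + u) \<omega>) \<partial>M)"
      using markov_integral[OF _ _ F' f, of "s + u + t"] s u t by simp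
    also have "\<dots> = (\<integral>\<^sup>+\<omega>\<in>F. lift (P u (P t f)) (W s \<omega>) \<partial>M)"
      using markov_integral[OF s _ F P_measurable[OF f], of "s + u"] u by simp
    finally show "(\<integral>\<^sup>+\<omega>\<in>F. ?h \<omega> \<partial>M) = (\<integral>\<^sup>+\<omega>\<in>F. lift (P u (P t f)) (W s \<omega>) \<partial>M)" .
  qed
  show ?thesis using 1 2 by eventually_elim simp
qed

text \<open>
  In the Chapman-Kolmogorov identity for \<open>P u (P 1 1)\<close> the leading exponential as \<open>u \<rightarrow> \<infinity>\<close> is
  \<open>exp (- u / g 0 x)\<close>; comparing its coefficients on both sides identifies \<open>exp (- 1 / g 0 x)\<close>
  with a constant.
\<close>

lemma AE_g_0_const:
  assumes AEg: "AE y in \<mu>. good y" and s: "0 \<le> s"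
  shows "AE \<omega> in M. \<forall>x. W s \<omega> = Some x \<longrightarrow> ennreal (exp (- 1 / g 0 x)) = (\<integral>\<^sup>+y. P 1 (\<lambda>_. 1) y \<partial>\<mu>)"
proof -
  let ?h = "P 1 (\<lambda>_. 1)"
  have hm: "?h \<in> borel_measurable \<mu>" unfolding measurable_\<mu> by (rule P_measurable) simp
  have dm: "(\<lambda>y. 1 - ?h y) \<in> borel_measurable \<mu>" unfolding measurable_\<mu> by measurable
  have h_le: "AE y in \<mu>. ?h y \<le> 1"
    using AEg AE_space by eventually_elim (auto simp: P_one_le space_\<mu>)
  define H where "H = enn2real (\<integral>\<^sup>+y. ?h y \<partial>\<mu>)"
  have Hle: "(\<integral>\<^sup>+y. ?h y \<partial>\<mu>) \<le> 1"
    using nn_integral_mono_AE[OF h_le] by (simp add: emeasure_space_1)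
  then have H: "(\<integral>\<^sup>+y. ?h y \<partial>\<mu>) = ennreal H" unfolding H_def by (simp add: top.not_eq_extremum le_less_trans)
  have H1: "0 \<le> H" "H \<le> 1" using Hle unfolding H by (auto simp: H_def ennreal_le_1)
  have H': "(\<integral>\<^sup>+y. 1 - ?h y \<partial>\<mu>) = ennreal (1 - H)"
  proof -
    have "(\<integral>\<^sup>+y. 1 - ?h y \<partial>\<mu>) = (\<integral>\<^sup>+y. 1 \<partial>\<mu>) - (\<integral>\<^sup>+y. ?h y \<partial>\<mu>)"
      using hm h_le H by (intro nn_integral_diff) auto
    also have "\<dots> = ennreal 1 - ennreal H" by (simp add: emeasure_space_1 H)
    also have "\<dots> = ennreal (1 - H)" using H1(1) by (rule ennreal_minus)
    finally show ?thesis .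
  qed
  \<comment> \<open>Integer times u suffice for the limit, and being countable they leave a single
    exceptional null set.\<close>
  have CK: "AE \<omega> in M. \<forall>u::nat. lift (P (real u) ?h) (W s \<omega>) = lift (P (real u + 1) (\<lambda>_. 1)) (W s \<omega>)"
    using chapman_kolmogorov[OF s, of "real _" 1 "\<lambda>_. 1"] by (simp add: AE_all_countable)
  show ?thesis using CK AE_good[OF s] AE_space
  proof eventually_elim
    case (elim \<omega>)
    show ?case
    proof (intro allI impI)
      fix x assume x: "W s \<omega> = Some x"
      then have xb: "x \<in> boundary T" and xg: "good x" using W_live[OF s elim(3)] elim(2) by auto
      define a where "a = exp (- 1 / g 0 x)"
      define b where "b = exp (- 1 / g 1 x)"
      have g: "0 < g 1 x" "g 1 x < g 0 x"
        using g_pos[OF xb xg, of 1] g_Suc_less[OF xb xg, of 0] by auto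
      then have ab: "0 < b" "b < a" unfolding a_def b_def by (auto simp: field_simps)
      define q where "q = b / a"
      have q: "0 \<le> q" "q < 1" using ab by (auto simp: q_def field_simps)
      \<comment> \<open>With u = N = Suc n, the level-0 term alone bounds p u x y from below by c =
        a^N - b^N for almost every y. Integrating this bound against \<open>?h\<close> gives c H
        \<le> a^N a, and against 1 - \<open>?h\<close> gives a^N a + c (1 - H) \<le> a^N. Division
        by a^N leaves errors of order q^N with q = b / a < 1.\<close>
      have ineq: "(1 - q ^ Suc n) * H \<le> a \<and> a \<le> H + q ^ Suc n * (1 - H)" for n
      proof -
        define u where "u = real (Suc n)"
        have u: "0 < u" by (simp add: u_def)
        have pw: "exp (- u / v) = exp (- 1 / v) ^ Suc n" for v
        proof -
          have "- u / v = real (Suc n) * (- 1 / v)" unfolding u_def by (simp only: times_divide_eq_right mult_minus1_right)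
          then show ?thesis by (simp only: exp_of_nat_mult)
        qed
        have "- (u + 1) / g 0 x = - u / g 0 x + - 1 / g 0 x" by (simp only: minus_add_distrib add_divide_distrib)
        then have pow: "exp (- u / g 0 x) = a ^ Suc n" "exp (- u / g 1 x) = b ^ Suc n"
          "exp (- (u + 1) / g 0 x) = a ^ Suc n * a"
          unfolding a_def b_def using pw by (simp_all only: exp_add)
        define c where "c = a ^ Suc n - b ^ Suc n"
        have c: "0 \<le> c" unfolding c_def using power_mono[of b a "Suc n"] ab by (simp del: power_Suc)
        have p_ge: "ennreal c \<le> p u x y" if "y d = i0" for y
        proof -
          have "(if x (0 + d) = y (0 + d) then coef u 0 x else 0) \<le> p u x y"
            unfolding p_def using sum_le_suminf[of "\<lambda>n. if x (n + d) = y (n + d) then coef u n x else 0" "{0}"]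
            by simp
          moreover have "coef u 0 x = ennreal c"
            unfolding coef_def mass_0[OF xb xg] c_def using pow by simp
          ultimately show ?thesis using base_point[OF xb xg] that by simp
        qed
        have pm: "p u x \<in> borel_measurable \<mu>" unfolding measurable_\<mu> by (rule p_measurable2[OF xb])
        have Puh: "P u ?h x = ennreal (a ^ Suc n * a)"
        proof -
          have "P u ?h x = P (u + 1) (\<lambda>_. 1) x" using elim(1)[rule_format, of "Suc n"] x by (simp add: u_def)
          then show ?thesis using P_one_good[OF xb xg, of "u + 1"] u pow by simp
        qed
        have Pu1: "P u (\<lambda>_. 1) x = ennreal (a ^ Suc n)" using P_one_good[OF xb xg u] pow by simp
        have "ennreal c * ennreal H = (\<integral>\<^sup>+y. ennreal c * ?h y \<partial>\<mu>)"
          using hm by (simp add: nn_integral_cmult H)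
        also have "\<dots> \<le> (\<integral>\<^sup>+y. p u x y * ?h y \<partial>\<mu>)"
          by (rule nn_integral_mono_AE) (use base in eventually_elim, simp add: p_ge mult_right_mono)
        also have "\<dots> = ennreal (a ^ Suc n * a)" using Puh u by (simp add: P_def)
        finally have 1: "c * H \<le> a ^ Suc n * a"
          using c H1 ab by (simp add: ennreal_mult[symmetric] ennreal_le_iff)
        have "ennreal (a ^ Suc n * a) + ennreal c * ennreal (1 - H) =
            (\<integral>\<^sup>+y. p u x y * ?h y \<partial>\<mu>) + (\<integral>\<^sup>+y. ennreal c * (1 - ?h y) \<partial>\<mu>)"
        proof -
          have "(\<integral>\<^sup>+y. ennreal c * (1 - ?h y) \<partial>\<mu>) = ennreal c * (\<integral>\<^sup>+y. 1 - ?h y \<partial>\<mu>)"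
            by (rule nn_integral_cmult[OF dm])
          moreover have "(\<integral>\<^sup>+y. p u x y * ?h y \<partial>\<mu>) = ennreal (a ^ Suc n * a)"
            using Puh u unfolding P_def[of u] by simp
          ultimately show ?thesis by (simp only: H')
        qed
        also have "\<dots> = (\<integral>\<^sup>+y. p u x y * ?h y + ennreal c * (1 - ?h y) \<partial>\<mu>)"
          by (intro nn_integral_add[symmetric] borel_measurable_times_ennreal borel_measurable_const pm hm dm)
        also have "\<dots> \<le> (\<integral>\<^sup>+y. p u x y * 1 \<partial>\<mu>)"
        proof (rule nn_integral_mono_AE)
          show "AE y in \<mu>. p u x y * ?h y + ennreal c * (1 - ?h y) \<le> p u x y * 1"
            using base h_le
          proof eventually_elim
            case (elim y)
            have "p u x y * ?h y + ennreal c * (1 - ?h y) \<le> p u x y * ?h y + p u x y * (1 - ?h y)"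
              using p_ge[of y, OF elim(1)] by (intro add_mono mult_right_mono) auto
            also have "\<dots> = p u x y * 1"
              unfolding distrib_left[symmetric] using elim(2) by (simp add: add_diff_inverse_ennreal)
            finally show ?case .
          qed
        qed
        also have "\<dots> = ennreal (a ^ Suc n)" using Pu1 u by (simp add: P_def)
        finally have 2: "a ^ Suc n * a + c * (1 - H) \<le> a ^ Suc n"
          using c H1 ab by (simp add: ennreal_mult[symmetric] ennreal_plus[symmetric] ennreal_le_iff del: ennreal_plus)
        have A: "0 < a ^ Suc n" using ab by simp
        have cq: "c = a ^ Suc n * (1 - q ^ Suc n)"
          unfolding c_def q_def using ab by (simp add: power_divide field_simps)
        have "a ^ Suc n * ((1 - q ^ Suc n) * H) \<le> a ^ Suc n * a" using 1 unfolding cq by (simp only: mult.assoc)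
        moreover have "a ^ Suc n * a \<le> a ^ Suc n * (H + q ^ Suc n * (1 - H))"
          using 2 unfolding cq by (simp only: algebra_simps)
        ultimately show ?thesis using A by (simp only: mult_le_cancel_left_pos)
      qed
      have q0: "(\<lambda>n. q ^ Suc n) \<longlonglongrightarrow> 0" using LIMSEQ_power_zero[of q] q by (intro LIMSEQ_Suc) simp
      have "(\<lambda>n. (1 - q ^ Suc n) * H) \<longlonglongrightarrow> (1 - 0) * H" by (intro tendsto_intros q0)
      then have 1: "H \<le> a" using ineq by (intro LIMSEQ_le_const2[of _ H a]) auto
      have "(\<lambda>n. H + q ^ Suc n * (1 - H)) \<longlonglongrightarrow> H + 0 * (1 - H)" by (intro tendsto_intros q0)
      then have 2: "a \<le> H" using ineq by (intro LIMSEQ_le_const[of _ H a]) auto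
      from 1 2 show "ennreal (exp (- 1 / g 0 x)) = (\<integral>\<^sup>+y. ?h y \<partial>\<mu>)" by (simp add: H a_def)
    qed
  qed
qed

lemma integral_initial:
  assumes sets: "sets \<nu> = sets \<B>" and f: "f \<in> borel_measurable \<B>"
  shows "(\<integral>\<^sup>+\<omega>. lift f (W 0 \<omega>) \<partial>M) = (\<integral>\<^sup>+x. f x * indicator R x \<partial>\<nu>)"
proof (rule sigma_linear_ray_eqI[OF tree _ _ _ _ f])
  have sp: "space \<nu> = space \<B>" by (rule sets_eq_imp_space_eq[OF sets])
  have m0: "measurable \<nu> N = measurable \<B> N" for N by (rule measurable_cong_sets[OF sets refl])
  have ind: "(\<integral>\<^sup>+\<omega>. lift f (W 0 \<omega>) \<partial>M) = (\<integral>\<^sup>+\<omega>. lift f (W 0 \<omega>) * indicator (space M) \<omega> \<partial>M)" for f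
    by (rule nn_integral_cong) simp
  show "sigma_linear \<B> (\<lambda>f. \<integral>\<^sup>+\<omega>. lift f (W 0 \<omega>) \<partial>M)"
    unfolding ind by (rule integral_lift_sigma_linear) auto
  show "(\<integral>\<^sup>+\<omega>. lift (\<lambda>_. 1) (W 0 \<omega>) \<partial>M) \<noteq> \<infinity>" unfolding ind by (rule integral_lift_finite)
  show "sigma_linear \<B> (\<lambda>f. \<integral>\<^sup>+x. f x * indicator R x \<partial>\<nu>)"
  proof (rule sigma_linear_nn_integral)
    show "sigma_linear \<B> (\<lambda>f. f x * indicator R x)" if "x \<in> space \<nu>" for x
      using sigma_linear_scale[OF sigma_linear_eval, of x \<B> "indicator R x"] that sp
      by (simp only: mult.commute)
    show "(\<lambda>x. f x * indicator R x) \<in> borel_measurable \<nu>"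
      if "f \<in> borel_measurable \<B>" for f :: "(nat \<Rightarrow> 'i) \<Rightarrow> ennreal"
      unfolding m0 by (intro borel_measurable_times_ennreal borel_measurable_indicator that R_sets)
  qed
  fix i assume i: "i \<in> sites T"
  let ?A = "Some ` (boundary_at T i \<inter> R)"
  have v: "Some -` ?A = boundary_at T i \<inter> R" by auto
  have U: "boundary_at T i \<inter> R \<in> sets \<B>" using boundary_at_in_sets[OF tree i] R_sets by auto
  have A: "?A \<in> sets E" unfolding in_sets_coffin_borel_iff[OF tree R_sets] v using U by auto
  have "(\<integral>\<^sup>+\<omega>. lift (indicator (boundary_at T i)) (W 0 \<omega>) \<partial>M) = (\<integral>\<^sup>+\<omega>. indicator (W 0 -` ?A \<inter> space M) \<omega> \<partial>M)"
  proof (rule nn_integral_cong)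
    fix \<omega> assume "\<omega> \<in> space M"
    then show "lift (indicator (boundary_at T i)) (W 0 \<omega>) = (indicator (W 0 -` ?A \<inter> space M) \<omega> :: ennreal)"
      using W_live[of 0 \<omega>] by (cases "W 0 \<omega>") (auto simp: indicator_def)
  qed
  also have "\<dots> = emeasure \<nu> (boundary_at T i \<inter> R)"
    using W_initial[OF A] measurable_sets[OF W_measurable A] v by simp
  also have "\<dots> = (\<integral>\<^sup>+x. indicator (boundary_at T i \<inter> R) x \<partial>\<nu>)" using U sets by simp
  finally show "(\<integral>\<^sup>+\<omega>. lift (indicator (boundary_at T i)) (W 0 \<omega>) \<partial>M) =
      (\<integral>\<^sup>+x. indicator (boundary_at T i) x * indicator R x \<partial>\<nu>)"
    by (simp add: indicator_inter_arith)
qed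

lemma emeasure_hits_initial:
  assumes sets: "sets \<nu> = sets \<B>" and full: "AE x in \<nu>. x \<in> R"
    and l: "sorted (map fst l)" "set l \<subseteq> {0..} \<times> sites T"
  shows "emeasure M (hits T (space M) W l) = (\<integral>\<^sup>+x. \<Phi> 0 l (\<lambda>_. 1) x \<partial>\<nu>)"
proof -
  let ?F = "{\<omega> \<in> space M. W 0 \<omega> \<noteq> None}"
  obtain s where s: "0 \<le> s" "set l \<subseteq> {0..s} \<times> sites T"
  proof
    show "0 \<le> Max (insert 0 (fst ` set l))" by (rule Max_ge) auto
    show "set l \<subseteq> {0..Max (insert 0 (fst ` set l))} \<times> sites T"
    proof
      fix a assume a: "a \<in> set l"
      then have "fst a \<le> Max (insert 0 (fst ` set l))" by (intro Max_ge) auto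
      moreover have "0 \<le> fst a" "snd a \<in> sites T" using a l(2) by auto
      ultimately show "a \<in> {0..Max (insert 0 (fst ` set l))} \<times> sites T" by (cases a) auto
    qed
  qed
  have H: "hits T (space M) W l \<in> sets M" using hits_in_Pst[OF s(2,1)] sets_Pst_sub by auto
  have F: "?F \<in> sets (Pst 0)" by (rule alive_in_Pst) auto
  have FM: "?F \<in> sets M" using F sets_Pst_sub by auto
  have \<Phi>m: "\<Phi> 0 l (\<lambda>_. 1) \<in> borel_measurable \<B>" using l(2) by (intro \<Phi>_measurable) auto
  have m0: "measurable \<nu> N = measurable \<B> N" for N by (rule measurable_cong_sets[OF sets refl])
  have one: "(\<integral>\<^sup>+\<omega>. lift (\<lambda>_. 1) (W 0 \<omega>) \<partial>M) = emeasure \<nu> (space \<nu>)"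
  proof -
    have "(\<integral>\<^sup>+\<omega>. lift (\<lambda>_. 1) (W 0 \<omega>) \<partial>M) = (\<integral>\<^sup>+x. 1 * indicator R x \<partial>\<nu>)"
      by (rule integral_initial[OF sets]) simp
    also have "\<dots> = (\<integral>\<^sup>+x. 1 \<partial>\<nu>)"
      by (rule nn_integral_cong_AE) (use full in eventually_elim, simp)
    finally show ?thesis by simp
  qed
  \<comment> \<open>The whole state space has probability 1 at time 0, which gives \<nu> total mass
    1; since \<nu> lives on \<open>R\<close>, the process starts alive almost surely.\<close>
  have "emeasure M (W 0 -` insert None (Some ` R) \<inter> space M) = emeasure \<nu> R"
  proof -
    have "Some -` insert None (Some ` R) = R" by auto
    then show ?thesis using W_initial[of "insert None (Some ` R)"] R_sets
      by (simp add: in_sets_coffin_borel_iff[OF tree R_sets])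
  qed
  moreover have "W 0 -` insert None (Some ` R) \<inter> space M = space M" using W_range[of 0] by auto
  moreover have "emeasure \<nu> R = emeasure \<nu> (space \<nu>)"
    using full R_sets sets by (intro emeasure_eq_AE) auto
  ultimately have "emeasure \<nu> (space \<nu>) = 1" by (simp add: M.emeasure_space_1)
  moreover have "(\<integral>\<^sup>+\<omega>. lift (\<lambda>_. 1) (W 0 \<omega>) \<partial>M) = (\<integral>\<^sup>+\<omega>. indicator ?F \<omega> \<partial>M)"
    by (rule nn_integral_cong) (auto simp: lift_def indicator_def split: option.split)
  ultimately have "emeasure M ?F = 1" using one FM by simp
  then have AEF: "AE \<omega> in M. \<omega> \<in> ?F" using FM by (subst M.AE_in_set_eq_1) (auto simp: measure_def)
  have "emeasure M (hits T (space M) W l) = emeasure M (?F \<inter> hits T (space M) W l)"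
    by (rule emeasure_eq_AE) (use AEF H FM in auto)
  also have "\<dots> = (\<integral>\<^sup>+\<omega>. lift (\<Phi> 0 l (\<lambda>_. 1)) (W 0 \<omega>) * indicator ?F \<omega> \<partial>M)"
    by (rule emeasure_hits[OF F]) (use l in auto)
  also have "\<dots> = (\<integral>\<^sup>+\<omega>. lift (\<Phi> 0 l (\<lambda>_. 1)) (W 0 \<omega>) \<partial>M)"
    by (rule nn_integral_cong) (auto simp: lift_def indicator_def split: option.split)
  also have "\<dots> = (\<integral>\<^sup>+x. \<Phi> 0 l (\<lambda>_. 1) x * indicator R x \<partial>\<nu>)"
    by (rule integral_initial[OF sets \<Phi>m])
  also have "\<dots> = (\<integral>\<^sup>+x. \<Phi> 0 l (\<lambda>_. 1) x \<partial>\<nu>)"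
    by (rule nn_integral_cong_AE) (use full in eventually_elim, simp)
  finally show ?thesis .
qed

lemma emeasure_hits_point:
  assumes \<nu>: "\<nu> = return \<B> \<xi>" and \<xi>: "\<xi> \<in> R"
    and l: "sorted (map fst l)" "set l \<subseteq> {0..} \<times> sites T"
  shows "emeasure M (hits T (space M) W l) = \<Phi> 0 l (\<lambda>_. 1) \<xi>"
proof -
  have xb: "\<xi> \<in> space \<B>" using \<xi> R_sub tree by auto
  have Rm: "Measurable.pred \<B> (\<lambda>x. x \<in> R)" using R_sets by measurable
  have "emeasure M (hits T (space M) W l) = (\<integral>\<^sup>+x. \<Phi> 0 l (\<lambda>_. 1) x \<partial>\<nu>)"
  proof (rule emeasure_hits_initial[OF _ _ l])
    show "AE x in \<nu>. x \<in> R" unfolding \<nu> AE_return[OF xb Rm] by (rule \<xi>)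
  qed (simp add: \<nu>)
  also have "\<dots> = \<Phi> 0 l (\<lambda>_. 1) \<xi>"
    unfolding \<nu> by (rule nn_integral_return[OF xb]) (use l(2) in \<open>auto intro!: \<Phi>_measurable\<close>)
  finally show ?thesis .
qed

end

section \<open>Paths of the glued process, and the limit of its restart probabilities\<close>

lemma limitin_shift_right:
  assumes "limitin X z l (at_right (t - c :: real))"
  shows "limitin X (\<lambda>u. z (u - c)) l (at_right t)"
  using assms unfolding limitin_def filtermap_at_right_shift[symmetric] eventually_filtermap by simp

lemma limitin_shift_left:
  assumes "limitin X z l (at_left (t - c :: real))"
  shows "limitin X (\<lambda>u. z (u - c)) l (at_left t)"
  using assms unfolding limitin_def filtermap_at_left_shift[symmetric] eventually_filtermap by simp

lemma eventually_ereal_less_at_right: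
  assumes "ereal t < \<Lambda>" shows "eventually (\<lambda>u. ereal u < \<Lambda>) (at_right t)"
proof -
  have "((\<lambda>u. ereal u) \<longlongrightarrow> ereal t) (at_right t)" by (intro tendsto_intros)
  then show ?thesis using assms by (rule order_tendstoD)
qed

text \<open>At the lifetime itself the two one-sided limits come from different processes: the left
  one is that of \<open>Y\<close>, the right one that of \<open>Z\<close> at time 0, or the coffin
  if the coin fails. At every other time a single process governs a neighbourhood.\<close>

lemma rcll_glue:
  assumes y: "rcll (add_coffin X) (\<lambda>t. Y t \<omega>)" and z: "rcll (add_coffin X) (\<lambda>t. Z t \<omega>)"
  shows "rcll (add_coffin X) (\<lambda>t. glue Y B Z t \<omega>)"
  unfolding rcll_def
proof (intro conjI allI impI)
  let ?\<Lambda> = "lifetime (\<lambda>s. Y s \<omega>)"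
  let ?X = "add_coffin X"
  let ?v = "\<lambda>u. if B \<omega> then Z (u - real_of_ereal ?\<Lambda>) \<omega> else None"
  have nn: "0 \<le> ?\<Lambda>" unfolding lifetime_def by (rule Inf_greatest) auto
  {
    fix t :: real assume t: "0 \<le> t"
    show "limitin ?X (\<lambda>t. glue Y B Z t \<omega>) (glue Y B Z t \<omega>) (at_right t)"
    proof (cases "ereal t < ?\<Lambda>")
      case True
      have lim: "limitin ?X (\<lambda>t. Y t \<omega>) (Y t \<omega>) (at_right t)" using y t by (simp add: rcll_def)
      have "eventually (\<lambda>u. Y u \<omega> = glue Y B Z u \<omega>) (at_right t)"
        using eventually_ereal_less_at_right[OF True] by eventually_elim (simp add: glue_def)
      moreover have "glue Y B Z t \<omega> = Y t \<omega>" using True by (simp add: glue_def)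
      ultimately show ?thesis using limitin_transform_eventually[OF _ lim] by simp
    next
      case False
      then obtain c where c: "?\<Lambda> = ereal c" "0 \<le> c" "c \<le> t"
        using nn by (cases ?\<Lambda>) auto
      have lim: "limitin ?X ?v (?v t) (at_right t)"
      proof (cases "B \<omega>")
        case True
        have "limitin ?X (\<lambda>u. Z u \<omega>) (Z (t - c) \<omega>) (at_right (t - c))"
          using z c by (simp add: rcll_def)
        from limitin_shift_right[OF this] show ?thesis using True c by simp
      qed (simp add: topspace_add_coffin)
      have "eventually (\<lambda>u. ?v u = glue Y B Z u \<omega>) (at_right t)"
        using eventually_at_right_less[of t] by eventually_elim (use c in \<open>auto simp: glue_def\<close>)
      from limitin_transform_eventually[OF this lim]
      have "limitin ?X (\<lambda>u. glue Y B Z u \<omega>) (?v t) (at_right t)" .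
      moreover have "?v t = glue Y B Z t \<omega>" using c by (auto simp: glue_def)
      ultimately show ?thesis by (simp only:)
    qed
  next
    fix t :: real assume t: "0 < t"
    show "\<exists>l. limitin ?X (\<lambda>t. glue Y B Z t \<omega>) l (at_left t)"
    proof (cases "ereal t \<le> ?\<Lambda>")
      case True
      obtain l where l: "limitin ?X (\<lambda>t. Y t \<omega>) l (at_left t)" using y t by (auto simp: rcll_def)
      have "eventually (\<lambda>u. Y u \<omega> = glue Y B Z u \<omega>) (at_left t)"
        using eventually_at_left_real[OF t]
      proof eventually_elim
        case (elim u)
        then have "ereal u < ereal t" by simp
        then have "ereal u < ?\<Lambda>" using True by (rule less_le_trans)
        then show ?case by (simp add: glue_def)
      qed
      from limitin_transform_eventually[OF this l] show ?thesis by blast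
    next
      case False
      then obtain c where c: "?\<Lambda> = ereal c" "0 \<le> c" "c < t"
        using nn by (cases ?\<Lambda>) auto
      have "\<exists>l. limitin ?X ?v l (at_left t)"
      proof (cases "B \<omega>")
        case True
        have "\<exists>l. limitin ?X (\<lambda>u. Z u \<omega>) l (at_left (t - c))"
          using z c by (simp add: rcll_def)
        then obtain l where "limitin ?X (\<lambda>u. Z u \<omega>) l (at_left (t - c))" ..
        from limitin_shift_left[OF this] show ?thesis using True c by auto
      next
        case False
        then have "limitin ?X ?v None (at_left t)" by (simp add: topspace_add_coffin)
        then show ?thesis by blast
      qed
      then obtain l where l: "limitin ?X ?v l (at_left t)" ..
      have "eventually (\<lambda>u. ?v u = glue Y B Z u \<omega>) (at_left t)"
        using eventually_at_left_real[OF c(3)] by eventually_elim (use c in \<open>auto simp: glue_def\<close>)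
      from limitin_transform_eventually[OF this l] show ?thesis by blast
    qed
  }
qed

lemma rcll_coffin_mono:
  "rcll (add_coffin (subtopology X S)) z \<Longrightarrow> S \<subseteq> S' \<Longrightarrow> rcll (add_coffin (subtopology X S')) z"
  unfolding rcll_def by (meson limitin_add_coffin_mono)

text \<open>A Riemann-type sum for (1 - b / a) times the integral of a exp (- a r) exp (- b
  (\<delta> - r)) over 0 \<le> r \<le> \<delta>. It is geometric with ratio exp (- h (a - b)) and
  can be summed exactly; only the quotient of (1 - exp (- h a)) / h by (1 - exp (- h (a - b))) / h
  remains, whose limit a / (a - b) cancels the prefactor.\<close>

lemma geometric_mixture_limit:
  fixes a b \<delta> :: real and h :: "nat \<Rightarrow> real"
  assumes ab: "0 < b" "b < a" and \<delta>: "0 < \<delta>"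
  defines "h \<equiv> \<lambda>n. \<delta> / real (Suc n)"
  shows "(\<lambda>n. (1 - b / a) * (\<Sum>k<Suc n. (exp (- (k * h n * a)) - exp (- (Suc k * h n * a))) *
    exp (- ((\<delta> - k * h n) * b)))) \<longlonglongrightarrow> exp (- (\<delta> * b)) - exp (- (\<delta> * a))"
proof -
  let ?c = "a - b"
  have c: "0 < ?c" using ab by simp
  have hpos: "0 < h n" for n using \<delta> by (simp add: h_def)
  have hN: "real (Suc n) * h n = \<delta>" for n by (simp add: h_def)
  have h0: "filterlim h (at 0) sequentially"
  proof (rule filterlim_atI)
    have "(\<lambda>n. \<delta> * inverse (real (Suc n))) \<longlonglongrightarrow> \<delta> * 0"
      by (intro tendsto_intros LIMSEQ_inverse_real_of_nat)
    then show "h \<longlonglongrightarrow> 0" by (simp add: h_def[abs_def] divide_inverse)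
    show "eventually (\<lambda>n. h n \<noteq> 0) sequentially" using hpos by (simp add: less_imp_neq[symmetric])
  qed
  have lim1: "(\<lambda>n. (1 - exp (- (h n * v))) / h n) \<longlonglongrightarrow> v" for v :: real
  proof -
    have "((\<lambda>x. 1 - exp (- (x * v))) has_real_derivative v) (at 0)"
      by (auto intro!: derivative_eq_intros)
    then have "((\<lambda>x. (1 - exp (- (x * v))) / x) \<longlongrightarrow> v) (at 0)" by (simp add: DERIV_def)
    then show ?thesis by (rule filterlim_compose[OF _ h0])
  qed
  have eq: "(1 - b / a) * (\<Sum>k<Suc n. (exp (- (k * h n * a)) - exp (- (Suc k * h n * a))) *
      exp (- ((\<delta> - k * h n) * b))) =
    (1 - b / a) * (exp (- (\<delta> * b)) - exp (- (\<delta> * a))) *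
      (((1 - exp (- (h n * a))) / h n) / ((1 - exp (- (h n * ?c))) / h n))" for n
  proof -
    define r where "r = exp (- (h n * ?c))"
    have r: "r \<noteq> 1" using hpos[of n] c by (simp add: r_def)
    have rk: "exp (- (real k * h n * ?c)) = r ^ k" for k
      by (simp add: r_def exp_of_nat_mult[symmetric] algebra_simps)
    have summand: "(exp (- (k * h n * a)) - exp (- (Suc k * h n * a))) * exp (- ((\<delta> - k * h n) * b)) =
        (1 - exp (- (h n * a))) * exp (- (\<delta> * b)) * r ^ k" for k :: nat
    proof -
      have 1: "exp (- (Suc k * h n * a)) = exp (- (k * h n * a)) * exp (- (h n * a))"
        unfolding exp_add[symmetric] by (simp add: algebra_simps)
      have 2: "exp (- (k * h n * a)) * exp (- ((\<delta> - k * h n) * b)) = exp (- (\<delta> * b)) * exp (- (real k * h n * ?c))"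
        unfolding exp_add[symmetric] by (simp add: algebra_simps)
      have "(exp (- (k * h n * a)) - exp (- (Suc k * h n * a))) * exp (- ((\<delta> - k * h n) * b)) =
          (1 - exp (- (h n * a))) * (exp (- (k * h n * a)) * exp (- ((\<delta> - k * h n) * b)))"
        unfolding 1 by (simp only: algebra_simps mult_1)
      then show ?thesis unfolding 2 rk by (simp only: mult.assoc)
    qed
    have rN: "r ^ Suc n = exp (- (\<delta> * ?c))" using rk[of "Suc n"] hN[of n] by (simp only:)
    have "(\<Sum>k<Suc n. (exp (- (k * h n * a)) - exp (- (Suc k * h n * a))) * exp (- ((\<delta> - k * h n) * b))) =
        (1 - exp (- (h n * a))) * exp (- (\<delta> * b)) * (\<Sum>k<Suc n. r ^ k)"
      unfolding summand sum_distrib_left ..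
    also have "(\<Sum>k<Suc n. r ^ k) = (1 - exp (- (\<delta> * ?c))) / (1 - r)"
      using sum_gp_strict[of r "Suc n"] r unfolding rN by simp
    also have "(1 - exp (- (h n * a))) * exp (- (\<delta> * b)) * ((1 - exp (- (\<delta> * ?c))) / (1 - r)) =
        (exp (- (\<delta> * b)) - exp (- (\<delta> * b)) * exp (- (\<delta> * ?c))) * ((1 - exp (- (h n * a))) / (1 - r))"
    proof -
      have "A * v * ((1 - y) / z) = (v - v * y) * (A / z)" for A v y z :: real
        unfolding times_divide_eq_right by (simp add: algebra_simps)
      then show ?thesis .
    qed
    also have "exp (- (\<delta> * b)) * exp (- (\<delta> * ?c)) = exp (- (\<delta> * a))"
      unfolding exp_add[symmetric] by (simp add: algebra_simps)
    also have "(1 - exp (- (h n * a))) / (1 - r) =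
        ((1 - exp (- (h n * a))) / h n) / ((1 - exp (- (h n * ?c))) / h n)"
      using hpos[of n] by (simp add: r_def)
    finally show ?thesis by (simp only: mult.assoc)
  qed
  have "(\<lambda>n. (1 - b / a) * (exp (- (\<delta> * b)) - exp (- (\<delta> * a))) *
      (((1 - exp (- (h n * a))) / h n) / ((1 - exp (- (h n * ?c))) / h n)))
    \<longlonglongrightarrow> (1 - b / a) * (exp (- (\<delta> * b)) - exp (- (\<delta> * a))) * (a / ?c)"
    using c by (intro tendsto_intros lim1) auto
  moreover have "(1 - b / a) * (exp (- (\<delta> * b)) - exp (- (\<delta> * a))) * (a / ?c) =
      exp (- (\<delta> * b)) - exp (- (\<delta> * a))"
    using ab by (simp add: field_simps)
  ultimately show ?thesis unfolding eq by simp
qed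

section \<open>Restarting a process at its lifetime\<close>

text \<open>\<open>a\<close> and \<open>b\<close> stand for 1 / G_1 and 1 / G_0: the rate at which
  \<open>Y\<close> dies, and the rate at which \<mu> decays under the semigroup of \<open>Z\<close>.
  The kernel identities are required along \<open>Y\<close> only, because they are available only at
  the points it occupies.\<close>

locale glued =
  Y: ray_process \<mu>' T d' D' i' M R' dens' Y "return (boundary_borel T) \<xi>" +
  Z: ray_process \<mu> T d D i0 M R dens Z \<mu>
  for \<mu>' T d' D' i' and M :: "'w measure" and R' dens' Y \<xi> and \<mu> d D i0 R dens Z +
  fixes B :: "'w \<Rightarrow> bool" and a b :: real
  assumes ab: "0 < b" "b < a"
    and R'_R: "R' \<subseteq> R"
    and \<xi>: "\<xi> \<in> R'"
    and survival: "\<And>s t. 0 \<le> s \<Longrightarrow> 0 \<le> t \<Longrightarrow>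
      AE \<omega> in M. lift (Y.P t (\<lambda>_. 1)) (Y s \<omega>) = lift (\<lambda>_. ennreal (exp (- (t * a)))) (Y s \<omega>)"
    and quasi_stationary: "\<And>t f. 0 < t \<Longrightarrow> f \<in> borel_measurable (boundary_borel T) \<Longrightarrow>
      (\<integral>\<^sup>+x. Z.P t f x \<partial>\<mu>) = ennreal (exp (- (t * b))) * (\<integral>\<^sup>+x. f x \<partial>\<mu>)"
    and decomposition: "\<And>s t f. 0 \<le> s \<Longrightarrow> 0 < t \<Longrightarrow> f \<in> borel_measurable (boundary_borel T) \<Longrightarrow>
      AE \<omega> in M. lift (Z.P t f) (Y s \<omega>) =
        lift (\<lambda>y. Y.P t f y + ennreal (exp (- (t * b)) - exp (- (t * a))) * (\<integral>\<^sup>+x. f x \<partial>\<mu>)) (Y s \<omega>)"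
    and B_sets: "{\<omega> \<in> space M. B \<omega>} \<in> sets M"
    and indep: "\<And>s u F H. 0 \<le> s \<Longrightarrow> 0 \<le> u \<Longrightarrow> F \<in> sets (Y.Pst s) \<Longrightarrow> H \<in> sets (Z.Pst u) \<Longrightarrow>
      emeasure M (F \<inter> {\<omega> \<in> space M. B \<omega>} \<inter> H) = emeasure M F * ennreal (1 - b / a) * emeasure M H"
    and sub: "\<And>t. 0 < t \<Longrightarrow> AE x in \<mu>. Z.P t (\<lambda>_. 1) x \<le> 1"
    and sub_\<xi>: "\<And>t. 0 < t \<Longrightarrow> Z.P t (\<lambda>_. 1) \<xi> \<le> 1"
begin

definition W :: "real \<Rightarrow> 'w \<Rightarrow> (nat \<Rightarrow> 'a) option" where
  "W = glue Y B Z"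

lemma W_alive: "\<omega> \<in> space M \<Longrightarrow> 0 \<le> t \<Longrightarrow> Y t \<omega> \<noteq> None \<Longrightarrow> W t \<omega> = Y t \<omega>"
  using Y.less_lifetime_iff by (simp add: W_def glue_def)

lemma W_dead:
  "\<omega> \<in> space M \<Longrightarrow> 0 \<le> t \<Longrightarrow> Y t \<omega> = None \<Longrightarrow>
    W t \<omega> = (if B \<omega> then Z (t - Y.L \<omega>) \<omega> else None)"
  using Y.less_lifetime_iff[of \<omega> t] by (simp add: W_def glue_def Y.L_def)

lemma W_rcll: "\<omega> \<in> space M \<Longrightarrow> rcll (add_coffin (subtopology (boundary_top T) R)) (\<lambda>t. W t \<omega>)"
  unfolding W_def by (rule rcll_glue[OF rcll_coffin_mono[OF Y.W_rcll R'_R] Z.W_rcll])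

lemma W_absorbed:
  assumes \<omega>: "\<omega> \<in> space M" and s: "0 \<le> s" "s \<le> t" and dead: "W s \<omega> = None"
  shows "W t \<omega> = None"
proof -
  have t: "0 \<le> t" using s by simp
  have Ys: "Y s \<omega> = None" using W_alive[OF \<omega> s(1)] dead by (cases "Y s \<omega>") auto
  then have Yt: "Y t \<omega> = None" by (rule Y.W_absorbed[OF \<omega> s])
  have L: "Y.L \<omega> \<le> s" using Y.lifetime_eq_L(3)[OF \<omega> s(1) Ys] .
  show ?thesis
  proof (cases "B \<omega>")
    case True
    then have "Z (s - Y.L \<omega>) \<omega> = None" using W_dead[OF \<omega> s(1) Ys] dead by simp
    then have "Z (t - Y.L \<omega>) \<omega> = None" by (rule Z.W_absorbed[OF \<omega>, rotated 2]) (use L s in auto)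
    then show ?thesis using W_dead[OF \<omega> t Yt] by simp
  qed (simp add: W_dead[OF \<omega> t Yt])
qed

lemma W_range:
  assumes \<omega>: "\<omega> \<in> space M" and t: "0 \<le> t"
  shows "W t \<omega> \<in> insert None (Some ` R)"
proof (cases "Y t \<omega> = None")
  case True
  have "0 \<le> t - Y.L \<omega>" using Y.lifetime_eq_L(3)[OF \<omega> t True] by simp
  then show ?thesis using Z.W_range[OF _ \<omega>] W_dead[OF \<omega> t True] by simp
next
  case False
  then show ?thesis using Y.W_range[OF t \<omega>] W_alive[OF \<omega> t] R'_R by auto
qed

definition restart_hits :: "(real \<times> 'a) list \<Rightarrow> 'w set" where
  "restart_hits l = {\<omega> \<in> space M. B \<omega> \<and> (\<forall>(t, i)\<in>set l. Z (t - Y.L \<omega>) \<omega> \<in> Some ` boundary_at T i)}"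

definition shift_back :: "real \<Rightarrow> (real \<times> 'a) list \<Rightarrow> (real \<times> 'a) list" where
  "shift_back c l = map (\<lambda>(t, i). (t - c, i)) l"

lemma emeasure_alive:
  assumes s: "0 \<le> s" and u: "0 \<le> u" and F: "F \<in> sets (Y.Pst s)" "\<forall>\<omega>\<in>F. Y s \<omega> \<noteq> None"
  shows "emeasure M (F \<inter> {\<omega> \<in> space M. Y (s + u) \<omega> \<noteq> None}) = ennreal (exp (- (u * a))) * emeasure M F"
proof -
  have FM: "F \<in> sets M" using F Y.sets_Pst_sub by auto
  have sb: "0 \<le> s + u" using s u by simp
  have alive: "{\<omega> \<in> space M. Y (s + u) \<omega> \<noteq> None} \<in> sets M"
    using Y.alive_in_Pst[OF sb order.refl] Y.sets_Pst_sub by auto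
  have "emeasure M (F \<inter> {\<omega> \<in> space M. Y (s + u) \<omega> \<noteq> None}) =
      (\<integral>\<^sup>+\<omega>. lift (\<lambda>_. 1) (Y (s + u) \<omega>) * indicator F \<omega> \<partial>M)"
  proof -
    have "(\<integral>\<^sup>+\<omega>. lift (\<lambda>_. 1) (Y (s + u) \<omega>) * indicator F \<omega> \<partial>M) =
        (\<integral>\<^sup>+\<omega>. indicator (F \<inter> {\<omega> \<in> space M. Y (s + u) \<omega> \<noteq> None}) \<omega> \<partial>M)"
      by (rule nn_integral_cong) (auto simp: lift_def indicator_def split: option.split)
    then show ?thesis using FM alive by simp
  qed
  also have "\<dots> = (\<integral>\<^sup>+\<omega>. lift (Y.P (s + u - s) (\<lambda>_. 1)) (Y s \<omega>) * indicator F \<omega> \<partial>M)"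
    by (rule Y.markov_integral[OF s _ F(1)]) (use u in auto)
  also have "\<dots> = (\<integral>\<^sup>+\<omega>. ennreal (exp (- (u * a))) * indicator F \<omega> \<partial>M)"
  proof (rule nn_integral_cong_AE)
    show "AE \<omega> in M. lift (Y.P (s + u - s) (\<lambda>_. 1)) (Y s \<omega>) * indicator F \<omega> =
        ennreal (exp (- (u * a))) * indicator F \<omega>"
      using survival[OF s u]
    proof eventually_elim
      case (elim \<omega>)
      show ?case
      proof (cases "\<omega> \<in> F")
        case True
        then obtain y where "Y s \<omega> = Some y" using F(2) by blast
        then show ?thesis using elim by simp
      qed simp
    qed
  qed
  also have "\<dots> = ennreal (exp (- (u * a))) * emeasure M F"
    using FM by (rule nn_integral_cmult_indicator)
  finally show ?thesis .
qed

lemma emeasure_dies_between: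
  assumes s: "0 \<le> s" and u: "0 \<le> u" "u \<le> v" and F: "F \<in> sets (Y.Pst s)" "\<forall>\<omega>\<in>F. Y s \<omega> \<noteq> None"
  shows "emeasure M (F \<inter> {\<omega> \<in> space M. Y (s + u) \<omega> \<noteq> None \<and> Y (s + v) \<omega> = None}) =
    ennreal (exp (- (u * a)) - exp (- (v * a))) * emeasure M F"
proof -
  have v: "0 \<le> v" using u by simp
  let ?A = "\<lambda>u. F \<inter> {\<omega> \<in> space M. Y (s + u) \<omega> \<noteq> None}"
  have FM: "F \<in> sets M" using F Y.sets_Pst_sub by auto
  have A: "?A u \<in> sets M" if "0 \<le> u" for u
  proof -
    have "0 \<le> s + u" using s that by simp
    then show ?thesis using FM Y.alive_in_Pst[OF _ order.refl, of "s + u"] Y.sets_Pst_sub by blast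
  qed
  have sub: "?A v \<subseteq> ?A u"
  proof
    fix \<omega> assume \<omega>: "\<omega> \<in> ?A v"
    then have "\<omega> \<in> space M" "Y (s + v) \<omega> \<noteq> None" by auto
    then have "Y (s + u) \<omega> \<noteq> None" using Y.W_absorbed[of \<omega> "s + u" "s + v"] s u
      by (cases "Y (s + u) \<omega>") auto
    then show "\<omega> \<in> ?A u" using \<omega> by blast
  qed
  have "F \<inter> {\<omega> \<in> space M. Y (s + u) \<omega> \<noteq> None \<and> Y (s + v) \<omega> = None} = ?A u - ?A v" by auto
  also have "emeasure M \<dots> = emeasure M (?A u) - emeasure M (?A v)"
    by (rule emeasure_Diff[OF _ A[OF u(1)] A[OF v] sub]) simp
  also have "\<dots> = ennreal (exp (- (u * a))) * emeasure M F - ennreal (exp (- (v * a))) * emeasure M F"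
    using emeasure_alive[OF s u(1) F] emeasure_alive[OF s v F] by simp
  also have "\<dots> = ennreal (exp (- (u * a)) - exp (- (v * a))) * emeasure M F"
  proof -
    have e: "0 \<le> exp (- (u * a)) - exp (- (v * a))" using u ab by (simp add: mult_right_mono)
    have "ennreal (exp (- (u * a))) * ennreal m - ennreal (exp (- (v * a))) * ennreal m =
        ennreal (exp (- (u * a)) - exp (- (v * a))) * ennreal m" if "0 \<le> m" for m
      using that e by (simp only: ennreal_mult[symmetric] exp_ge_zero ennreal_minus mult_nonneg_nonneg
          left_diff_distrib)
    then show ?thesis by (simp only: Y.M.emeasure_eq_measure measure_nonneg)
  qed
  finally show ?thesis .
qed

text \<open>By quasi-stationarity the delay v before the first prescribed time contributes only the
  factor exp (- (v * b)). The remaining integral depends on c + v alone, so it is the same for all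
  restart times c with a fixed first target time.\<close>

lemma emeasure_shift_back_hits:
  assumes v: "0 < v" and l: "sorted (map fst ((c + v, i) # l))" "set ((c + v, i) # l) \<subseteq> UNIV \<times> sites T"
  shows "emeasure M (hits T (space M) Z (shift_back c ((c + v, i) # l))) =
    ennreal (exp (- (v * b))) * (\<integral>\<^sup>+x. indicator (boundary_at T i) x * Z.\<Phi> (c + v) l (\<lambda>_. 1) x \<partial>\<mu>)"
proof -
  let ?l = "shift_back c ((c + v, i) # l)"
  let ?h = "\<lambda>x. indicator (boundary_at T i) x * Z.\<Phi> (c + v) l (\<lambda>_. 1) x"
  have i: "i \<in> sites T" using l by simp
  have h: "?h \<in> borel_measurable (boundary_borel T)"
    using l by (intro borel_measurable_times_ennreal borel_measurable_indicator
        boundary_at_in_sets[OF Y.tree i] Z.\<Phi>_measurable) auto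
  have "Z.\<Phi> (v + c) (map (\<lambda>(t, i). (t + c, i)) (shift_back c l)) (\<lambda>_. 1) = Z.\<Phi> v (shift_back c l) (\<lambda>_. 1)"
    by (rule Z.\<Phi>_shift)
  moreover have "map (\<lambda>(t, i). (t + c, i)) (shift_back c l) = l"
    unfolding shift_back_def by (induction l) auto
  ultimately have sh: "Z.\<Phi> v (shift_back c l) (\<lambda>_. 1) = Z.\<Phi> (c + v) l (\<lambda>_. 1)"
    by (simp add: add.commute)
  have ge: "c + v \<le> fst x" if "x \<in> set l" for x using l(1) that by auto
  have srt: "sorted (map fst ?l)"
  proof -
    have "map fst ?l = map (\<lambda>x. fst x - c) ((c + v, i) # l)"
      unfolding shift_back_def by auto
    moreover have "sorted (map (\<lambda>x. fst x - c) ((c + v, i) # l))"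
      using l(1) unfolding sorted_map by simp
    ultimately show ?thesis by simp
  qed
  have "emeasure M (hits T (space M) Z ?l) = (\<integral>\<^sup>+x. Z.\<Phi> 0 ?l (\<lambda>_. 1) x \<partial>\<mu>)"
  proof (rule Z.emeasure_hits_initial[OF Z.sets_\<mu> Z.R_full srt])
    show "set ?l \<subseteq> {0..} \<times> sites T"
    proof
      fix x assume "x \<in> set ?l"
      then obtain p where p: "p \<in> set ((c + v, i) # l)" "x = (\<lambda>(t, i). (t - c, i)) p"
        unfolding shift_back_def set_map by (elim imageE)
      obtain t j where "p = (t, j)" by force
      with p have tj: "(t, j) \<in> set ((c + v, i) # l)" "x = (t - c, j)" by simp_all
      then have "c + v \<le> t" using ge[of "(t, j)"] by auto
      moreover have "j \<in> sites T" using tj(1) l(2) by blast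
      ultimately show "x \<in> {0..} \<times> sites T" using tj(2) v by simp
    qed
  qed
  also have "\<dots> = (\<integral>\<^sup>+x. Z.P v ?h x \<partial>\<mu>)"
    by (simp add: shift_back_def sh[unfolded shift_back_def])
  also have "\<dots> = ennreal (exp (- (v * b))) * (\<integral>\<^sup>+x. ?h x \<partial>\<mu>)"
    by (rule quasi_stationary[OF v h])
  finally show ?thesis .
qed

text \<open>
  The lifetime of \<open>Y\<close> is approximated from below by the grid of mesh \<open>step n\<close>; cells being clopen,
  right-continuity of \<open>Z\<close> makes the restarted process hit the same cells at the approximate times as
  at the exact ones once the mesh is small.
\<close>

context
  fixes s t F i l
  assumes s: "0 \<le> s" and st: "s < t" and F: "F \<in> sets (Y.Pst s)" "\<forall>\<omega>\<in>F. Y s \<omega> \<noteq> None"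
    and l: "sorted (map fst ((t, i) # l))" "set ((t, i) # l) \<subseteq> UNIV \<times> sites T"
begin

definition step :: "nat \<Rightarrow> real" where
  "step n = (t - s) / real (Suc n)"

definition died_in :: "nat \<Rightarrow> nat \<Rightarrow> 'w set" where
  "died_in n k = F \<inter> {\<omega> \<in> space M. Y (s + k * step n) \<omega> \<noteq> None \<and> Y (s + Suc k * step n) \<omega> = None}"

definition approx :: "nat \<Rightarrow> 'w set" where
  "approx n = (\<Union>k<Suc n. died_in n k \<inter> {\<omega> \<in> space M. B \<omega>} \<inter>
    hits T (space M) Z (shift_back (s + k * step n) ((t, i) # l)))"

definition crossing :: "'w set" where
  "crossing = F \<inter> {\<omega> \<in> space M. Y t \<omega> = None} \<inter> restart_hits ((t, i) # l)"

lemma step_pos: "0 < step n"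
  using st by (simp add: step_def)

lemma step_sum: "s + Suc n * step n = t"
  by (simp add: step_def)

lemma step_le: "k < Suc n \<Longrightarrow> s + Suc k * step n \<le> t"
  using step_sum[of n] step_pos[of n] by (smt (verit) Suc_leI mult_right_mono of_nat_mono)

lemma step_tendsto: "step \<longlonglongrightarrow> 0"
proof -
  have "(\<lambda>n. (t - s) * inverse (real (Suc n))) \<longlonglongrightarrow> (t - s) * 0"
    by (intro tendsto_intros LIMSEQ_inverse_real_of_nat)
  then show ?thesis by (simp add: step_def[abs_def] divide_inverse)
qed

lemma times_ge: "(u, j) \<in> set ((t, i) # l) \<Longrightarrow> t \<le> u \<and> j \<in> sites T"
  using l by auto

lemma died_in_iff:
  assumes \<omega>: "\<omega> \<in> F" "\<omega> \<in> space M" "Y t \<omega> = None" and k: "k < Suc n"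
  shows "\<omega> \<in> died_in n k \<longleftrightarrow> s + k * step n < Y.L \<omega> \<and> Y.L \<omega> \<le> s + Suc k * step n"
proof -
  have t: "0 \<le> t" using s st by simp
  have 1: "0 \<le> s + k * step n" "0 \<le> s + Suc k * step n" using s step_pos[of n] by auto
  show ?thesis unfolding died_in_def
    using Y.less_L_iff[OF \<omega>(2) t \<omega>(3) 1(1)] Y.less_L_iff[OF \<omega>(2) t \<omega>(3) 1(2)] \<omega> by (auto simp: not_less)
qed

lemma approx_eventually:
  assumes \<omega>: "\<omega> \<in> space M"
  shows "eventually (\<lambda>n. \<omega> \<in> approx n \<longleftrightarrow> \<omega> \<in> crossing) sequentially"
proof (cases "\<omega> \<in> F \<and> Y t \<omega> = None \<and> B \<omega>")
  case False
  have "\<omega> \<notin> approx n" for n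
  proof
    assume "\<omega> \<in> approx n"
    then obtain k where k: "k < Suc n" "\<omega> \<in> died_in n k" "B \<omega>" unfolding approx_def by auto
    then have "\<omega> \<in> F" "Y (s + Suc k * step n) \<omega> = None" by (auto simp: died_in_def)
    moreover have "0 \<le> s + Suc k * step n" using s step_pos[of n] by simp
    ultimately have "Y t \<omega> = None" using Y.W_absorbed[OF \<omega> _ step_le[OF k(1)]] by blast
    then show False using False k \<open>\<omega> \<in> F\<close> by simp
  qed
  moreover have "\<omega> \<notin> crossing" using False by (auto simp: crossing_def restart_hits_def)
  ultimately show ?thesis by simp
next
  case True
  have t: "0 \<le> t" using s st by simp
  note L = Y.lifetime_eq_L(2,3)[OF \<omega> t]
  have Lt: "Y.L \<omega> \<le> t" using L True by simp
  have sL: "s < Y.L \<omega>" using Y.less_L_iff[OF \<omega> t conjunct1[OF conjunct2[OF True]] s] True F(2) by simp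
  \<comment> \<open>The property asks that, for each of the finitely many entries, membership of
    \<open>Z\<close> in the prescribed cell stay constant for a duration e after the exact restarted
    time.\<close>
  let ?ok = "\<lambda>e. \<forall>(u, j)\<in>set ((t, i) # l). \<forall>v. u - Y.L \<omega> < v \<longrightarrow> v < u - Y.L \<omega> + e \<longrightarrow>
    (Z v \<omega> \<in> Some ` boundary_at T j \<longleftrightarrow> Z (u - Y.L \<omega>) \<omega> \<in> Some ` boundary_at T j)"
  obtain e where e: "0 < e" "?ok e"
  proof -
    have "\<forall>p\<in>set ((t, i) # l). eventually (\<lambda>e. \<forall>v. fst p - Y.L \<omega> < v \<longrightarrow> v < fst p - Y.L \<omega> + e \<longrightarrow>
      (Z v \<omega> \<in> Some ` boundary_at T (snd p) \<longleftrightarrow> Z (fst p - Y.L \<omega>) \<omega> \<in> Some ` boundary_at T (snd p))) (at_right 0)"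
    proof
      fix p assume "p \<in> set ((t, i) # l)"
      then have p: "t \<le> fst p" "snd p \<in> sites T" using times_ge[of "fst p" "snd p"] by simp_all
      have "eventually (\<lambda>v. Z v \<omega> \<in> Some ` boundary_at T (snd p) \<longleftrightarrow>
          Z (fst p - Y.L \<omega>) \<omega> \<in> Some ` boundary_at T (snd p)) (at_right (fst p - Y.L \<omega>))"
        using Lt p by (intro Z.hits_eventually[OF \<omega>]) auto
      then obtain c where c: "fst p - Y.L \<omega> < c" "\<And>v. fst p - Y.L \<omega> < v \<Longrightarrow> v < c \<Longrightarrow>
          (Z v \<omega> \<in> Some ` boundary_at T (snd p) \<longleftrightarrow> Z (fst p - Y.L \<omega>) \<omega> \<in> Some ` boundary_at T (snd p))"
        unfolding eventually_at_right_field by blast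
      show "eventually (\<lambda>e. \<forall>v. fst p - Y.L \<omega> < v \<longrightarrow> v < fst p - Y.L \<omega> + e \<longrightarrow>
        (Z v \<omega> \<in> Some ` boundary_at T (snd p) \<longleftrightarrow> Z (fst p - Y.L \<omega>) \<omega> \<in> Some ` boundary_at T (snd p))) (at_right 0)"
        unfolding eventually_at_right_field
        by (intro exI[of _ "c - (fst p - Y.L \<omega>)"]) (use c in auto)
    qed
    then have "eventually (\<lambda>e. \<forall>p\<in>set ((t, i) # l). \<forall>v. fst p - Y.L \<omega> < v \<longrightarrow> v < fst p - Y.L \<omega> + e \<longrightarrow>
      (Z v \<omega> \<in> Some ` boundary_at T (snd p) \<longleftrightarrow> Z (fst p - Y.L \<omega>) \<omega> \<in> Some ` boundary_at T (snd p))) (at_right 0)"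
      by (intro eventually_ball_finite) auto
    moreover have "eventually (\<lambda>e::real. 0 < e) (at_right 0)" by (rule eventually_at_right_less)
    ultimately have "eventually (\<lambda>e. 0 < e \<and> ?ok e) (at_right (0::real))"
      by eventually_elim (simp add: split_beta')
    then have "\<exists>e. 0 < e \<and> ?ok e" by (rule eventually_happens'[rotated]) simp
    then show ?thesis using that by blast
  qed
  have "eventually (\<lambda>n. step n < e) sequentially"
    using step_tendsto e(1) by (rule order_tendstoD)
  then show ?thesis
  proof eventually_elim
    case (elim n)
    \<comment> \<open>Replacing the lifetime by the grid point before it moves each restarted time
      forward by a positive amount of at most one mesh, hence by less than e.\<close>
    have key: "\<omega> \<in> hits T (space M) Z (shift_back (s + k * step n) ((t, i) # l)) \<longleftrightarrow>
        \<omega> \<in> restart_hits ((t, i) # l)" if k: "s + k * step n < Y.L \<omega>" "Y.L \<omega> \<le> s + Suc k * step n" for k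
    proof -
      have near: "u - Y.L \<omega> < u - (s + k * step n)" "u - (s + k * step n) < u - Y.L \<omega> + e" for u
      proof -
        have "s + Suc k * step n = s + k * step n + step n" by (simp add: algebra_simps)
        then show "u - Y.L \<omega> < u - (s + k * step n)" "u - (s + k * step n) < u - Y.L \<omega> + e"
          using k elim by auto
      qed
      have "Z (u - (s + k * step n)) \<omega> \<in> Some ` boundary_at T j \<longleftrightarrow> Z (u - Y.L \<omega>) \<omega> \<in> Some ` boundary_at T j"
        if "(u, j) \<in> set ((t, i) # l)" for u j
        using bspec[OF e(2) that] near[of u] by simp
      then show ?thesis using True \<omega>
        unfolding hits_def restart_hits_def shift_back_def set_map by (auto simp: split_beta')
    qed
    \<comment> \<open>The grid intervals are open on the left and closed on the right, so the index
      is the ceiling minus 1.\<close>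
    define k where "k = nat (\<lceil>(Y.L \<omega> - s) / step n\<rceil> - 1)"
    have kk: "s + k * step n < Y.L \<omega>" "Y.L \<omega> \<le> s + Suc k * step n" "k < Suc n"
    proof -
      have pos: "0 < (Y.L \<omega> - s) / step n" using sL step_pos[of n] by simp
      then have c: "1 \<le> \<lceil>(Y.L \<omega> - s) / step n\<rceil>" by simp
      then have k1: "real k = of_int \<lceil>(Y.L \<omega> - s) / step n\<rceil> - 1" unfolding k_def by simp
      have "real k < (Y.L \<omega> - s) / step n" "(Y.L \<omega> - s) / step n \<le> real k + 1"
        unfolding k1 by linarith+
      then show A: "s + k * step n < Y.L \<omega>" and "Y.L \<omega> \<le> s + Suc k * step n"
        using step_pos[of n] by (auto simp: field_simps)
      have "s + k * step n < s + Suc n * step n" using A Lt step_sum[of n] by simp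
      then show "k < Suc n" using step_pos[of n] by simp
    qed
    show ?case
    proof
      assume "\<omega> \<in> approx n"
      then obtain k where k: "k < Suc n" "\<omega> \<in> died_in n k"
        "\<omega> \<in> hits T (space M) Z (shift_back (s + k * step n) ((t, i) # l))"
        unfolding approx_def by blast
      have "s + k * step n < Y.L \<omega> \<and> Y.L \<omega> \<le> s + Suc k * step n"
        using died_in_iff[OF _ \<omega> _ k(1)] True k(2) by simp
      then have "\<omega> \<in> restart_hits ((t, i) # l)" using key k(3) by simp
      then show "\<omega> \<in> crossing" using True \<omega> by (simp add: crossing_def)
    next
      assume "\<omega> \<in> crossing"
      then have "\<omega> \<in> restart_hits ((t, i) # l)" by (simp add: crossing_def)
      then have "\<omega> \<in> hits T (space M) Z (shift_back (s + k * step n) ((t, i) # l))" using key[OF kk(1,2)] by blast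
      moreover have "\<omega> \<in> died_in n k" using died_in_iff[OF _ \<omega> _ kk(3)] kk True by simp
      ultimately show "\<omega> \<in> approx n" unfolding approx_def using kk(3) True \<omega> by blast
    qed
  qed
qed

lemma died_in_sets: "died_in n k \<in> sets (Y.Pst (s + Suc k * step n))"
proof -
  have 1: "0 \<le> s + k * step n" "s + k * step n \<le> s + Suc k * step n" "s \<le> s + Suc k * step n"
    "0 \<le> s + Suc k * step n"
    using s step_pos[of n] by (auto simp: mult_right_mono)
  have "died_in n k = F \<inter> {\<omega> \<in> space M. Y (s + k * step n) \<omega> \<noteq> None} -
      {\<omega> \<in> space M. Y (s + Suc k * step n) \<omega> \<noteq> None}"
    unfolding died_in_def by auto
  also have "\<dots> \<in> sets (Y.Pst (s + Suc k * step n))"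
    using F(1) Y.Pst_mono[OF 1(3)] Y.alive_in_Pst[OF 1(1,2)] Y.alive_in_Pst[OF 1(4) order.refl] by blast
  finally show ?thesis .
qed

lemma shift_back_sets:
  assumes k: "k < Suc n"
  shows "\<exists>u\<ge>0. hits T (space M) Z (shift_back (s + k * step n) ((t, i) # l)) \<in> sets (Z.Pst u)"
proof -
  let ?l = "shift_back (s + k * step n) ((t, i) # l)"
  let ?u = "Max (insert 0 (fst ` set ?l))"
  have "0 \<le> ?u" by (rule Max_ge) auto
  moreover have "hits T (space M) Z ?l \<in> sets (Z.Pst ?u)"
  proof (rule Z.hits_in_Pst[OF _ \<open>0 \<le> ?u\<close>])
    show "set ?l \<subseteq> {0..?u} \<times> sites T"
    proof
      fix x assume x: "x \<in> set ?l"
      then obtain p where p: "p \<in> set ((t, i) # l)" "x = (\<lambda>(v, j). (v - (s + k * step n), j)) p"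
        unfolding shift_back_def set_map by (elim imageE)
      obtain v j where "p = (v, j)" by force
      with p have v: "(v, j) \<in> set ((t, i) # l)" "x = (v - (s + k * step n), j)" by simp_all
      have "s + k * step n \<le> s + Suc k * step n" using step_pos[of n] by (simp add: mult_right_mono)
      then have "0 \<le> fst x" "snd x \<in> sites T" using times_ge[OF v(1)] step_le[OF k] v(2) by auto
      moreover have "fst x \<le> ?u" using x by (intro Max_ge) auto
      ultimately show "x \<in> {0..?u} \<times> sites T" by (cases x) auto
    qed
  qed
  ultimately show ?thesis by blast
qed

lemma approx_piece_sets:
  "k < Suc n \<Longrightarrow> died_in n k \<inter> {\<omega> \<in> space M. B \<omega>} \<inter>
    hits T (space M) Z (shift_back (s + k * step n) ((t, i) # l)) \<in> sets M"
  using died_in_sets[of n k] Y.sets_Pst_sub shift_back_sets[of k n] Z.sets_Pst_sub B_sets by blast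

lemma approx_sets: "approx n \<in> sets M"
  unfolding approx_def using approx_piece_sets by (intro sets.finite_UN) auto

text \<open>The event involves \<open>Z\<close> at a random time, so its measurability is not
  immediate. Membership in the approximations is eventually that in the event, which is therefore
  their limit inferior.\<close>

lemma crossing_sets: "crossing \<in> sets M"
proof -
  have sub: "crossing \<subseteq> space M" by (auto simp: crossing_def restart_hits_def)
  have "crossing = (\<Union>n. \<Inter>m\<in>{n..}. approx m)"
  proof (intro set_eqI iffI)
    fix \<omega> assume \<omega>: "\<omega> \<in> crossing"
    then have "eventually (\<lambda>n. \<omega> \<in> approx n) sequentially"
      using approx_eventually[of \<omega>] sub by auto
    then show "\<omega> \<in> (\<Union>n. \<Inter>m\<in>{n..}. approx m)" by (auto simp: eventually_sequentially)
  next
    fix \<omega> assume "\<omega> \<in> (\<Union>n. \<Inter>m\<in>{n..}. approx m)"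
    then have ev: "eventually (\<lambda>n. \<omega> \<in> approx n) sequentially" by (auto simp: eventually_sequentially)
    then obtain n where "\<omega> \<in> approx n" using eventually_happens'[OF sequentially_bot ev] by blast
    then have "\<omega> \<in> space M" using sets.sets_into_space[OF approx_sets] by blast
    from eventually_conj[OF ev approx_eventually[OF this]]
    have "eventually (\<lambda>n. \<omega> \<in> crossing) sequentially" by eventually_elim blast
    then show "\<omega> \<in> crossing" by simp
  qed
  also have "\<dots> \<in> sets M"
    by (intro sets.countable_UN'' sets.countable_INT') (auto simp: approx_sets)
  finally show ?thesis .
qed

lemma approx_tendsto: "(\<lambda>n. emeasure M (approx n)) \<longlonglongrightarrow> emeasure M crossing"
proof -
  have "(\<lambda>n. \<integral>\<^sup>+\<omega>. indicator (approx n) \<omega> \<partial>M) \<longlonglongrightarrow> (\<integral>\<^sup>+\<omega>. indicator crossing \<omega> \<partial>M)"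
  proof (rule nn_integral_dominated_convergence[where w="\<lambda>_. 1"])
    show "AE \<omega> in M. (\<lambda>n. indicator (approx n) \<omega> :: ennreal) \<longlonglongrightarrow> indicator crossing \<omega>"
    proof (rule AE_I2)
      fix \<omega> assume "\<omega> \<in> space M"
      from approx_eventually[OF this]
      have "eventually (\<lambda>n. indicator (approx n) \<omega> = (indicator crossing \<omega> :: ennreal)) sequentially"
        by eventually_elim (simp add: indicator_def)
      then show "(\<lambda>n. indicator (approx n) \<omega> :: ennreal) \<longlonglongrightarrow> indicator crossing \<omega>"
        by (rule tendsto_eventually)
    qed
  qed (auto simp: approx_sets crossing_sets Y.M.emeasure_space_1 intro!: borel_measurable_indicator
      split: split_indicator)
  then show ?thesis by (simp add: approx_sets crossing_sets)
qed

text \<open>For each grid interval, independence factors the probability into death of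
  \<open>Y\<close> in the interval, success of the coin, and the cell hits of \<open>Z\<close>
  shifted by a deterministic time. All intervals share the same integral, so the sum is a scalar
  mixture with a known limit.\<close>

lemma emeasure_crossing:
  "emeasure M crossing = emeasure M F * (ennreal (exp (- ((t - s) * b)) - exp (- ((t - s) * a))) *
    (\<integral>\<^sup>+x. indicator (boundary_at T i) x * Z.\<Phi> t l (\<lambda>_. 1) x \<partial>\<mu>))"
proof -
  let ?J = "\<integral>\<^sup>+x. indicator (boundary_at T i) x * Z.\<Phi> t l (\<lambda>_. 1) x \<partial>\<mu>"
  define \<delta> where "\<delta> = t - s"
  have \<delta>: "0 < \<delta>" using st by (simp add: \<delta>_def)
  define S where "S n = (1 - b / a) * (\<Sum>k<Suc n. (exp (- (k * step n * a)) - exp (- (Suc k * step n * a))) *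
    exp (- ((\<delta> - k * step n) * b)))" for n
  have S_lim: "S \<longlonglongrightarrow> exp (- (\<delta> * b)) - exp (- (\<delta> * a))"
    using geometric_mixture_limit[OF ab \<delta>] unfolding S_def[abs_def] step_def \<delta>_def .
  have ba: "0 \<le> 1 - b / a" using ab by simp
  have hitsk: "emeasure M (hits T (space M) Z (shift_back (s + k * step n) ((t, i) # l))) =
      ennreal (exp (- ((\<delta> - k * step n) * b))) * ?J" if k: "k < Suc n" for k n
  proof -
    have "s + k * step n < s + Suc k * step n" using step_pos[of n] by simp
    then have v: "0 < \<delta> - k * step n" using step_le[OF k] unfolding \<delta>_def by linarith
    have eq: "s + k * step n + (\<delta> - k * step n) = t" by (simp add: \<delta>_def)
    show ?thesis using emeasure_shift_back_hits[OF v, of "s + k * step n" i l] l unfolding eq by simp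
  qed
  \<comment> \<open>Multiplication in \<open>ennreal\<close> is continuous only for a finite factor.
    Finiteness is read off from the coarsest grid, where the integral times a positive number is a
    probability.\<close>
  have fin: "?J \<noteq> \<infinity>"
  proof
    assume inf: "?J = \<infinity>"
    have "emeasure M (hits T (space M) Z (shift_back (s + 0 * step 0) ((t, i) # l))) = \<infinity>"
      using hitsk[of 0 0] inf by (simp add: ennreal_mult_top)
    then show False by simp
  qed
  have approx_em: "emeasure M (approx n) = emeasure M F * (ennreal (S n) * ?J)" for n
  proof -
    let ?A = "\<lambda>k. died_in n k \<inter> {\<omega> \<in> space M. B \<omega>} \<inter>
      hits T (space M) Z (shift_back (s + k * step n) ((t, i) # l))"
    have disj: "disjoint_family_on ?A {..<Suc n}"
    proof -
      have no: False if km: "k < m" and k: "\<omega> \<in> died_in n k" and m: "\<omega> \<in> died_in n m" for k m \<omega>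
      proof -
        have "\<omega> \<in> space M" "Y (s + Suc k * step n) \<omega> = None" "Y (s + m * step n) \<omega> \<noteq> None"
          using k m by (auto simp: died_in_def)
        moreover have "0 \<le> s + Suc k * step n" using s step_pos[of n] by simp
        moreover have "s + Suc k * step n \<le> s + m * step n"
          using km step_pos[of n] by (intro add_left_mono mult_right_mono of_nat_mono) auto
        ultimately show False using Y.W_absorbed[of \<omega> "s + Suc k * step n" "s + m * step n"] by simp
      qed
      show ?thesis unfolding disjoint_family_on_def
      proof (intro ballI impI)
        fix k m :: nat assume "k \<noteq> m"
        then have "k < m \<or> m < k" by linarith
        then have "died_in n k \<inter> died_in n m = {}" using no by blast
        then show "?A k \<inter> ?A m = {}" by blast
      qed
    qed
    have piece: "emeasure M (?A k) = emeasure M F * (ennreal ((1 - b / a) *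
        ((exp (- (k * step n * a)) - exp (- (Suc k * step n * a))) * exp (- ((\<delta> - k * step n) * b)))) * ?J)"
      if k: "k < Suc n" for k
    proof -
      obtain u where u: "0 \<le> u" "hits T (space M) Z (shift_back (s + k * step n) ((t, i) # l)) \<in> sets (Z.Pst u)"
        using shift_back_sets[OF k] by blast
      have nn: "0 \<le> s + Suc k * step n" "0 \<le> k * step n" "k * step n \<le> Suc k * step n"
        using s step_pos[of n] by (auto simp: mult_right_mono)
      have e0: "0 \<le> exp (- (k * step n * a)) - exp (- (Suc k * step n * a))"
        using nn(3) ab by (simp add: mult_right_mono)
      have "emeasure M (?A k) = emeasure M (died_in n k) * ennreal (1 - b / a) *
          emeasure M (hits T (space M) Z (shift_back (s + k * step n) ((t, i) # l)))"
        by (rule indep[OF nn(1) u(1) died_in_sets u(2)])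
      also have "\<dots> = (ennreal (exp (- (k * step n * a)) - exp (- (Suc k * step n * a))) * emeasure M F) *
          ennreal (1 - b / a) * (ennreal (exp (- ((\<delta> - k * step n) * b))) * ?J)"
        unfolding hitsk[OF k] died_in_def
        using emeasure_dies_between[OF s nn(2,3) F] by simp
      also have "\<dots> = emeasure M F * ((ennreal (1 - b / a) *
          (ennreal (exp (- (k * step n * a)) - exp (- (Suc k * step n * a))) *
            ennreal (exp (- ((\<delta> - k * step n) * b))))) * ?J)"
        by (simp only: ac_simps)
      also have "ennreal (1 - b / a) *
          (ennreal (exp (- (k * step n * a)) - exp (- (Suc k * step n * a))) *
            ennreal (exp (- ((\<delta> - k * step n) * b)))) =
          ennreal ((1 - b / a) *
        ((exp (- (k * step n * a)) - exp (- (Suc k * step n * a))) * exp (- ((\<delta> - k * step n) * b))))"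
        using e0 ba by (simp add: ennreal_mult)
      finally show ?thesis .
    qed
    have "emeasure M (approx n) = (\<Sum>k<Suc n. emeasure M (?A k))"
      unfolding approx_def using approx_piece_sets disj by (intro sum_emeasure[symmetric]) auto
    also have "\<dots> = (\<Sum>k<Suc n. emeasure M F * (ennreal ((1 - b / a) *
        ((exp (- (k * step n * a)) - exp (- (Suc k * step n * a))) * exp (- ((\<delta> - k * step n) * b)))) * ?J))"
      by (intro sum.cong refl piece) simp
    also have "\<dots> = emeasure M F * ((\<Sum>k<Suc n. ennreal ((1 - b / a) *
        ((exp (- (k * step n * a)) - exp (- (Suc k * step n * a))) * exp (- ((\<delta> - k * step n) * b))))) * ?J)"
      by (simp only: sum_distrib_left sum_distrib_right)
    also have "(\<Sum>k<Suc n. ennreal ((1 - b / a) *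
        ((exp (- (k * step n * a)) - exp (- (Suc k * step n * a))) * exp (- ((\<delta> - k * step n) * b))))) = ennreal (S n)"
      unfolding S_def sum_distrib_left
    proof (rule sum_ennreal)
      fix k assume "k \<in> {..<Suc n}"
      have "k * step n * a \<le> Suc k * step n * a"
        using step_pos[of n] ab by (intro mult_right_mono) auto
      then show "0 \<le> (1 - b / a) * ((exp (- (k * step n * a)) - exp (- (Suc k * step n * a))) *
          exp (- ((\<delta> - k * step n) * b)))"
        using ba by (intro mult_nonneg_nonneg) auto
    qed
    finally show ?thesis .
  qed
  have "(\<lambda>n. emeasure M F * (?J * ennreal (S n))) \<longlonglongrightarrow>
      emeasure M F * (?J * ennreal (exp (- (\<delta> * b)) - exp (- (\<delta> * a))))"
    using fin by (intro ennreal_tendsto_cmult tendsto_ennrealI S_lim) (auto simp: less_top[symmetric])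
  then have "(\<lambda>n. emeasure M (approx n)) \<longlonglongrightarrow>
      emeasure M F * (ennreal (exp (- (\<delta> * b)) - exp (- (\<delta> * a))) * ?J)"
    unfolding approx_em by (simp only: mult.commute[of ?J])
  from LIMSEQ_unique[OF approx_tendsto this] show ?thesis unfolding \<delta>_def .
qed

end

text \<open>The list must be nonempty because \<open>restart_hits\<close> demands a successful coin
  even when no cell is prescribed, whereas \<open>hits\<close> of the empty list demands
  nothing.\<close>

lemma hits_dead_iff:
  assumes \<omega>: "\<omega> \<in> space M" and t: "0 \<le> t" and dead: "Y t \<omega> = None" and l: "\<And>u j. (u, j) \<in> set l \<Longrightarrow> t \<le> u"
    and ne: "l \<noteq> []"
  shows "\<omega> \<in> hits T (space M) W l \<longleftrightarrow> \<omega> \<in> restart_hits l"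
proof -
  have W: "W u \<omega> = (if B \<omega> then Z (u - Y.L \<omega>) \<omega> else None)" if "(u, j) \<in> set l" for u j
  proof -
    have u: "t \<le> u" "0 \<le> u" using l[OF that] t by auto
    show ?thesis by (rule W_dead[OF \<omega> u(2) Y.W_absorbed[OF \<omega> t u(1) dead]])
  qed
  show ?thesis
  proof (cases "B \<omega>")
    case True
    have "(\<forall>(u, j)\<in>set l. W u \<omega> \<in> Some ` boundary_at T j) \<longleftrightarrow>
        (\<forall>(u, j)\<in>set l. Z (u - Y.L \<omega>) \<omega> \<in> Some ` boundary_at T j)"
    proof (rule ball_cong[OF refl])
      fix p assume p: "p \<in> set l"
      obtain u j where uj: "p = (u, j)" by force
      then show "(case p of (u, j) \<Rightarrow> W u \<omega> \<in> Some ` boundary_at T j) =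
          (case p of (u, j) \<Rightarrow> Z (u - Y.L \<omega>) \<omega> \<in> Some ` boundary_at T j)"
        using W[of u j] p True by simp
    qed
    then show ?thesis using \<omega> True by (simp add: hits_def restart_hits_def)
  next
    case False
    obtain u j where uj: "(u, j) \<in> set l" using ne by (cases l) force+
    have "W u \<omega> \<notin> Some ` boundary_at T j" using W[OF uj] False by auto
    then have "\<omega> \<notin> hits T (space M) W l" using uj by (auto simp: hits_def)
    then show ?thesis using False by (simp add: restart_hits_def)
  qed
qed

text \<open>Measurability is proved along with the value, because \<open>W t\<close> is not yet
  known to be measurable. If \<open>Y\<close> is alive at the first listed time, the induction
  hypothesis applies with that hit absorbed into \<open>F\<close>; if it has died, the rest of the
  list concerns the restarted process.\<close>

lemma emeasure_glue_hits:
  assumes "F \<in> sets (Y.Pst s)" "0 \<le> s" "\<forall>\<omega>\<in>F. Y s \<omega> \<noteq> None"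
    "sorted (map fst l)" "set l \<subseteq> {s..} \<times> sites T"
  shows "F \<inter> hits T (space M) W l \<in> sets M \<and>
    emeasure M (F \<inter> hits T (space M) W l) =
      (\<integral>\<^sup>+\<omega>. lift (Z.\<Phi> s l (\<lambda>_. 1)) (Y s \<omega>) * indicator F \<omega> \<partial>M)"
  using assms
proof (induction l arbitrary: s F)
  case Nil
  have F: "F \<in> sets M" using Nil Y.sets_Pst_sub by auto
  have "(\<integral>\<^sup>+\<omega>. lift (Z.\<Phi> s [] (\<lambda>_. 1)) (Y s \<omega>) * indicator F \<omega> \<partial>M) = (\<integral>\<^sup>+\<omega>. indicator F \<omega> \<partial>M)"
  proof (rule nn_integral_cong)
    fix \<omega> show "lift (Z.\<Phi> s [] (\<lambda>_. 1)) (Y s \<omega>) * indicator F \<omega> = indicator F \<omega>"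
      using Nil(3) by (cases "Y s \<omega>") (auto simp: indicator_def)
  qed
  then show ?case using F sets.sets_into_space[OF F] by (simp add: Int_absorb2)
next
  case (Cons p l)
  obtain t i where p: "p = (t, i)" by force
  have st: "s \<le> t" and i: "i \<in> sites T" using Cons.prems p by auto
  have t: "0 \<le> t" using st Cons.prems(2) by simp
  have FM: "F \<in> sets M" using Cons.prems(1) Y.sets_Pst_sub by auto
  have Fsp: "F \<subseteq> space M" by (rule sets.sets_into_space[OF FM])
  have l: "sorted (map fst l)" "set l \<subseteq> {t..} \<times> sites T" using Cons.prems p by auto
  let ?h = "\<lambda>y. indicator (boundary_at T i) y * Z.\<Phi> t l (\<lambda>_. 1) y"
  have h: "?h \<in> borel_measurable (boundary_borel T)"
    using Cons.prems p by (intro borel_measurable_times_ennreal borel_measurable_indicator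
        boundary_at_in_sets[OF Y.tree i] Z.\<Phi>_measurable) auto
  let ?F = "F \<inter> {\<omega> \<in> space M. Y t \<omega> \<in> Some ` boundary_at T i}"
  have F': "?F \<in> sets (Y.Pst t)"
    using Cons.prems(1) Y.Pst_mono[OF st] Y.live_in_Pst[OF t order.refl boundary_at_in_sets[OF Y.tree i]] by blast
  have F'_alive: "\<forall>\<omega>\<in>?F. Y t \<omega> \<noteq> None" by auto
  note IH = Cons.IH[OF F' t F'_alive l]
  have A1: "?F \<inter> hits T (space M) W l \<in> sets M" using IH by simp
  have A1_em: "emeasure M (?F \<inter> hits T (space M) W l) = (\<integral>\<^sup>+\<omega>. lift (Y.P (t - s) ?h) (Y s \<omega>) * indicator F \<omega> \<partial>M)"
  proof -
    have "emeasure M (?F \<inter> hits T (space M) W l) = (\<integral>\<^sup>+\<omega>. lift (Z.\<Phi> t l (\<lambda>_. 1)) (Y t \<omega>) * indicator ?F \<omega> \<partial>M)"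
      using IH by simp
    also have "\<dots> = (\<integral>\<^sup>+\<omega>. lift ?h (Y t \<omega>) * indicator F \<omega> \<partial>M)"
    proof (rule nn_integral_cong)
      fix \<omega> assume "\<omega> \<in> space M"
      then show "lift (Z.\<Phi> t l (\<lambda>_. 1)) (Y t \<omega>) * indicator ?F \<omega> = lift ?h (Y t \<omega>) * indicator F \<omega>"
        by (cases "Y t \<omega>") (auto simp: indicator_def)
    qed
    also have "\<dots> = (\<integral>\<^sup>+\<omega>. lift (Y.P (t - s) ?h) (Y s \<omega>) * indicator F \<omega> \<partial>M)"
      by (rule Y.markov_integral[OF Cons.prems(2) st Cons.prems(1) h])
    finally show ?thesis .
  qed
  have alive_part: "\<omega> \<in> F \<inter> hits T (space M) W (p # l) \<longleftrightarrow> \<omega> \<in> ?F \<inter> hits T (space M) W l"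
    if \<omega>: "\<omega> \<in> F" "Y t \<omega> \<noteq> None" for \<omega>
  proof -
    have "\<omega> \<in> space M" using \<omega>(1) Fsp by auto
    then have "W t \<omega> = Y t \<omega>" using W_alive t \<omega>(2) by blast
    then show ?thesis unfolding p hits_Cons by auto
  qed
  \<comment> \<open>For t = s no death lies between the two times and both kernels are the identity;
    for t > s the live and restarted contributions add up to the kernel of \<open>Z\<close> by
    \<open>decomposition\<close>.\<close>
  show ?case
  proof (cases "t = s")
    case True
    have "F \<inter> hits T (space M) W (p # l) = ?F \<inter> hits T (space M) W l"
      using alive_part Cons.prems(3) True by blast
    moreover have "Y.P (t - s) ?h = Z.P (t - s) ?h" using True by (simp add: Y.P_def Z.P_def fun_eq_iff)
    ultimately show ?thesis using A1 A1_em unfolding p Z.\<Phi>.simps by simp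
  next
    case False
    with st have st: "s < t" by simp
    let ?C = "crossing t F i l"
    have l': "sorted (map fst ((t, i) # l))" "set ((t, i) # l) \<subseteq> UNIV \<times> sites T"
      using Cons.prems p by auto
    note cross = crossing_sets[OF Cons.prems(2) st Cons.prems(1) Cons.prems(3) l']
      emeasure_crossing[OF Cons.prems(2) st Cons.prems(1) Cons.prems(3) l']
    let ?\<kappa> = "ennreal (exp (- ((t - s) * b)) - exp (- ((t - s) * a)))"
    let ?J = "\<integral>\<^sup>+x. ?h x \<partial>\<mu>"
    have split: "F \<inter> hits T (space M) W (p # l) = (?F \<inter> hits T (space M) W l) \<union> ?C"
    proof (rule set_eqI)
      fix \<omega> show "\<omega> \<in> F \<inter> hits T (space M) W (p # l) \<longleftrightarrow> \<omega> \<in> (?F \<inter> hits T (space M) W l) \<union> ?C"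
      proof (cases "\<omega> \<in> F")
        case True
        then have \<omega>: "\<omega> \<in> space M" using Fsp by auto
        show ?thesis
        proof (cases "Y t \<omega> = None")
          case dead: True
          have "\<omega> \<in> hits T (space M) W (p # l) \<longleftrightarrow> \<omega> \<in> restart_hits (p # l)"
            using l p by (intro hits_dead_iff[OF \<omega> t dead]) auto
          then show ?thesis using True dead \<omega> by (auto simp: crossing_def[OF Cons.prems(2) st Cons.prems(1) Cons.prems(3) l'] p)
        next
          case alive: False
          then have "\<omega> \<notin> ?C" by (simp add: crossing_def[OF Cons.prems(2) st Cons.prems(1) Cons.prems(3) l'])
          then show ?thesis using alive_part[OF True alive] by blast
        qed
      qed (simp add: crossing_def[OF Cons.prems(2) st Cons.prems(1) Cons.prems(3) l'])
    qed
    have disj: "(?F \<inter> hits T (space M) W l) \<inter> ?C = {}"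
      by (auto simp: crossing_def[OF Cons.prems(2) st Cons.prems(1) Cons.prems(3) l'])
    have "emeasure M (F \<inter> hits T (space M) W (p # l)) =
        emeasure M (?F \<inter> hits T (space M) W l) + emeasure M ?C"
      unfolding split by (rule plus_emeasure[OF A1 cross(1) disj, symmetric])
    also have "emeasure M ?C = (\<integral>\<^sup>+\<omega>. (?\<kappa> * ?J) * indicator F \<omega> \<partial>M)"
      unfolding cross(2) by (subst nn_integral_cmult_indicator[OF FM]) (rule mult.commute)
    also have "emeasure M (?F \<inter> hits T (space M) W l) + (\<integral>\<^sup>+\<omega>. (?\<kappa> * ?J) * indicator F \<omega> \<partial>M) =
        (\<integral>\<^sup>+\<omega>. lift (Y.P (t - s) ?h) (Y s \<omega>) * indicator F \<omega> + (?\<kappa> * ?J) * indicator F \<omega> \<partial>M)"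
      unfolding A1_em
      by (intro nn_integral_add[symmetric] borel_measurable_times_ennreal borel_measurable_const
          borel_measurable_indicator FM Y.lift_W_measurable_M[OF Cons.prems(2) Y.P_measurable[OF h]])
    also have "\<dots> = (\<integral>\<^sup>+\<omega>. lift (Z.P (t - s) ?h) (Y s \<omega>) * indicator F \<omega> \<partial>M)"
    proof (rule nn_integral_cong_AE)
      have "0 < t - s" using st by simp
      from decomposition[OF Cons.prems(2) this h]
      show "AE \<omega> in M. lift (Y.P (t - s) ?h) (Y s \<omega>) * indicator F \<omega> + (?\<kappa> * ?J) * indicator F \<omega> =
          lift (Z.P (t - s) ?h) (Y s \<omega>) * indicator F \<omega>"
      proof eventually_elim
        case (elim \<omega>)
        show ?case
        proof (cases "\<omega> \<in> F")
          case True
          then obtain y where "Y s \<omega> = Some y" using Cons.prems(3) by blast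
          then show ?thesis using elim by (simp add: distrib_right)
        qed simp
      qed
    qed
    finally have "emeasure M (F \<inter> hits T (space M) W (p # l)) =
      (\<integral>\<^sup>+\<omega>. lift (Z.P (t - s) ?h) (Y s \<omega>) * indicator F \<omega> \<partial>M)" .
    moreover have "F \<inter> hits T (space M) W (p # l) \<in> sets M"
      unfolding split by (rule sets.Un[OF A1 cross(1)])
    ultimately show ?thesis unfolding p Z.\<Phi>.simps by simp
  qed
qed

lemma W_measurable:
  assumes t: "0 \<le> t" shows "W t \<in> measurable M (coffin_borel T R)"
proof (rule measurable_sigma_sets[OF sets_coffin_borel[OF Y.tree Z.R_sub]])
  show "(\<lambda>i. Some ` (boundary_at T i \<inter> R)) ` sites T \<subseteq> Pow (insert None (Some ` R))" by auto
  show "W t \<in> space M \<rightarrow> insert None (Some ` R)" using W_range t by simp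
  fix A assume "A \<in> (\<lambda>i. Some ` (boundary_at T i \<inter> R)) ` sites T"
  then obtain i where i: "i \<in> sites T" "A = Some ` (boundary_at T i \<inter> R)" by auto
  let ?F = "{\<omega> \<in> space M. Y 0 \<omega> \<noteq> None}"
  have F: "?F \<in> sets (Y.Pst 0)" by (rule Y.alive_in_Pst) auto
  have FM: "?F \<in> sets M" using F Y.sets_Pst_sub by auto
  have 1: "?F \<inter> hits T (space M) W [(t, i)] \<in> sets M"
    by (rule conjunct1[OF emeasure_glue_hits[OF F]]) (use t i in auto)
  have 2: "(space M - ?F) \<inter> {\<omega> \<in> space M. B \<omega>} \<inter> {\<omega> \<in> space M. Z t \<omega> \<in> Some ` boundary_at T i} \<in> sets M"
    using FM B_sets Z.measurable_live[OF t boundary_at_in_sets[OF Y.tree i(1)]] by blast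
  \<comment> \<open>The second part collects the paths of \<open>Y\<close> that are dead from the
    start. They have probability 0 but still have to form measurable sets; there the lifetime is 0,
    so the restart runs \<open>Z\<close> without a shift.\<close>
  have "W t -` A \<inter> space M = (?F \<inter> hits T (space M) W [(t, i)]) \<union>
      ((space M - ?F) \<inter> {\<omega> \<in> space M. B \<omega>} \<inter> {\<omega> \<in> space M. Z t \<omega> \<in> Some ` boundary_at T i})"
  proof (rule set_eqI)
    fix \<omega>
    show "\<omega> \<in> W t -` A \<inter> space M \<longleftrightarrow> \<omega> \<in> (?F \<inter> hits T (space M) W [(t, i)]) \<union>
      ((space M - ?F) \<inter> {\<omega> \<in> space M. B \<omega>} \<inter> {\<omega> \<in> space M. Z t \<omega> \<in> Some ` boundary_at T i})"
    proof (cases "\<omega> \<in> space M")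
      case \<omega>: True
      have A: "W t \<omega> \<in> A \<longleftrightarrow> W t \<omega> \<in> Some ` boundary_at T i"
        using W_range[OF \<omega> t] i(2) by (cases "W t \<omega>") auto
      show ?thesis
      proof (cases "Y 0 \<omega> = None")
        case True
        have "Y t \<omega> = None" by (rule Y.W_absorbed[OF \<omega> order.refl t True])
        moreover have "Y.L \<omega> = 0" using Y.lifetime_eq_L(2,3)[OF \<omega> order.refl True] by simp
        ultimately have "W t \<omega> = (if B \<omega> then Z t \<omega> else None)" using W_dead[OF \<omega> t] by simp
        then show ?thesis using A \<omega> True by auto
      next
        case False
        then show ?thesis using A \<omega> by (auto simp: hits_def)
      qed
    qed (auto simp: hits_def)
  qed
  then show "W t -` A \<inter> space M \<in> sets M" using 1 2 by simp
qed

lemma W_path: "ray_path \<mu> T d D i0 M R dens W"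
proof (unfold_locales)
  show "R \<in> sets (boundary_borel T)" by (rule Z.R_sets)
  show "AE x in \<mu>. x \<in> R" by (rule Z.R_full)
  show "dens t x y = Z.p t x y" if "0 < t" "x \<in> R" "y \<in> R" for t x y by (rule Z.dens_eq[OF that])
  show "W t \<in> measurable M (coffin_borel T R)" if "0 \<le> t" for t by (rule W_measurable[OF that])
  show "rcll (add_coffin (subtopology (boundary_top T) R)) (\<lambda>t. W t \<omega>)" if "\<omega> \<in> space M" for \<omega>
    by (rule W_rcll[OF that])
  show "W t \<omega> = None" if "\<omega> \<in> space M" "0 \<le> s" "s \<le> t" "W s \<omega> = None" for \<omega> s t
    by (rule W_absorbed[OF that])
qed

theorem glue_is_process:
  "sub_markov_process (subtopology (boundary_top T) R) \<mu> dens (return (boundary_borel T) \<xi>) M (glue Y B Z)"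
proof -
  interpret W: ray_path \<mu> T d D i0 M R dens W by (rule W_path)
  have init: "AE \<omega> in M. Y 0 \<omega> = Some \<xi>" by (rule Y.AE_initial_point[OF refl \<xi>])
  let ?F = "{\<omega> \<in> space M. Y 0 \<omega> \<noteq> None}"
  have F: "?F \<in> sets (Y.Pst 0)" by (rule Y.alive_in_Pst) auto
  have "sub_markov_process (subtopology (boundary_top T) R) \<mu> dens (return (boundary_borel T) \<xi>) M W"
  proof (rule W.sub_markov_process_of_hits)
    show "\<xi> \<in> R" using \<xi> R'_R by auto
    show "AE \<omega> in M. W 0 \<omega> = Some \<xi>"
      using init AE_space by eventually_elim (use W_alive in auto)
    show "AE x in \<mu>. Z.P u (\<lambda>_. 1) x \<le> 1" if "0 < u" for u by (rule sub[OF that])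
    show "Z.P u (\<lambda>_. 1) \<xi> \<le> 1" if "0 < u" for u by (rule sub_\<xi>[OF that])
    fix l :: "(real \<times> 'a) list" assume l: "sorted (map fst l)" "set l \<subseteq> {0..} \<times> sites T"
    have H: "?F \<inter> hits T (space M) W l \<in> sets M"
      "emeasure M (?F \<inter> hits T (space M) W l) =
        (\<integral>\<^sup>+\<omega>. lift (Z.\<Phi> 0 l (\<lambda>_. 1)) (Y 0 \<omega>) * indicator ?F \<omega> \<partial>M)"
      using emeasure_glue_hits[OF F order.refl _ l] by auto
    have "hits T (space M) W l \<in> sets M"
    proof -
      have "hits T (space M) W l \<in> cylinders T (space M) W {0..}"
        using l unfolding cylinders_def by blast
      also have "\<dots> \<subseteq> sigma_sets (space M) (cylinders T (space M) W {0..})" by auto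
      also have "\<dots> = sigma_sets (space M) (\<Union>u\<in>{0..}. {W u -` A \<inter> space M |A. A \<in> sets (coffin_borel T R)})"
        by (rule sigma_sets_cylinders[OF Y.tree Z.R_sub, symmetric]) (use W_range in auto)
      also have "\<dots> \<subseteq> sets M"
        by (rule sets.sigma_sets_subset) (use measurable_sets[OF W_measurable] in auto)
      finally show ?thesis .
    qed
    then have "emeasure M (hits T (space M) W l) = emeasure M (?F \<inter> hits T (space M) W l)"
    proof (intro emeasure_eq_AE H(1))
      show "AE \<omega> in M. \<omega> \<in> hits T (space M) W l \<longleftrightarrow> \<omega> \<in> ?F \<inter> hits T (space M) W l"
        using init AE_space by eventually_elim simp
    qed
    also have "\<dots> = (\<integral>\<^sup>+\<omega>. Z.\<Phi> 0 l (\<lambda>_. 1) \<xi> \<partial>M)"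
      unfolding H(2)
    proof (rule nn_integral_cong_AE)
      show "AE \<omega> in M. lift (Z.\<Phi> 0 l (\<lambda>_. 1)) (Y 0 \<omega>) * indicator ?F \<omega> = Z.\<Phi> 0 l (\<lambda>_. 1) \<xi>"
        using init AE_space by eventually_elim simp
    qed
    finally show "emeasure M (hits T (space M) W l) = Z.\<Phi> 0 l (\<lambda>_. 1) \<xi>"
      by (simp add: Y.M.emeasure_space_1)
  qed
  then show ?thesis by (simp only: W_def)
qed

end

section \<open>The two hierarchies of the tree, and the theorem\<close>

lemma ray_processI:
  assumes "ray_hierarchy \<mu> T d D i0" and "R \<in> sets (boundary_borel T)" and "AE x in \<mu>. x \<in> R"
    and "\<And>t x y. x \<in> R \<Longrightarrow> y \<in> R \<Longrightarrow> dens t x y = ray_hierarchy.p \<mu> T d D t x y"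
    and "sub_markov_process (subtopology (boundary_top T) R) \<mu> dens \<nu> M W"
  shows "ray_process \<mu> T d D i0 M R dens W \<nu>"
proof (intro ray_process.intro ray_process_axioms.intro ray_path.intro ray_path_axioms.intro)
  note D = sub_markov_processD[OF assms(5)]
  show "ray_hierarchy \<mu> T d D i0" "R \<in> sets (boundary_borel T)" "AE x in \<mu>. x \<in> R"
    "sub_markov_process (subtopology (boundary_top T) R) \<mu> dens \<nu> M W" by fact+
  show "prob_space M" by (rule D(1))
  show "W t \<in> measurable M (coffin_borel T R)" if "0 \<le> t" for t by (rule D(2)[OF that])
  show "rcll (add_coffin (subtopology (boundary_top T) R)) (\<lambda>t. W t \<omega>)" if "\<omega> \<in> space M" for \<omega>
    by (rule D(3)[OF that])
  show "W t \<omega> = None" if "\<omega> \<in> space M" "0 \<le> s" "s \<le> t" "W s \<omega> = None" for \<omega> s t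
    by (rule D(4)[OF that])
  show "dens t x y = ray_hierarchy.p \<mu> T d D t x y" if "x \<in> R" "y \<in> R" for t x y
    by (rule assms(4)[OF that])
qed

lemma sets_exit_law [simp]: "sets (exit_law T) = sets (boundary_borel T)"
  unfolding exit_law_def by (simp add: sets.sigma_sets_eq sets.space_closed)

text \<open>\<open>measure_of\<close> returns either the prescribed set function or, if that is not
  a measure, zero. The conditional probability of an event given itself is 1, or 0 when the division
  by zero convention applies.\<close>

lemma emeasure_exit_law_le_1:
  assumes T: "weighted_tree T"
  shows "emeasure (exit_law T) (boundary T) \<le> 1"
proof -
  have "\<P>(\<omega> in chain_law T (origin T). exits_in T (boundary T) \<omega> \<bar> exits_in T (boundary T) \<omega>) \<le> 1"
    by (simp add: cond_prob_def)
  then show ?thesis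
    unfolding exit_law_def emeasure_measure_of_conv using T by (simp add: ennreal_le_1)
qed

lemma density_Xi_eq:
  assumes x: "x \<in> boundary T" and y: "y \<in> boundary T"
  shows "density_Xi T t x y = (\<Sum>n. if x n = y n then ennreal ((exp (- t / G T n x) - exp (- t / G T (Suc n) x)) /
    measure (exit_law T) (cell T n x)) else 0)"
  unfolding density_Xi_def enat_le_meet_iff[OF x y] ..

lemma increment_pos: "weighted_tree T \<Longrightarrow> 0 < increment (weight T) n"
proof -
  assume T: "weighted_tree T"
  then have "strict_mono (weight T)" "\<forall>n. 0 < weight T n" by (simp_all add: weighted_tree_def)
  then show "0 < increment (weight T) n"
    unfolding increment_def by (cases n) (auto simp: strict_mono_Suc_iff)
qed

lemma increment_bar_weight:
  "increment (bar_weight T r1) n = measure (exit_law T) (boundary_at T r1) * increment (weight T) (Suc n)"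
  by (cases n) (simp_all add: increment_def bar_weight_def)

locale successor_hierarchy = \<mu>: prob_space "exit_law T" for T :: "'i tree_data" +
  fixes r1 :: 'i
  assumes tree: "weighted_tree T" and succ: "r1 \<in> successors T (origin T)"
    and charged: "0 < measure (exit_law T) (boundary_at T r1)"
begin

abbreviation "\<rho> \<equiv> measure (exit_law T) (boundary_at T r1)"

lemma depth_r1: "depth T r1 = 1"
proof -
  have "r1 \<in> sites T" "r1 \<noteq> origin T" "parent T r1 = origin T" using succ by (auto simp: successors_def)
  moreover have "path_between T (origin T) (origin T) [origin T]"
    using origin_in_sites[OF tree] by (auto simp: path_between_def)
  then have "depth T (origin T) = 0" using geodesic_eqI[OF tree] by (simp add: depth_def)
  ultimately show ?thesis using depth_parent[OF tree, of r1] by simp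
qed

lemma boundary_at_r1: "boundary_at T r1 = {x \<in> boundary T. x (Suc 0) = r1}"
  by (simp add: boundary_at_def depth_r1)

lemma boundary_at_r1_sets: "boundary_at T r1 \<in> sets (boundary_borel T)"
  using succ by (intro boundary_at_in_sets[OF tree]) (simp add: successors_def)

lemma emeasure_r1: "emeasure (exit_law T) (boundary_at T r1) = ennreal \<rho>"
  by (rule \<mu>.emeasure_eq_measure)

lemma emeasure_r1_neq: "emeasure (exit_law T) (boundary_at T r1) \<noteq> 0"
  "emeasure (exit_law T) (boundary_at T r1) \<noteq> \<infinity>"
  using charged by (simp_all add: emeasure_r1)

lemma space_exit_law: "space (exit_law T) = boundary T"
  using sets_eq_imp_space_eq[OF sets_exit_law[of T]] tree by simp

lemma sets_bar_law: "sets (bar_law T r1) = sets (boundary_borel T)"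
  by (simp add: bar_law_def)

lemma AE_bar_law: "(AE x in bar_law T r1. Q x) \<longleftrightarrow> (AE x in exit_law T. x \<in> boundary_at T r1 \<longrightarrow> Q x)"
  unfolding bar_law_def
  by (rule AE_uniform_measure[OF emeasure_r1_neq(1)]) (simp add: emeasure_r1)

sublocale H0: ray_hierarchy "exit_law T" T 0 "increment (weight T)" "origin T"
proof
  show "AE x in exit_law T. x 0 = origin T"
    using AE_space by eventually_elim (simp add: space_exit_law boundary_def)
qed (simp_all add: tree increment_pos)

sublocale H1: ray_hierarchy "bar_law T r1" T "Suc 0" "increment (bar_weight T r1)" r1
proof (intro ray_hierarchy.intro ray_hierarchy_axioms.intro)
  show "prob_space (bar_law T r1)"
    unfolding bar_law_def by (rule prob_space_uniform_measure[OF emeasure_r1_neq])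
  show "AE x in bar_law T r1. x (Suc 0) = r1" unfolding AE_bar_law by (simp add: boundary_at_r1)
  show "0 < increment (bar_weight T r1) n" for n
    unfolding increment_bar_weight using charged increment_pos[OF tree] by simp
qed (simp_all add: tree sets_bar_law)

lemma H0_mass: "x \<in> boundary T \<Longrightarrow> H0.mass n x = measure (exit_law T) (cell T n x)"
  by (simp add: H0.mass_def cell_def boundary_at_ray[OF tree])

lemma H0_g: "x \<in> boundary T \<Longrightarrow> H0.g n x = G T n x"
  by (simp add: H0.g_def G_def H0_mass)

lemma H0_p: "x \<in> boundary T \<Longrightarrow> y \<in> boundary T \<Longrightarrow> density_Xi T t x y = H0.p t x y"
  by (simp add: density_Xi_eq H0.p_def H0.coef_def H0_g H0_mass cong: if_cong)

lemma agree_r1: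
  assumes "x \<in> boundary_at T r1" "y \<in> boundary T" "x (Suc n) = y (Suc n)"
  shows "y \<in> boundary_at T r1"
proof -
  have "x \<in> boundary T" "x (Suc 0) = r1" using assms(1) by (simp_all add: boundary_at_r1)
  moreover from this have "x (Suc 0) = y (Suc 0)"
    using ray_agree_mono[of x T y "Suc n" "Suc 0"] assms(2,3) by simp
  ultimately show ?thesis using assms(2) by (simp add: boundary_at_r1)
qed

lemma H1_mass:
  assumes x: "x \<in> boundary_at T r1"
  shows "H1.mass n x = H0.mass (Suc n) x / \<rho>"
proof -
  let ?C = "{y \<in> boundary T. y (Suc n) = x (Suc n)}"
  have "?C \<subseteq> boundary_at T r1" using agree_r1[OF x] by (metis (mono_tags, lifting) mem_Collect_eq subsetI)
  then have "boundary_at T r1 \<inter> ?C = ?C" by blast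
  moreover have "?C \<in> sets (exit_law T)" unfolding sets_exit_law by (rule H0.level_set_in_sets)
  ultimately have "measure (bar_law T r1) ?C = measure (exit_law T) ?C / \<rho>"
    using measure_uniform_measure[OF emeasure_r1_neq, of ?C] by (simp add: bar_law_def)
  then show ?thesis by (simp add: H1.mass_def H0.mass_def)
qed

lemma H1_bar_cell: "x \<in> boundary T \<Longrightarrow> measure (bar_law T r1) (bar_cell T n x) = H1.mass n x"
  by (simp add: H1.mass_def bar_cell_def cell_def boundary_at_ray[OF tree])

text \<open>The factor \<rho> in \<open>bar_weight\<close> is the one by which
  \<open>bar_law\<close> is normalised, so the weighted masses of the subtree are those of the whole
  tree one level further down.\<close>

lemma D_mass:
  assumes "x \<in> boundary_at T r1"
  shows "increment (bar_weight T r1) n * H1.mass n x = increment (weight T) (Suc n) * H0.mass (Suc n) x"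
  using charged by (simp add: increment_bar_weight H1_mass[OF assms])

lemma H1_g: "x \<in> boundary_at T r1 \<Longrightarrow> H1.g n x = H0.g (Suc n) x"
  by (simp add: H1.g_def H0.g_def D_mass)

lemma bar_G_eq: "x \<in> boundary T \<Longrightarrow> bar_G T r1 n x = H1.g n x"
  by (simp add: bar_G_def H1.g_def H1_bar_cell)

lemma H1_p:
  assumes x: "x \<in> boundary_at T r1" and y: "y \<in> boundary_at T r1"
  shows "density_Xi_bar T r1 t x y = H1.p t x y"
proof -
  have xb: "x \<in> boundary T" and yb: "y \<in> boundary T" using x y by (auto simp: boundary_at_def)
  \<comment> \<open>Two rays of the subtree agree at level 1, so the truncated subtraction of 1 from
    a finite \<open>meet\<close> is exact; an infinite \<open>meet\<close> is unchanged.\<close>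
  have "enat n \<le> meet x y - 1 \<longleftrightarrow> x (Suc n) = y (Suc n)" for n
  proof (cases "meet x y")
    case (enat m)
    have "enat (Suc 0) \<le> meet x y" using enat_le_meet_iff[OF xb yb, of "Suc 0"] x y by (simp add: boundary_at_r1)
    then have "1 \<le> m" by (simp add: enat)
    then have "enat n \<le> meet x y - 1 \<longleftrightarrow> enat (Suc n) \<le> meet x y"
      by (auto simp: enat one_enat_def)
    then show ?thesis using enat_le_meet_iff[OF xb yb] by simp
  next
    case infinity
    then have "x = y" by (simp add: meet_def split: if_splits)
    moreover have "enat n \<le> meet x y - 1" unfolding infinity by simp
    ultimately show ?thesis by simp
  qed
  then show ?thesis
    by (simp cong: if_cong add: density_Xi_bar_def H1.p_def H1.coef_def bar_G_eq[OF xb] H1_bar_cell[OF xb])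
qed

lemma H0_mass_0: "x \<in> boundary T \<Longrightarrow> H0.mass 0 x = 1"
proof -
  assume x: "x \<in> boundary T"
  have "{y \<in> boundary T. y (0 + 0) = x (0 + 0)} = space (exit_law T)"
    using x by (auto simp: space_exit_law boundary_def)
  then show "H0.mass 0 x = 1" unfolding H0.mass_def using \<mu>.prob_space by simp
qed

lemma good_iff:
  assumes x: "x \<in> boundary_at T r1"
  shows "H1.good x \<longleftrightarrow> H0.good x"
proof -
  have xb: "x \<in> boundary T" using x by (simp add: boundary_at_def)
  have "(\<forall>n. 0 < H1.mass n x) \<longleftrightarrow> (\<forall>n. 0 < H0.mass n x)"
  proof -
    have "0 < H1.mass n x \<longleftrightarrow> 0 < H0.mass (Suc n) x" for n
      using charged by (simp add: H1_mass[OF x] zero_less_divide_iff)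
    moreover have "0 < H0.mass 0 x" by (simp add: H0_mass_0[OF xb])
    ultimately show ?thesis by (metis not0_implies_Suc)
  qed
  moreover have "summable (\<lambda>k. increment (bar_weight T r1) k * H1.mass k x) \<longleftrightarrow>
      summable (\<lambda>k. increment (weight T) k * H0.mass k x)"
    unfolding D_mass[OF x] by (rule summable_Suc_iff)
  ultimately show ?thesis by (simp add: H0.good_def H1.good_def)
qed

lemma H0_g_0:
  assumes x: "x \<in> boundary T" "H0.good x"
  shows "H0.g 0 x = weight T 0 + H0.g 1 x"
  using H0.g_Suc[OF x, of 0] H0_mass_0[OF x(1)] by (simp add: increment_def)

text \<open>The level-0 cell is the whole boundary, so the first term of \<open>H0.p\<close>
  contributes a constant times the integral of \<open>f\<close>. The later terms vanish off the
  subtree; on it they are the terms of \<open>H1.p\<close> divided by \<rho>, and integration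
  against \<open>bar_law\<close> supplies this division.\<close>

lemma P_decomposition:
  assumes x: "x \<in> boundary_at T r1" and t: "0 < t" and f: "f \<in> borel_measurable (boundary_borel T)"
  shows "H0.P t f x = H1.P t f x +
    ennreal (exp (- t / H0.g 0 x) - exp (- t / H1.g 0 x)) * (\<integral>\<^sup>+y. f y \<partial>exit_law T)"
proof -
  have xb: "x \<in> boundary T" using x by (simp add: boundary_at_def)
  define c where "c = ennreal (exp (- t / H0.g 0 x) - exp (- t / H1.g 0 x))"
  \<comment> \<open>The density of the whole process without its level-0 term.\<close>
  define q where "q y = (\<Sum>n. if x (Suc n) = y (Suc n) then H0.coef t (Suc n) x else 0)" for y
  have c: "H0.coef t 0 x = c"
    using H1_g[OF x, of 0] by (simp add: H0.coef_def c_def H0_mass_0[OF xb])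
  have p0: "H0.p t x y = q y + c" if "y \<in> boundary T" for y
  proof -
    have "x 0 = y 0" using xb that by (simp add: boundary_def)
    then show ?thesis
      using suminf_offset[of "\<lambda>n. if x n = y n then H0.coef t n x else 0" 1]
      by (simp add: H0.p_def q_def c cong: if_cong)
  qed
  have coef: "H1.coef t n x = ennreal \<rho> * H0.coef t (Suc n) x" for n
  proof -
    have "H1.coef t n x = ennreal (\<rho> * ((exp (- t / H0.g (Suc n) x) - exp (- t / H0.g (Suc (Suc n)) x)) /
        H0.mass (Suc n) x))"
      unfolding H1.coef_def H1_g[OF x] H1_mass[OF x] by (simp add: mult.commute)
    then show ?thesis by (simp only: H0.coef_def ennreal_mult'[OF less_imp_le[OF charged]])
  qed
  have p1: "H1.p t x y * indicator (boundary_at T r1) y = ennreal \<rho> * q y" if y: "y \<in> boundary T" for y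
  proof (cases "y \<in> boundary_at T r1")
    case True
    have "H1.p t x y = (\<Sum>n. ennreal \<rho> * (if x (Suc n) = y (Suc n) then H0.coef t (Suc n) x else 0))"
      unfolding H1.p_def coef by (intro suminf_cong) simp
    then show ?thesis using True by (simp add: q_def)
  next
    case False
    then have "x (Suc n) \<noteq> y (Suc n)" for n using agree_r1[OF x y] by blast
    then show ?thesis using False by (simp add: q_def)
  qed
  have fm: "f \<in> borel_measurable (exit_law T)" using f by (simp add: H0.measurable_\<mu>)
  have qm: "q \<in> borel_measurable (exit_law T)"
  proof -
    have "(\<lambda>y. if x (Suc n) = y (Suc n) then H0.coef t (Suc n) x else 0) \<in> borel_measurable (boundary_borel T)" for n
      by (rule measurable_level_comp[OF tree, where f="\<lambda>i. if x (Suc n) = i then H0.coef t (Suc n) x else 0"])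
    then show ?thesis unfolding q_def[abs_def] H0.measurable_\<mu> by (rule borel_measurable_suminf_order)
  qed
  have "H1.P t f x = (\<integral>\<^sup>+y. H1.p t x y * f y \<partial>bar_law T r1)" using t by (simp add: H1.P_def)
  also have "\<dots> = (\<integral>\<^sup>+y. H1.p t x y * f y * indicator (boundary_at T r1) y \<partial>exit_law T) / ennreal \<rho>"
  proof -
    have m: "(\<lambda>y. H1.p t x y * f y) \<in> borel_measurable (exit_law T)"
      unfolding H0.measurable_\<mu> by (intro borel_measurable_times_ennreal H1.p_measurable2[OF xb] f)
    have r1: "boundary_at T r1 \<in> sets (exit_law T)" by (simp add: boundary_at_r1_sets)
    from nn_integral_uniform_measure[OF m r1, folded bar_law_def] show ?thesis
      by (simp only: emeasure_r1)
  qed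
  also have "(\<integral>\<^sup>+y. H1.p t x y * f y * indicator (boundary_at T r1) y \<partial>exit_law T) =
      (\<integral>\<^sup>+y. ennreal \<rho> * (q y * f y) \<partial>exit_law T)"
  proof (rule nn_integral_cong)
    fix y assume "y \<in> space (exit_law T)"
    then have "H1.p t x y * indicator (boundary_at T r1) y = ennreal \<rho> * q y" using p1 space_exit_law by simp
    then have "H1.p t x y * indicator (boundary_at T r1) y * f y = ennreal \<rho> * q y * f y" by simp
    then show "H1.p t x y * f y * indicator (boundary_at T r1) y = ennreal \<rho> * (q y * f y)"
      by (simp only: ac_simps)
  qed
  also have "\<dots> = ennreal \<rho> * (\<integral>\<^sup>+y. q y * f y \<partial>exit_law T)"
    by (intro nn_integral_cmult borel_measurable_times_ennreal qm fm)
  also have "\<dots> / ennreal \<rho> = (\<integral>\<^sup>+y. q y * f y \<partial>exit_law T)"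
    using charged by (subst mult.commute) (simp add: ennreal_mult_divide_eq)
  finally have H1P: "H1.P t f x = (\<integral>\<^sup>+y. q y * f y \<partial>exit_law T)" .
  have "H0.P t f x = (\<integral>\<^sup>+y. H0.p t x y * f y \<partial>exit_law T)" using t by (simp add: H0.P_def)
  also have "\<dots> = (\<integral>\<^sup>+y. q y * f y + c * f y \<partial>exit_law T)"
    by (rule nn_integral_cong) (simp add: p0 space_exit_law distrib_right)
  also have "\<dots> = (\<integral>\<^sup>+y. q y * f y \<partial>exit_law T) + (\<integral>\<^sup>+y. c * f y \<partial>exit_law T)"
    by (intro nn_integral_add borel_measurable_times_ennreal borel_measurable_const qm fm)
  finally show ?thesis by (simp add: H1P c_def nn_integral_cmult[OF fm])
qed

end

theorem theorem6p2:
  fixes T :: "'i tree_data" and r1 :: 'i and \<xi> :: "nat \<Rightarrow> 'i"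
    and M :: "'w measure" and B :: "'w \<Rightarrow> bool"
    and Xi_bar Xi_mu :: "real \<Rightarrow> 'w \<Rightarrow> (nat \<Rightarrow> 'i) option"
  assumes "weighted_tree T" and "transient T"
    and "r1 \<in> successors T (origin T)"
    and "measure (exit_law T) (boundary_at T r1) > 0"
    and "\<xi> \<in> bar_regular_boundary T r1"
    and "process_Xi_bar T r1 (return (boundary_borel T) \<xi>) M Xi_bar"
    and "process_Xi T (exit_law T) M Xi_mu"
    and "prob_space.indep_var M
           (path_space (bar_regular_top T r1)) (path_of Xi_bar)
           (path_space (regular_top T)) (path_of Xi_mu)"
    and "\<P>(\<omega> in M. B \<omega>) = 1 - G T 1 \<xi> / G T 0 \<xi>"
    and "independent_elements M
           (count_space UNIV) B
           (path_space (bar_regular_top T r1) \<Otimes>\<^sub>M path_space (regular_top T))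
           (\<lambda>\<omega>. (path_of Xi_bar \<omega>, path_of Xi_mu \<omega>))"
  shows "process_Xi T (return (boundary_borel T) \<xi>) M (glue Xi_bar B Xi_mu) \<and>
    (\<forall>(N :: 'v measure) Xi_xi.
       process_Xi T (return (boundary_borel T) \<xi>) N Xi_xi \<longrightarrow>
       distr M (path_space (regular_top T)) (path_of (glue Xi_bar B Xi_mu)) =
       distr N (path_space (regular_top T)) (path_of Xi_xi))"
proof -
  define R where "R = regular_boundary T"
  define R' where "R' = bar_regular_boundary T r1"
  have tops: "regular_top T = subtopology (boundary_top T) R"
    "bar_regular_top T r1 = subtopology (boundary_top T) R'"
    by (simp_all add: regular_top_def bar_regular_top_def R_def R'_def)
  note T = assms(1)
  have Zp: "sub_markov_process (subtopology (boundary_top T) R) (exit_law T) (density_Xi T) (exit_law T) M Xi_mu"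
    using assms(7) by (simp only: process_Xi_def tops)
  have Yp: "sub_markov_process (subtopology (boundary_top T) R') (bar_law T r1) (density_Xi_bar T r1)
      (return (boundary_borel T) \<xi>) M Xi_bar"
    using assms(6) by (simp only: process_Xi_bar_def tops)
  interpret M: prob_space M by (rule sub_markov_processD(1)[OF Zp])
  have R_sub: "R \<subseteq> boundary T" by (auto simp: R_def regular_boundary_def)
  have space_exit: "space (exit_law T) = boundary T"
    using sets_eq_imp_space_eq[OF sets_exit_law[of T]] T by simp
  \<comment> \<open>At time 0 the process \<open>Xi_mu\<close> lies in its state space with
    probability 1, and its initial law translates this into the mass of \<open>R\<close>.\<close>
  have R_one: "emeasure (exit_law T) R = 1"
  proof -
    let ?A = "space (coffin_borel T R)"
    have "emeasure M (Xi_mu 0 -` ?A \<inter> space M) = emeasure (exit_law T) (Some -` ?A)"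
      by (rule sub_markov_processD(5)[OF Zp]) simp
    moreover have "Xi_mu 0 -` ?A \<inter> space M = space M"
      using measurable_space[OF sub_markov_processD(2)[OF Zp order.refl]] by auto
    moreover have "Some -` ?A = R" unfolding space_coffin_borel[OF T R_sub] by auto
    ultimately show ?thesis by (simp add: M.emeasure_space_1)
  qed
  \<comment> \<open>\<open>emeasure\<close> is 0 on sets that are not measurable, so mass 1 forces
    the regular boundary to be measurable.\<close>
  then have R_sets': "R \<in> sets (exit_law T)"
    using emeasure_notin_sets by (metis zero_neq_one)
  then have R_sets: "R \<in> sets (boundary_borel T)" by simp
  \<comment> \<open>The same mass excludes the degenerate outcome of \<open>measure_of\<close>:
    \<open>exit_law\<close> is a genuine probability measure.\<close>
  have "emeasure (exit_law T) R \<le> emeasure (exit_law T) (boundary T)"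
    using R_sub sets.top[of "exit_law T"] space_exit by (intro emeasure_mono) simp_all
  then have total: "emeasure (exit_law T) (space (exit_law T)) = 1"
    using emeasure_exit_law_le_1[OF T] R_one space_exit by simp
  interpret successor_hierarchy T r1
    by (intro successor_hierarchy.intro successor_hierarchy_axioms.intro prob_spaceI total assms(1,3,4))
  have R_full: "AE x in exit_law T. x \<in> R"
    using R_one R_sets' by (subst \<mu>.AE_in_set_eq_1) (auto simp: measure_def)
  have R': "R' = R \<inter> boundary_at T r1" by (simp add: R'_def R_def bar_regular_boundary_def)
  have R'_sets: "R' \<in> sets (boundary_borel T)" unfolding R' using R_sets boundary_at_r1_sets by auto
  have R'_full: "AE x in bar_law T r1. x \<in> R'"
    unfolding AE_bar_law R' using R_full by eventually_elim simp
  have \<xi>: "\<xi> \<in> R'" using assms(5) by (simp add: R'_def)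
  interpret Z: ray_process "exit_law T" T 0 "increment (weight T)" "origin T" M R "density_Xi T" Xi_mu "exit_law T"
    by (rule ray_processI[OF H0.ray_hierarchy_axioms R_sets R_full _ Zp]) (use H0_p R_sub in auto)
  interpret Y: ray_process "bar_law T r1" T "Suc 0" "increment (bar_weight T r1)" r1 M R' "density_Xi_bar T r1" Xi_bar
    "return (boundary_borel T) \<xi>"
    by (rule ray_processI[OF H1.ray_hierarchy_axioms R'_sets R'_full _ Yp]) (use H1_p R' in auto)

  have good0: "AE x in exit_law T. H0.good x"
    using Z.AE_initial[OF sets_exit_law H0.good_measurable Z.AE_good[OF order.refl]] R_full
    by eventually_elim simp
  obtain c0 where c0: "AE x in exit_law T. H0.g 0 x = c0"
  proof -
    let ?C = "\<integral>\<^sup>+y. H0.P 1 (\<lambda>_. 1) y \<partial>exit_law T"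
    have meas: "{x \<in> boundary T. ennreal (exp (- 1 / H0.g 0 x)) = ?C} \<in> sets (boundary_borel T)"
    proof -
      have "{x \<in> space (boundary_borel T). ennreal (exp (- 1 / H0.g 0 x)) = ?C} \<in> sets (boundary_borel T)"
        using H0.g_measurable[of 0] by measurable
      then show ?thesis using T by simp
    qed
    have all: "AE x in exit_law T. x \<in> boundary T \<and> H0.good x \<and> ennreal (exp (- 1 / H0.g 0 x)) = ?C"
      using Z.AE_initial[OF sets_exit_law meas Z.AE_g_0_const[OF good0 order.refl]] R_full good0
      by eventually_elim (use R_sub in auto)
    then obtain x0 where x0: "x0 \<in> boundary T" "H0.good x0" "ennreal (exp (- 1 / H0.g 0 x0)) = ?C"
      using \<mu>.prob_space eventually_happens'[OF \<mu>.ae_filter_bot all] by blast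
    have "AE x in exit_law T. H0.g 0 x = H0.g 0 x0"
      using all
    proof eventually_elim
      case (elim x)
      then have "exp (- 1 / H0.g 0 x) = exp (- 1 / H0.g 0 x0)" using x0(3) by (metis ennreal_inj exp_ge_zero)
      moreover have "0 < H0.g 0 x" "0 < H0.g 0 x0" using H0.g_pos elim x0 by blast+
      ultimately show ?case by (simp add: field_simps)
    qed
    then show ?thesis by (rule that)
  qed
  \<comment> \<open>The level-0 cell has mass 1, so G_0 and G_1 differ by the first weight at every
    good point, and G_1 inherits constancy from G_0.\<close>
  define c1 where "c1 = c0 - weight T 0"
  have good1: "AE x in bar_law T r1. H1.good x \<and> H1.g 0 x = c1"
    unfolding AE_bar_law using good0 c0
  proof eventually_elim
    case (elim x)
    show ?case
    proof
      assume x: "x \<in> boundary_at T r1"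
      then have "x \<in> boundary T" by (simp add: boundary_at_def)
      then show "H1.good x \<and> H1.g 0 x = c1"
        using H0_g_0[of x] H1_g[OF x, of 0] good_iff[OF x] elim by (simp add: c1_def)
    qed
  qed
  then have good1': "AE x in bar_law T r1. H1.good x" by eventually_elim simp
  have pos: "0 < c1" "c1 < c0"
  proof -
    have "AE x in bar_law T r1. 0 < c1"
      using good1 AE_space
      by eventually_elim (use H1.g_pos[of _ 0] H1.space_\<mu> in auto)
    then show "0 < c1" by simp
    show "c1 < c0" using T by (simp add: c1_def weighted_tree_def)
  qed
  have const1: "(\<integral>\<^sup>+y. H1.P 1 (\<lambda>_. 1) y \<partial>bar_law T r1) = ennreal (exp (- 1 / c1))"
  proof -
    have "(\<integral>\<^sup>+y. H1.P 1 (\<lambda>_. 1) y \<partial>bar_law T r1) = (\<integral>\<^sup>+y. ennreal (exp (- 1 / c1)) \<partial>bar_law T r1)"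
    proof (rule nn_integral_cong_AE)
      show "AE y in bar_law T r1. H1.P 1 (\<lambda>_. 1) y = ennreal (exp (- 1 / c1))"
        using good1 AE_space by eventually_elim (simp add: H1.P_one_good H1.space_\<mu>)
    qed
    then show ?thesis by (simp add: H1.emeasure_space_1)
  qed
  \<comment> \<open>Statements for almost every point of the boundary do not suffice: the kernel
    identities are needed at the positions of \<open>Xi_bar\<close>, and its starting point may have
    mass 0.\<close>
  have Y_good: "AE \<omega> in M. \<forall>x. Xi_bar s \<omega> = Some x \<longrightarrow>
      x \<in> boundary_at T r1 \<and> H1.good x \<and> H1.g 0 x = c1 \<and> H0.good x \<and> H0.g 0 x = c0" if s: "0 \<le> s" for s
    using Y.AE_good[OF s] Y.AE_g_0_const[OF good1' s] AE_space
  proof eventually_elim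
    case (elim \<omega>)
    show ?case
    proof (intro allI impI)
      fix x assume x: "Xi_bar s \<omega> = Some x"
      then have xb: "x \<in> boundary T" "x \<in> boundary_at T r1" using Y.W_live[OF s elim(3)] R' by auto
      have g: "H1.good x" "ennreal (exp (- 1 / H1.g 0 x)) = ennreal (exp (- 1 / c1))"
        using elim(1,2) x const1 by auto
      then have "exp (- 1 / H1.g 0 x) = exp (- 1 / c1)" by (metis ennreal_inj exp_ge_zero)
      moreover have "0 < H1.g 0 x" by (rule H1.g_pos[OF xb(1) g(1)])
      ultimately have g1: "H1.g 0 x = c1" using pos by (simp add: field_simps)
      have "H0.good x" using good_iff[OF xb(2)] g(1) by simp
      moreover from this have "H0.g 0 x = c0" using H0_g_0[OF xb(1)] H1_g[OF xb(2), of 0] g1 by (simp add: c1_def)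
      ultimately show "x \<in> boundary_at T r1 \<and> H1.good x \<and> H1.g 0 x = c1 \<and> H0.good x \<and> H0.g 0 x = c0"
        using xb(2) g(1) g1 by blast
    qed
  qed
  \<comment> \<open>\<open>Xi_bar\<close> sits at \<xi> at time 0 almost surely, so what holds at
    its positions holds at \<xi>; an assertion free of the sample point that is true almost surely
    is true.\<close>
  have \<xi>_good: "\<xi> \<in> boundary_at T r1 \<and> H1.good \<xi> \<and> H1.g 0 \<xi> = c1 \<and> H0.good \<xi> \<and> H0.g 0 \<xi> = c0"
  proof -
    have "AE \<omega> in M. \<xi> \<in> boundary_at T r1 \<and> H1.good \<xi> \<and> H1.g 0 \<xi> = c1 \<and> H0.good \<xi> \<and> H0.g 0 \<xi> = c0"
      using Y_good[OF order.refl] Y.AE_initial_point[OF refl \<xi>] by eventually_elim blast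
    then show ?thesis by simp
  qed
  then have \<xi>b: "\<xi> \<in> boundary T" by (simp add: boundary_at_def)
  define a where "a = 1 / c1"
  define b where "b = 1 / c0"
  have probB: "\<P>(\<omega> in M. B \<omega>) = 1 - b / a"
    using assms(9) \<xi>_good H0_g[OF \<xi>b, of 0] H0_g[OF \<xi>b, of 1] H1_g[of \<xi> 0] by (simp add: a_def b_def)
  have Bm: "B \<in> measurable M (count_space UNIV)"
    and pair_indep: "M.indep_set {B -` A \<inter> space M |A. A \<in> sets (count_space UNIV)}
      {(\<lambda>\<omega>. (path_of Xi_bar \<omega>, path_of Xi_mu \<omega>)) -` C \<inter> space M |C.
        C \<in> sets (path_space (bar_regular_top T r1) \<Otimes>\<^sub>M path_space (regular_top T))}"
    using assms(10) by (simp_all add: independent_elements_def)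
  have B_eq: "{\<omega> \<in> space M. B \<omega>} = B -` {True} \<inter> space M" by auto
  have indep: "emeasure M (F \<inter> {\<omega> \<in> space M. B \<omega>} \<inter> H) = emeasure M F * ennreal (1 - b / a) * emeasure M H"
    if su: "0 \<le> s" "0 \<le> u" and F: "F \<in> sets (Y.Pst s)" and H: "H \<in> sets (Z.Pst u)" for s u F H
  proof -
    obtain C where C: "C \<in> sets (path_space (bar_regular_top T r1))" "F = path_of Xi_bar -` C \<inter> space M"
      using Y.Pst_path[OF su(1) F] unfolding tops by blast
    obtain C' where C': "C' \<in> sets (path_space (regular_top T))" "H = path_of Xi_mu -` C' \<inter> space M"
      using Z.Pst_path[OF su(2) H] unfolding tops by blast
    let ?pair = "\<lambda>\<omega>. (path_of Xi_bar \<omega>, path_of Xi_mu \<omega>)"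
    have FH: "?pair -` (C \<times> C') \<inter> space M = F \<inter> H" using C(2) C'(2) by auto
    \<comment> \<open>Independence enters in two stages: the coin is separated from the pair of
      paths by means of a rectangle in the product space, and then the two paths from each
      other.\<close>
    have "measure M (({\<omega> \<in> space M. B \<omega>}) \<inter> (F \<inter> H)) = measure M {\<omega> \<in> space M. B \<omega>} * measure M (F \<inter> H)"
      unfolding B_eq FH[symmetric]
      by (rule M.indep_setD[OF pair_indep]) (use C(1) C'(1) in \<open>auto intro!: exI[of _ "C \<times> C'"]\<close>)
    also have "measure M (F \<inter> H) = measure M F * measure M H"
      using M.indep_varD[OF assms(8) C(1) C'(1)] unfolding FH C(2)[symmetric] C'(2)[symmetric] .
    finally have "measure M (F \<inter> {\<omega> \<in> space M. B \<omega>} \<inter> H) = measure M F * (1 - b / a) * measure M H"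
      using probB by (simp add: ac_simps)
    moreover have "0 \<le> 1 - b / a" using pos by (simp add: a_def b_def)
    ultimately show ?thesis by (simp add: M.emeasure_eq_measure ennreal_mult)
  qed
  interpret glued "bar_law T r1" T "Suc 0" "increment (bar_weight T r1)" r1 M R' "density_Xi_bar T r1" Xi_bar \<xi>
    "exit_law T" 0 "increment (weight T)" "origin T" R "density_Xi T" Xi_mu B a b
  proof (intro glued.intro glued_axioms.intro Y.ray_process_axioms Z.ray_process_axioms indep)
    show "0 < b" "b < a" using pos by (simp_all add: a_def b_def frac_less2)
    show "R' \<subseteq> R" "\<xi> \<in> R'" using R' \<xi> by auto
    show "{\<omega> \<in> space M. B \<omega>} \<in> sets M" unfolding B_eq by (rule measurable_sets[OF Bm]) simp
    show "AE \<omega> in M. lift (H1.P t (\<lambda>_. 1)) (Xi_bar s \<omega>) = lift (\<lambda>_. ennreal (exp (- (t * a)))) (Xi_bar s \<omega>)"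
      if "0 \<le> s" "0 \<le> t" for s t
      using Y_good[OF that(1)]
    proof eventually_elim
      case (elim \<omega>)
      show ?case
      proof (cases "Xi_bar s \<omega>")
        case (Some x)
        then have "x \<in> boundary T" "H1.good x" "H1.g 0 x = c1" using elim by (auto simp: boundary_at_def)
        then show ?thesis using Some H1.P_one[of x t] that(2) by (simp add: a_def)
      qed simp
    qed
    show "(\<integral>\<^sup>+x. H0.P t f x \<partial>exit_law T) = ennreal (exp (- (t * b))) * (\<integral>\<^sup>+x. f x \<partial>exit_law T)"
      if "0 < t" "f \<in> borel_measurable (boundary_borel T)" for t f
    proof -
      have "AE x in exit_law T. H0.good x \<and> H0.g 0 x = c0" using good0 c0 by eventually_elim simp
      from H0.nn_integral_P[OF this that] show ?thesis by (simp add: b_def)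
    qed
    show "AE \<omega> in M. lift (H0.P t f) (Xi_bar s \<omega>) =
        lift (\<lambda>y. H1.P t f y + ennreal (exp (- (t * b)) - exp (- (t * a))) * (\<integral>\<^sup>+x. f x \<partial>exit_law T)) (Xi_bar s \<omega>)"
      if "0 \<le> s" "0 < t" "f \<in> borel_measurable (boundary_borel T)" for s t f
      using Y_good[OF that(1)]
    proof eventually_elim
      case (elim \<omega>)
      show ?case
      proof (cases "Xi_bar s \<omega>")
        case (Some x)
        then have "x \<in> boundary_at T r1" "H1.g 0 x = c1" "H0.g 0 x = c0" using elim by auto
        then show ?thesis using Some P_decomposition[of x t f] that by (simp add: a_def b_def)
      qed simp
    qed
    show "AE x in exit_law T. H0.P t (\<lambda>_. 1) x \<le> 1" if "0 < t" for t
      using good0 AE_space by eventually_elim (use that H0.P_one_le space_exit_law in auto)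
    show "H0.P t (\<lambda>_. 1) \<xi> \<le> 1" if "0 < t" for t
      using H0.P_one_le[OF \<xi>b _ that] \<xi>_good by blast
  qed
  note glued_process = glue_is_process
  \<comment> \<open>With its Markov property established, the glued process has the cylinder
    probabilities given by \<Phi> at \<xi>, like any other process with these data; equality of the
    path laws then follows from equality on cylinders.\<close>
  interpret W: ray_process "exit_law T" T 0 "increment (weight T)" "origin T" M R "density_Xi T"
    "glue Xi_bar B Xi_mu" "return (boundary_borel T) \<xi>"
    by (rule ray_processI[OF H0.ray_hierarchy_axioms R_sets R_full _ glued_process]) (use H0_p R_sub in auto)
  have \<xi>R: "\<xi> \<in> R" using \<xi> R' by simp
  show ?thesis
  proof (intro conjI allI impI)
    show "process_Xi T (return (boundary_borel T) \<xi>) M (glue Xi_bar B Xi_mu)"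
      unfolding process_Xi_def tops by (rule glued_process)
    fix N :: "'v measure" and Xi_xi
    assume "process_Xi T (return (boundary_borel T) \<xi>) N Xi_xi"
    then have Xp: "sub_markov_process (subtopology (boundary_top T) R) (exit_law T) (density_Xi T)
        (return (boundary_borel T) \<xi>) N Xi_xi" by (simp only: process_Xi_def tops)
    interpret X: ray_process "exit_law T" T 0 "increment (weight T)" "origin T" N R "density_Xi T" Xi_xi
      "return (boundary_borel T) \<xi>"
      by (rule ray_processI[OF H0.ray_hierarchy_axioms R_sets R_full _ Xp]) (use H0_p R_sub in auto)
    show "distr M (path_space (regular_top T)) (path_of (glue Xi_bar B Xi_mu)) =
        distr N (path_space (regular_top T)) (path_of Xi_xi)"
      unfolding tops
    proof (rule path_law_eqI[OF T R_sub M.prob_space_axioms X.M.prob_space_axioms W.W_measurable X.W_measurable])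
      fix l :: "(real \<times> 'i) list" assume l: "sorted (map fst l)" "set l \<subseteq> {0..} \<times> sites T"
      show "emeasure M (hits T (space M) (glue Xi_bar B Xi_mu) l) = emeasure N (hits T (space N) Xi_xi l)"
        using W.emeasure_hits_point[OF refl \<xi>R l] X.emeasure_hits_point[OF refl \<xi>R l] by simp
    qed
  qed
qed

end
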